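(* Let $H$ be a finite group with character degrees $\{d_k\}$. If $H$ simultaneously realizes $\langle a_1,b_1,c_1\rangle,\dots,\langle a_n,b_n,c_n\rangle$, then $$\sum_{i=1}^n (a_ib_ic_i)^{\omega/3}\le\sum_k d_k^\omega,$$ where $\omega$ is the exponent of matrix multiplication over $\mathbb{C}$.
   Context: The exponent of matrix multiplication $\omega$ (over $\mathbb{C}$) is the smallest real number such that, for each $\varepsilon>0$, $n\times n$ matrix multiplication over $\mathbb{C}$ can be performed in $O(n^{\omega+\varepsilon})$ arithmetic operations. The character degrees of a finite group are the dimensions of its irreducible complex representations, one for each isomorphism class. For a subset $S$ of a group, $Q(S)=\{s_1s_2^{-1}:s_1,s_2\in S\}$. Subsets $S_1,S_2,S_3$ satisfy the triple product property if $q_i\in Q(S_i)$ and $q_1q_2q_3=1$ imply $q_1=q_2=q_3=1$. Triples of subsets $A_i,B_i,C_i$ ($1\le i\le n$) of a group $H$ satisfy the simultaneous triple product property if (i) for each $i$, $A_i,B_i,C_i$ satisfy the triple product property, and (ii) for all $i,j,k$, $a_i(a_j')^{-1}b_j(b_k')^{-1}c_k(c_i')^{-1}=1$ with $a_i\in A_i$, $a_j'\in A_j$, $b_j\in B_j$, $b_k'\in B_k$, $c_k\in C_k$, $c_i'\in C_i$ implies $i=j=k$. In that case $H$ is said to simultaneously realize $\langle|A_1|,|B_1|,|C_1|\rangle,\dots,\langle|A_n|,|B_n|,|C_n|\rangle$. *)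

theory Defs
  imports
    "HOL-Library.Landau_Symbols"
    "HOL-Library.Multiset"
    "HOL-Algebra.Group"
    "Jordan_Normal_Form.VS_Connect"
begin

section \<open>The exponent of matrix multiplication\<close>

text \<open>
  Straight-line programs over the complex numbers taking two square matrices as input.
  An operand is a complex constant, an entry of one of the two input matrices, or the result of
  an earlier instruction. Constants and input entries are free; each instruction is one
  arithmetic operation. A reference outside the matrices or to a later instruction, and a
  division by zero, have no value.
\<close>

datatype operand = Scalar complex | EntryA nat nat | EntryB nat nat | Result nat

datatype arith_op = Plus | Minus | Times | Divide

datatype instruction = Instr arith_op operand operand

fun operand_value :: "complex mat \<Rightarrow> complex mat \<Rightarrow> complex list \<Rightarrow> operand \<Rightarrow> complex option" where
  "operand_value A B vs (Scalar c) = Some c"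
| "operand_value A B vs (EntryA i j) =
     (if i < dim_row A \<and> j < dim_col A then Some (A $$ (i, j)) else None)"
| "operand_value A B vs (EntryB i j) =
     (if i < dim_row B \<and> j < dim_col B then Some (B $$ (i, j)) else None)"
| "operand_value A B vs (Result k) = (if k < length vs then Some (vs ! k) else None)"

fun apply_op :: "arith_op \<Rightarrow> complex \<Rightarrow> complex \<Rightarrow> complex option" where
  "apply_op Plus x y = Some (x + y)"
| "apply_op Minus x y = Some (x - y)"
| "apply_op Times x y = Some (x * y)"
| "apply_op Divide x y = (if y = 0 then None else Some (x / y))"

fun instr_value :: "complex mat \<Rightarrow> complex mat \<Rightarrow> complex list \<Rightarrow> instruction \<Rightarrow> complex option" where
  "instr_value A B vs (Instr f p q) =
     Option.bind (operand_value A B vs p) (\<lambda>x.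
     Option.bind (operand_value A B vs q) (\<lambda>y. apply_op f x y))"

fun run_program ::
  "complex mat \<Rightarrow> complex mat \<Rightarrow> complex list \<Rightarrow> instruction list \<Rightarrow> complex list option" where
  "run_program A B vs [] = Some vs"
| "run_program A B vs (c # cs) =
     Option.bind (instr_value A B vs c) (\<lambda>x. run_program A B (vs @ [x]) cs)"

text \<open>The operand \<open>out i j\<close> holds the \<open>(i, j)\<close> entry of the product when the program ends.\<close>

definition multiplies_matrices ::
  "nat \<Rightarrow> instruction list \<Rightarrow> (nat \<Rightarrow> nat \<Rightarrow> operand) \<Rightarrow> bool" where
  "multiplies_matrices n prog out \<longleftrightarrow>
     (\<forall>A \<in> carrier_mat n n. \<forall>B \<in> carrier_mat n n.
        \<exists>vs. run_program A B [] prog = Some vs \<and>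
          (\<forall>i<n. \<forall>j<n. operand_value A B vs (out i j) = Some ((A * B) $$ (i, j))))"

definition matrix_mult_in_ops :: "nat \<Rightarrow> nat \<Rightarrow> bool" where
  "matrix_mult_in_ops n t \<longleftrightarrow> (\<exists>prog out. multiplies_matrices n prog out \<and> length prog = t)"

definition matrix_mult_in_bigo :: "real \<Rightarrow> bool" where
  "matrix_mult_in_bigo \<tau> \<longleftrightarrow>
     (\<exists>t. (\<forall>n. matrix_mult_in_ops n (t n)) \<and> (\<lambda>n. real (t n)) \<in> O(\<lambda>n. real n powr \<tau>))"

definition matrix_mult_exponent :: real where
  "matrix_mult_exponent = (LEAST w. \<forall>\<epsilon>>0. matrix_mult_in_bigo (w + \<epsilon>))"

section \<open>Character degrees\<close>

text \<open>
  A complex representation of dimension \<open>d\<close> is a homomorphism to the general linear group, which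
  is the group of units of the ring of \<open>d \<times> d\<close> matrices. It is passed around as
  the pair \<open>(d, \<rho>)\<close>; the values of \<open>\<rho>\<close> off the carrier are irrelevant, and
  isomorphism ignores them.
\<close>

definition representation :: "('a, 'b) monoid_scheme \<Rightarrow> nat \<Rightarrow> ('a \<Rightarrow> complex mat) \<Rightarrow> bool" where
  "representation G d \<rho> \<longleftrightarrow> \<rho> \<in> hom G (units_of (ring_mat TYPE(complex) d ()))"

definition irreducible_representation ::
  "('a, 'b) monoid_scheme \<Rightarrow> nat \<Rightarrow> ('a \<Rightarrow> complex mat) \<Rightarrow> bool" where
  "irreducible_representation G d \<rho> \<longleftrightarrow>
     representation G d \<rho> \<and> d \<noteq> 0 \<and>
     (\<forall>W. subspace class_ring W (module_vec TYPE(complex) d) \<and>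
          (\<forall>g \<in> carrier G. \<forall>v \<in> W. \<rho> g *\<^sub>v v \<in> W)
        \<longrightarrow> W = {0\<^sub>v d} \<or> W = carrier_vec d)"

definition isomorphic_representations ::
  "('a, 'b) monoid_scheme \<Rightarrow> nat \<times> ('a \<Rightarrow> complex mat) \<Rightarrow> nat \<times> ('a \<Rightarrow> complex mat) \<Rightarrow> bool" where
  "isomorphic_representations G R R' \<longleftrightarrow>
     fst R = fst R' \<and>
     (\<exists>P \<in> carrier_mat (fst R) (fst R).
        invertible_mat P \<and> (\<forall>g \<in> carrier G. P * snd R g = snd R' g * P))"

definition irreducibles ::
  "('a, 'b) monoid_scheme \<Rightarrow> (nat \<times> ('a \<Rightarrow> complex mat)) set" where
  "irreducibles G = {(d, \<rho>). irreducible_representation G d \<rho>}"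

definition irreducible_classes ::
  "('a, 'b) monoid_scheme \<Rightarrow> (nat \<times> ('a \<Rightarrow> complex mat)) set set" where
  "irreducible_classes G =
     irreducibles G //
       {(R, R'). R \<in> irreducibles G \<and> R' \<in> irreducibles G \<and> isomorphic_representations G R R'}"

text \<open>
  All members of a class have the same first component, the dimension. For a finite group there
  are finitely many classes, so \<^const>\<open>mset_set\<close> lists each exactly once.
\<close>

definition character_degrees :: "('a, 'b) monoid_scheme \<Rightarrow> nat multiset" where
  "character_degrees G = image_mset (\<lambda>X. the_elem (fst ` X)) (mset_set (irreducible_classes G))"

section \<open>The simultaneous triple product property\<close>

definition quotient_set :: "('a, 'b) monoid_scheme \<Rightarrow> 'a set \<Rightarrow> 'a set" where
  "quotient_set G S = {s \<otimes>\<^bsub>G\<^esub> inv\<^bsub>G\<^esub> s' | s s'. s \<in> S \<and> s' \<in> S}"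

definition triple_product_property ::
  "('a, 'b) monoid_scheme \<Rightarrow> 'a set \<Rightarrow> 'a set \<Rightarrow> 'a set \<Rightarrow> bool" where
  "triple_product_property G S1 S2 S3 \<longleftrightarrow>
     (\<forall>q1 \<in> quotient_set G S1. \<forall>q2 \<in> quotient_set G S2. \<forall>q3 \<in> quotient_set G S3.
        q1 \<otimes>\<^bsub>G\<^esub> q2 \<otimes>\<^bsub>G\<^esub> q3 = \<one>\<^bsub>G\<^esub> \<longrightarrow>
        q1 = \<one>\<^bsub>G\<^esub> \<and> q2 = \<one>\<^bsub>G\<^esub> \<and> q3 = \<one>\<^bsub>G\<^esub>)"

definition simultaneous_triple_product_property ::
  "('a, 'b) monoid_scheme \<Rightarrow> nat \<Rightarrow> (nat \<Rightarrow> 'a set) \<Rightarrow> (nat \<Rightarrow> 'a set) \<Rightarrow> (nat \<Rightarrow> 'a set) \<Rightarrow> bool" where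
  "simultaneous_triple_product_property G n A B C \<longleftrightarrow>
     (\<forall>i \<in> {1..n}. triple_product_property G (A i) (B i) (C i)) \<and>
     (\<forall>i \<in> {1..n}. \<forall>j \<in> {1..n}. \<forall>k \<in> {1..n}.
        \<forall>a \<in> A i. \<forall>a' \<in> A j. \<forall>b \<in> B j. \<forall>b' \<in> B k. \<forall>c \<in> C k. \<forall>c' \<in> C i.
          a \<otimes>\<^bsub>G\<^esub> inv\<^bsub>G\<^esub> a' \<otimes>\<^bsub>G\<^esub> b \<otimes>\<^bsub>G\<^esub> inv\<^bsub>G\<^esub> b' \<otimes>\<^bsub>G\<^esub> c \<otimes>\<^bsub>G\<^esub> inv\<^bsub>G\<^esub> c' = \<one>\<^bsub>G\<^esub>
          \<longrightarrow> i = j \<and> j = k)"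

definition simultaneously_realizes ::
  "('a, 'b) monoid_scheme \<Rightarrow> nat \<Rightarrow> (nat \<Rightarrow> nat) \<Rightarrow> (nat \<Rightarrow> nat) \<Rightarrow> (nat \<Rightarrow> nat) \<Rightarrow> bool" where
  "simultaneously_realizes G n a b c \<longleftrightarrow>
     (\<exists>A B C.
        (\<forall>i \<in> {1..n}. A i \<subseteq> carrier G \<and> B i \<subseteq> carrier G \<and> C i \<subseteq> carrier G \<and>
           card (A i) = a i \<and> card (B i) = b i \<and> card (C i) = c i) \<and>
        simultaneous_triple_product_property G n A B C)"

end

(*
  Tensor rank carries the whole argument.  Let R(m) be the rank of m x m matrix multiplication
  and w the exponent.  A program without zero divisions has constant divisors, so truncating
  at degree 2 turns a program with t instructions into R(m) <= 2 t; conversely, block recursion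
  turns rank into programs.  Hence m^w <= R(m) <= C m^(w + eps).

  By Maschke's theorem and Schur's lemma the multiplication tensor [x y z = 1] of the group is a
  restriction of the direct sum of the matrix multiplications <d_k, d_k, d_k>, and by the
  simultaneous triple product property it contains the direct sum of the <a_i, b_i, c_i>.  Take
  m-th powers, keep only the index sequences of one popular type, and tensor the three cyclic
  rotations: the result is a direct sum of L equal products <q, q, q>.  Performing the outer
  multiplications of a D x D algorithm in batches of L gives
  R(D q) <= (R(D) / L + 1) * SUM R(d_k), whence L q^w <= SUM d_k^w in the limit.
*)
theory Submission
  imports
    Defs
    "HOL-Computational_Algebra.Fundamental_Theorem_Algebra"
    "HOL-Real_Asymp.Real_Asymp"
begin

section \<open>Tensor rank\<close>

text \<open>The exponent speaks of one square product at a time, whereas the group yields a direct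
  sum of rectangular ones; the proof has to repair both mismatches. Summands of one type share one
  format <v 0, v 1, v 2>, and tensoring with its two rotations makes it square with q = v 0 * v 1 *
  v 2. These three factors are the source of w / 3: the inequality is proved for the cubes of both
  sides. A direct sum of L equal products performs L independent products, and independent products
  are what the rank-one terms of an outer D x D algorithm supply. The rank of that algorithm is D ^
  w only up to D ^ eps, and D >= L grows exponentially with m. The loss is thus the m-th power of a
  constant to the eps: it survives the m-th root and goes only with eps -> 0 at the very end, while
  the constants and the (m + 1) ^ card I types disappear in the root. Two points come before all
  this: the exponent is a \<open>LEAST\<close> over the reals, whose existence has to be shown, and
  m ^ w <= R(m) must hold for every positive m without a constant.\<close>

definition rank_le ::
  "nat \<Rightarrow> 'x set \<Rightarrow> 'y set \<Rightarrow> 'z set \<Rightarrow> ('x \<Rightarrow> 'y \<Rightarrow> 'z \<Rightarrow> complex) \<Rightarrow> bool" where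
  "rank_le r X Y Z t \<longleftrightarrow>
     (\<exists>u v w. \<forall>x\<in>X. \<forall>y\<in>Y. \<forall>z\<in>Z. t x y z = (\<Sum>l<r. u l x * v l y * w l z))"

lemma rank_leE:
  assumes "rank_le r X Y Z t"
  obtains u v w where
    "\<And>x y z. x \<in> X \<Longrightarrow> y \<in> Y \<Longrightarrow> z \<in> Z \<Longrightarrow> t x y z = (\<Sum>l<r. u l x * v l y * w l z)"
  using assms unfolding rank_le_def by blast

lemma rank_leI:
  fixes u :: "'l \<Rightarrow> 'x \<Rightarrow> complex"
  assumes "finite A" "card A \<le> r"
    and eq: "\<And>x y z. x \<in> X \<Longrightarrow> y \<in> Y \<Longrightarrow> z \<in> Z \<Longrightarrow> t x y z = (\<Sum>l\<in>A. u l x * v l y * w l z)"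
  shows "rank_le r X Y Z t"
proof -
  obtain h where h: "bij_betw h {..<card A} A"
    using ex_bij_betw_nat_finite[OF \<open>finite A\<close>] by (metis atLeast0LessThan)
  \<comment> \<open>One zero factor kills a term, so padding \<open>u\<close> alone extends the
    decomposition to exactly \<open>r\<close> terms.\<close>
  define u' where "u' l = (if l < card A then u (h l) else (\<lambda>_. 0))" for l
  have "t x y z = (\<Sum>l<r. u' l x * v (h l) y * w (h l) z)"
    if "x \<in> X" "y \<in> Y" "z \<in> Z" for x y z
  proof -
    have "t x y z = (\<Sum>l<card A. u (h l) x * v (h l) y * w (h l) z)"
      using eq[OF that] sum.reindex_bij_betw[OF h, of "\<lambda>l. u l x * v l y * w l z"] by simp
    also have "\<dots> = (\<Sum>l<card A. u' l x * v (h l) y * w (h l) z)"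
      by (simp add: u'_def)
    also have "\<dots> = (\<Sum>l<r. u' l x * v (h l) y * w (h l) z)"
      using \<open>card A \<le> r\<close> by (intro sum.mono_neutral_left) (auto simp: u'_def)
    finally show ?thesis .
  qed
  then show ?thesis
    unfolding rank_le_def by (intro exI[of _ u'] exI[of _ "\<lambda>l. v (h l)"] exI[of _ "\<lambda>l. w (h l)"]) simp
qed

lemma rank_le_sum:
  assumes "finite K" and rank: "\<And>k. k \<in> K \<Longrightarrow> rank_le (r k) X Y Z (t k)"
  shows "rank_le (\<Sum>k\<in>K. r k) X Y Z (\<lambda>x y z. \<Sum>k\<in>K. t k x y z)"
proof -
  have "\<forall>k\<in>K. \<exists>u v w. \<forall>x\<in>X. \<forall>y\<in>Y. \<forall>z\<in>Z. t k x y z = (\<Sum>l<r k. u l x * v l y * w l z)"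
    using rank unfolding rank_le_def by blast
  then obtain u v w where
    uvw: "\<And>k x y z. k \<in> K \<Longrightarrow> x \<in> X \<Longrightarrow> y \<in> Y \<Longrightarrow> z \<in> Z \<Longrightarrow>
           t k x y z = (\<Sum>l<r k. u k l x * v k l y * w k l z)"
    by metis
  show ?thesis
  proof (rule rank_leI[where A = "SIGMA k:K. {..<r k}" and u = "\<lambda>(k, l). u k l"
        and v = "\<lambda>(k, l). v k l" and w = "\<lambda>(k, l). w k l"])
    show "(\<Sum>k\<in>K. t k x y z) = (\<Sum>kl\<in>(SIGMA k:K. {..<r k}).
        (case kl of (k, l) \<Rightarrow> u k l) x * (case kl of (k, l) \<Rightarrow> v k l) y * (case kl of (k, l) \<Rightarrow> w k l) z)"
      if "x \<in> X" "y \<in> Y" "z \<in> Z" for x y z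
    proof -
      have "(\<Sum>k\<in>K. t k x y z) = (\<Sum>k\<in>K. \<Sum>l<r k. u k l x * v k l y * w k l z)"
        by (intro sum.cong refl) (simp add: uvw that)
      also have "\<dots> = (\<Sum>(k, l)\<in>(SIGMA k:K. {..<r k}). u k l x * v k l y * w k l z)"
        using assms(1) by (intro sum.Sigma) auto
      finally show ?thesis
        by (simp add: split_def)
    qed
  qed (use assms(1) in auto)
qed

lemma sum_product3:
  fixes f g h :: "_ \<Rightarrow> 'a :: comm_semiring_0"
  shows "sum f A * sum g B * sum h C = (\<Sum>l\<in>A. \<Sum>m\<in>B. \<Sum>n\<in>C. f l * g m * h n)"
proof -
  have "sum f A * sum g B * sum h C = (\<Sum>l\<in>A. (\<Sum>m\<in>B. f l * g m) * sum h C)"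
    by (subst sum_product) (simp only: sum_distrib_right)
  then show ?thesis
    by (simp only: sum_product)
qed

text \<open>A linear substitution in each of the three arguments acts on a decomposition factor by
  factor and so keeps the number of terms. The element \<open>f l x\<close> may depend on both
  \<open>l\<close> and \<open>x\<close>: this covers relabelling, as in
  \<open>rank_le_pullback\<close>, as well as genuine linear combinations, as in
  \<open>rank_le_triangle\<close> and in the batches.\<close>

lemma rank_le_restrict:
  fixes \<alpha> :: "'l \<Rightarrow> 'x \<Rightarrow> complex" and \<beta> :: "'m \<Rightarrow> 'y \<Rightarrow> complex" and \<gamma> :: "'n \<Rightarrow> 'z \<Rightarrow> complex"
  assumes rank: "rank_le r X' Y' Z' t'"
    and f: "\<And>l x. l \<in> A \<Longrightarrow> x \<in> X \<Longrightarrow> f l x \<in> X'"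
    and g: "\<And>m y. m \<in> B \<Longrightarrow> y \<in> Y \<Longrightarrow> g m y \<in> Y'"
    and h: "\<And>n z. n \<in> C \<Longrightarrow> z \<in> Z \<Longrightarrow> h n z \<in> Z'"
    and eq: "\<And>x y z. x \<in> X \<Longrightarrow> y \<in> Y \<Longrightarrow> z \<in> Z \<Longrightarrow>
      t x y z = (\<Sum>l\<in>A. \<Sum>m\<in>B. \<Sum>n\<in>C. \<alpha> l x * \<beta> m y * \<gamma> n z * t' (f l x) (g m y) (h n z))"
  shows "rank_le r X Y Z t"
proof -
  obtain u v w where
    uvw: "\<And>x y z. x \<in> X' \<Longrightarrow> y \<in> Y' \<Longrightarrow> z \<in> Z' \<Longrightarrow> t' x y z = (\<Sum>s<r. u s x * v s y * w s z)"
    using rank_leE[OF rank] by metis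
  have "t x y z = (\<Sum>s<r. (\<Sum>l\<in>A. \<alpha> l x * u s (f l x)) * (\<Sum>m\<in>B. \<beta> m y * v s (g m y)) *
                     (\<Sum>n\<in>C. \<gamma> n z * w s (h n z)))"
    if "x \<in> X" "y \<in> Y" "z \<in> Z" for x y z
  proof -
    have "t x y z = (\<Sum>l\<in>A. \<Sum>m\<in>B. \<Sum>n\<in>C. \<Sum>s<r.
        (\<alpha> l x * u s (f l x)) * (\<beta> m y * v s (g m y)) * (\<gamma> n z * w s (h n z)))"
      unfolding eq[OF that]
      by (intro sum.cong refl) (simp add: uvw f g h that sum_distrib_left mult_ac)
    also have "\<dots> = (\<Sum>l\<in>A. \<Sum>m\<in>B. \<Sum>s<r. \<Sum>n\<in>C.
        (\<alpha> l x * u s (f l x)) * (\<beta> m y * v s (g m y)) * (\<gamma> n z * w s (h n z)))"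
      by (intro sum.cong refl sum.swap)
    also have "\<dots> = (\<Sum>l\<in>A. \<Sum>s<r. \<Sum>m\<in>B. \<Sum>n\<in>C.
        (\<alpha> l x * u s (f l x)) * (\<beta> m y * v s (g m y)) * (\<gamma> n z * w s (h n z)))"
      by (intro sum.cong refl sum.swap)
    also have "\<dots> = (\<Sum>s<r. \<Sum>l\<in>A. \<Sum>m\<in>B. \<Sum>n\<in>C.
        (\<alpha> l x * u s (f l x)) * (\<beta> m y * v s (g m y)) * (\<gamma> n z * w s (h n z)))"
      by (rule sum.swap)
    also have "\<dots> = (\<Sum>s<r. (\<Sum>l\<in>A. \<alpha> l x * u s (f l x)) * (\<Sum>m\<in>B. \<beta> m y * v s (g m y)) *
                     (\<Sum>n\<in>C. \<gamma> n z * w s (h n z)))"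
      by (simp only: sum_product3)
    finally show ?thesis .
  qed
  then show ?thesis
    unfolding rank_le_def
    by (intro exI[of _ "\<lambda>s x. \<Sum>l\<in>A. \<alpha> l x * u s (f l x)"] exI[of _ "\<lambda>s y. \<Sum>m\<in>B. \<beta> m y * v s (g m y)"]
        exI[of _ "\<lambda>s z. \<Sum>n\<in>C. \<gamma> n z * w s (h n z)"]) simp
qed

lemma rank_le_pullback:
  assumes "rank_le r X' Y' Z' t'" "f ` X \<subseteq> X'" "g ` Y \<subseteq> Y'" "h ` Z \<subseteq> Z'"
    and "\<And>x y z. x \<in> X \<Longrightarrow> y \<in> Y \<Longrightarrow> z \<in> Z \<Longrightarrow> t x y z = t' (f x) (g y) (h z)"
  shows "rank_le r X Y Z t"
  using assms
  by (intro rank_le_restrict[where A = "{()}" and B = "{()}" and C = "{()}" and \<alpha> = "\<lambda>_ _. 1"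
        and \<beta> = "\<lambda>_ _. 1" and \<gamma> = "\<lambda>_ _. 1" and f = "\<lambda>_. f" and g = "\<lambda>_. g" and h = "\<lambda>_. h"]) auto

section \<open>The rank of matrix multiplication\<close>

text \<open>The third argument is indexed by (column, row) of the product, so the tensor is the
  trace of a triple product. In this form it is invariant under cyclic rotation of its
  arguments.\<close>

definition mm :: "'i \<times> 'j \<Rightarrow> 'j \<times> 'k \<Rightarrow> 'k \<times> 'i \<Rightarrow> complex" where
  "mm x y z = of_bool (snd x = fst y \<and> snd y = fst z \<and> snd z = fst x)"

definition mm_rank_le :: "nat \<Rightarrow> 'i set \<Rightarrow> bool" where
  "mm_rank_le r S \<longleftrightarrow> rank_le r (S \<times> S) (S \<times> S) (S \<times> S) mm"

definition mmrank :: "nat \<Rightarrow> nat" where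
  "mmrank m = (LEAST r. mm_rank_le r {..<m})"

lemma mm_rank_le_cong:
  assumes "mm_rank_le r S" "finite S" "finite T" "card T \<le> card S"
  shows "mm_rank_le r T"
proof -
  obtain f where f: "inj_on f T" "f ` T \<subseteq> S"
    using card_le_inj assms(2-4) by blast
  have "f a = f b \<longleftrightarrow> a = b" if "a \<in> T" "b \<in> T" for a b
    using f that by (auto dest: inj_onD)
  then show ?thesis
    using assms(1) f(2) unfolding mm_rank_le_def
    by (elim rank_le_pullback[where f = "map_prod f f" and g = "map_prod f f" and h = "map_prod f f"])
       (auto simp: mm_def)
qed

text \<open>The schoolbook algorithm. It makes the \<open>LEAST\<close> in \<open>mmrank\<close>
  range over a nonempty set, so that \<open>mmrank\<close> is itself a valid number of
  terms.\<close>

lemma mm_rank_le_cube: "mm_rank_le (m ^ 3) {..<m}"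
  unfolding mm_rank_le_def
proof (rule rank_leI[where A = "{..<m} \<times> {..<m} \<times> {..<m}"
      and u = "\<lambda>(i, j, k) x. of_bool (x = (i, j))"
      and v = "\<lambda>(i, j, k) y. of_bool (y = (j, k))"
      and w = "\<lambda>(i, j, k) z. of_bool (z = (k, i))"])
  fix x y z :: "nat \<times> nat"
  assume "x \<in> {..<m} \<times> {..<m}" "y \<in> {..<m} \<times> {..<m}" "z \<in> {..<m} \<times> {..<m}"
  then obtain i j j' k k' i' where x: "x = (i, j)" "i < m" "j < m" and y: "y = (j', k)" "j' < m" "k < m"
    and z: "z = (k', i')" "k' < m" "i' < m"
    by auto
  have "(\<Sum>l\<in>{..<m} \<times> {..<m} \<times> {..<m}.
      (case l of (i, j, k) \<Rightarrow> \<lambda>x. of_bool (x = (i, j))) x * (case l of (i, j, k) \<Rightarrow> \<lambda>y. of_bool (y = (j, k))) y *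
      (case l of (i, j, k) \<Rightarrow> \<lambda>z. of_bool (z = (k, i))) z)
    = (\<Sum>l\<in>{..<m} \<times> {..<m} \<times> {..<m}. if l = (i, j, k) then of_bool (j = j' \<and> k = k' \<and> i = i') else (0::complex))"
    by (intro sum.cong refl) (auto simp: x y z split: prod.splits)
  also have "\<dots> = mm x y z"
    using x y z by (subst sum.delta) (auto simp: mm_def)
  finally show "mm x y z = (\<Sum>l\<in>{..<m} \<times> {..<m} \<times> {..<m}.
      (case l of (i, j, k) \<Rightarrow> \<lambda>x. of_bool (x = (i, j))) x * (case l of (i, j, k) \<Rightarrow> \<lambda>y. of_bool (y = (j, k))) y *
      (case l of (i, j, k) \<Rightarrow> \<lambda>z. of_bool (z = (k, i))) z)" by (rule sym)
qed (auto simp: power3_eq_cube)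

lemma mm_rank_le_mmrank:
  assumes "finite S" "card S = m"
  shows "mm_rank_le (mmrank m) S"
proof -
  have "mm_rank_le (mmrank m) {..<m}"
    unfolding mmrank_def by (rule LeastI[of _ "m ^ 3"]) (rule mm_rank_le_cube)
  then show ?thesis
    by (rule mm_rank_le_cong) (use assms in auto)
qed

lemma mmrank_le:
  assumes "mm_rank_le r S" "finite S" "card S = m"
  shows "mmrank m \<le> r"
  unfolding mmrank_def by (rule Least_le) (use mm_rank_le_cong[OF assms(1,2), of "{..<m}"] assms in simp)

text \<open>If \<open>r < m\<close>, zero padding gives square matrices with \<open>U' * V'\<close>
  the identity. A one-sided inverse of a square matrix is two-sided, but row \<open>r\<close> of
  \<open>V'\<close> is zero, so \<open>V' * U'\<close> cannot be the identity.\<close>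

lemma left_inverse_dimension_le:
  fixes U V :: "nat \<Rightarrow> nat \<Rightarrow> complex"
  assumes "\<And>i j. i < m \<Longrightarrow> j < m \<Longrightarrow> (\<Sum>l<r. U i l * V l j) = of_bool (i = j)"
  shows "m \<le> r"
proof (rule ccontr)
  assume "\<not> m \<le> r"
  define U' where "U' = mat m m (\<lambda>(i, l). if l < r then U i l else 0)"
  define V' where "V' = mat m m (\<lambda>(l, j). if l < r then V l j else 0)"
  have carrier: "U' \<in> carrier_mat m m" "V' \<in> carrier_mat m m"
    by (auto simp: U'_def V'_def)
  have "U' * V' = 1\<^sub>m m"
  proof (rule eq_matI)
    fix i j assume ij: "i < dim_row (1\<^sub>m m)" "j < dim_col (1\<^sub>m m)"
    then have "(U' * V') $$ (i, j) = (\<Sum>l<m. (if l < r then U i l else 0) * (if l < r then V l j else 0))"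
      by (simp add: U'_def V'_def scalar_prod_def atLeast0LessThan)
    also have "\<dots> = (\<Sum>l<r. U i l * V l j)"
      using \<open>\<not> m \<le> r\<close> by (intro sum.mono_neutral_cong_right) auto
    finally show "(U' * V') $$ (i, j) = 1\<^sub>m m $$ (i, j)"
      using assms[of i j] ij by auto
  qed (auto simp: U'_def V'_def)
  then have "V' * U' = 1\<^sub>m m"
    by (rule mat_mult_left_right_inverse[OF carrier])
  moreover have "(V' * U') $$ (r, r) = 0"
    using \<open>\<not> m \<le> r\<close> by (simp add: U'_def V'_def scalar_prod_def)
  ultimately show False
    using \<open>\<not> m \<le> r\<close> by simp
qed

text \<open>Flattening: the arguments \<open>(j, 0)\<close> and \<open>(0, i)\<close> turn the
  tensor into the coordinate functional of entry \<open>(i, j)\<close> of the first matrix. So the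
  m^2 vectors formed by the values of \<open>u\<close> have a dual family in dimension
  \<open>mmrank m\<close>, and \<open>left_inverse_dimension_le\<close> applies.\<close>

lemma mmrank_ge_square: "m\<^sup>2 \<le> mmrank m"
proof (cases "m = 0")
  case False
  obtain u v w where
    uvw: "\<And>x y z. x \<in> {..<m} \<times> {..<m} \<Longrightarrow> y \<in> {..<m} \<times> {..<m} \<Longrightarrow> z \<in> {..<m} \<times> {..<m} \<Longrightarrow>
        mm x y z = (\<Sum>l<mmrank m. u l x * v l y * w l z)"
    using mm_rank_le_mmrank[of "{..<m}" m] unfolding mm_rank_le_def rank_le_def by auto
  obtain h where h: "bij_betw h {..<m\<^sup>2} ({..<m} \<times> {..<m})"
    using ex_bij_betw_nat_finite[of "{..<m} \<times> {..<m}"] by (auto simp: power2_eq_square atLeast0LessThan)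
  show ?thesis
  proof (rule left_inverse_dimension_le)
    fix a b assume ab: "a < m\<^sup>2" "b < m\<^sup>2"
    then have mem: "h a \<in> {..<m} \<times> {..<m}" "h b \<in> {..<m} \<times> {..<m}"
      using h by (auto dest: bij_betwE)
    have eq: "h a = h b \<longleftrightarrow> a = b"
      using h ab by (auto simp: bij_betw_def dest: inj_onD)
    have "(\<Sum>l<mmrank m. u l (h a) * (v l (snd (h b), 0) * w l (0, fst (h b)))) = mm (h a) (snd (h b), 0 :: nat) (0, fst (h b))"
      using mem False uvw[of "h a" "(snd (h b), 0)" "(0, fst (h b))"] by (simp add: mult.assoc mem_Times_iff)
    also have "\<dots> = of_bool (h a = h b)"
      by (auto simp: mm_def prod_eq_iff)
    finally show "(\<Sum>l<mmrank m. u l (h a) * (v l (snd (h b), 0) * w l (0, fst (h b)))) = of_bool (a = b)"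
      using eq by simp
  qed
qed simp

section \<open>From programs to rank\<close>

text \<open>Linearity in the pair (A, B) enters through this one consequence, the splitting into a
  part from A and a part from B. A rank decomposition asks for values on matrix units, and the
  splitting tells which of the two matrices each value comes from.\<close>

definition additive_on_pairs :: "nat \<Rightarrow> (complex mat \<Rightarrow> complex mat \<Rightarrow> complex) \<Rightarrow> bool" where
  "additive_on_pairs n f \<longleftrightarrow>
     (\<forall>A\<in>carrier_mat n n. \<forall>B\<in>carrier_mat n n. f A B = f A (0\<^sub>m n n) + f (0\<^sub>m n n) B)"

definition span_of_products ::
  "nat \<Rightarrow> ((complex mat \<Rightarrow> complex mat \<Rightarrow> complex) \<times> (complex mat \<Rightarrow> complex mat \<Rightarrow> complex)) list \<Rightarrow>
     (complex mat \<Rightarrow> complex mat \<Rightarrow> complex) \<Rightarrow> bool" where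
  "span_of_products n ps f \<longleftrightarrow>
     (\<exists>c. \<forall>A\<in>carrier_mat n n. \<forall>B\<in>carrier_mat n n.
        f A B = (\<Sum>l<length ps. c l * fst (ps ! l) A B * snd (ps ! l) A B))"

text \<open>
  Along the line \<open>s \<mapsto> (s A, s B)\<close> every value occurring in a program is a polynomial in \<open>s\<close>.
  Its constant coefficient does not depend on \<open>A\<close> and \<open>B\<close>, its linear coefficient is a linear
  form, and its quadratic coefficient is a combination of one product of linear forms per
  instruction.
\<close>

definition truncation ::
  "nat \<Rightarrow> ((complex mat \<Rightarrow> complex mat \<Rightarrow> complex) \<times> (complex mat \<Rightarrow> complex mat \<Rightarrow> complex)) list \<Rightarrow>
     (complex mat \<Rightarrow> complex mat \<Rightarrow> complex) \<Rightarrow> complex \<Rightarrow> (complex mat \<Rightarrow> complex mat \<Rightarrow> complex poly) \<Rightarrow> bool" where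
  "truncation n ps f c p \<longleftrightarrow>
     (\<forall>A\<in>carrier_mat n n. \<forall>B\<in>carrier_mat n n.
        (\<forall>s. f (s \<cdot>\<^sub>m A) (s \<cdot>\<^sub>m B) = poly (p A B) s) \<and> coeff (p A B) 0 = c) \<and>
     additive_on_pairs n (\<lambda>A B. coeff (p A B) 1) \<and>
     span_of_products n ps (\<lambda>A B. coeff (p A B) 2)"

definition truncates ::
  "nat \<Rightarrow> ((complex mat \<Rightarrow> complex mat \<Rightarrow> complex) \<times> (complex mat \<Rightarrow> complex mat \<Rightarrow> complex)) list \<Rightarrow>
     (complex mat \<Rightarrow> complex mat \<Rightarrow> complex) \<Rightarrow> bool" where
  "truncates n ps f \<longleftrightarrow> (\<exists>c p. truncation n ps f c p)"

lemma truncatesI: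
  assumes "\<And>A B s. A \<in> carrier_mat n n \<Longrightarrow> B \<in> carrier_mat n n \<Longrightarrow>
      f (s \<cdot>\<^sub>m A) (s \<cdot>\<^sub>m B) = poly (p A B) s"
    and "\<And>A B. A \<in> carrier_mat n n \<Longrightarrow> B \<in> carrier_mat n n \<Longrightarrow> coeff (p A B) 0 = c"
    and "additive_on_pairs n (\<lambda>A B. coeff (p A B) 1)"
    and "span_of_products n ps (\<lambda>A B. coeff (p A B) 2)"
  shows "truncates n ps f"
  unfolding truncates_def truncation_def by (rule exI[of _ c], rule exI[of _ p]) (use assms in simp)

lemma truncationD:
  assumes "truncation n ps f c p"
  shows "\<And>A B s. A \<in> carrier_mat n n \<Longrightarrow> B \<in> carrier_mat n n \<Longrightarrow> f (s \<cdot>\<^sub>m A) (s \<cdot>\<^sub>m B) = poly (p A B) s"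
    and "\<And>A B. A \<in> carrier_mat n n \<Longrightarrow> B \<in> carrier_mat n n \<Longrightarrow> coeff (p A B) 0 = c"
    and "additive_on_pairs n (\<lambda>A B. coeff (p A B) 1)"
    and "span_of_products n ps (\<lambda>A B. coeff (p A B) 2)"
  using assms unfolding truncation_def by blast+

lemma additive_on_pairsD:
  "additive_on_pairs n f \<Longrightarrow> A \<in> carrier_mat n n \<Longrightarrow> B \<in> carrier_mat n n \<Longrightarrow>
     f A B = f A (0\<^sub>m n n) + f (0\<^sub>m n n) B"
  unfolding additive_on_pairs_def by blast

lemma additive_on_pairs_cong:
  assumes "additive_on_pairs n f"
    and eq: "\<And>A B. A \<in> carrier_mat n n \<Longrightarrow> B \<in> carrier_mat n n \<Longrightarrow> f A B = g A B"
  shows "additive_on_pairs n g"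
  unfolding additive_on_pairs_def
proof (intro ballI)
  fix A B :: "complex mat" assume "A \<in> carrier_mat n n" "B \<in> carrier_mat n n"
  then show "g A B = g A (0\<^sub>m n n) + g (0\<^sub>m n n) B"
    using additive_on_pairsD[OF assms(1)] eq[symmetric] by (metis zero_carrier_mat)
qed

lemma additive_on_pairs_lincomb:
  assumes "additive_on_pairs n f" "additive_on_pairs n g"
  shows "additive_on_pairs n (\<lambda>A B. a * f A B + b * g A B)"
  unfolding additive_on_pairs_def
proof (intro ballI)
  fix A B :: "complex mat" assume AB: "A \<in> carrier_mat n n" "B \<in> carrier_mat n n"
  have "f A B = f A (0\<^sub>m n n) + f (0\<^sub>m n n) B" "g A B = g A (0\<^sub>m n n) + g (0\<^sub>m n n) B"
    using additive_on_pairsD[OF assms(1) AB] additive_on_pairsD[OF assms(2) AB] by blast+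
  then show "a * f A B + b * g A B = a * f A (0\<^sub>m n n) + b * g A (0\<^sub>m n n) +
      (a * f (0\<^sub>m n n) B + b * g (0\<^sub>m n n) B)"
    by (simp add: algebra_simps)
qed

lemma span_of_productsE:
  assumes "span_of_products n ps f"
  obtains c where "\<And>A B. A \<in> carrier_mat n n \<Longrightarrow> B \<in> carrier_mat n n \<Longrightarrow>
      f A B = (\<Sum>l<length ps. c l * fst (ps ! l) A B * snd (ps ! l) A B)"
  using assms unfolding span_of_products_def by blast

lemma span_of_products_zero: "span_of_products n ps (\<lambda>A B. 0)"
  unfolding span_of_products_def by (rule exI[of _ "\<lambda>_. 0"]) simp

lemma span_of_products_lincomb:
  assumes "span_of_products n ps f" "span_of_products n ps g"
  shows "span_of_products n ps (\<lambda>A B. a * f A B + b * g A B)"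
proof -
  obtain c where c: "\<And>A B. A \<in> carrier_mat n n \<Longrightarrow> B \<in> carrier_mat n n \<Longrightarrow>
      f A B = (\<Sum>l<length ps. c l * fst (ps ! l) A B * snd (ps ! l) A B)"
    using span_of_productsE[OF assms(1)] by blast
  obtain d where d: "\<And>A B. A \<in> carrier_mat n n \<Longrightarrow> B \<in> carrier_mat n n \<Longrightarrow>
      g A B = (\<Sum>l<length ps. d l * fst (ps ! l) A B * snd (ps ! l) A B)"
    using span_of_productsE[OF assms(2)] by blast
  have eq: "a * f A B + b * g A B = (\<Sum>l<length ps. (a * c l + b * d l) * fst (ps ! l) A B * snd (ps ! l) A B)"
    if "A \<in> carrier_mat n n" "B \<in> carrier_mat n n" for A B
    by (simp add: c[OF that] d[OF that] sum_distrib_left sum.distrib distrib_right mult.assoc)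
  show ?thesis
    unfolding span_of_products_def
    by (rule exI[of _ "\<lambda>l. a * c l + b * d l"], intro ballI, rule eq)
qed

lemma span_of_products_snoc:
  assumes "span_of_products n ps f"
  shows "span_of_products n (ps @ [uw]) f"
proof -
  obtain c where
    "\<And>A B. A \<in> carrier_mat n n \<Longrightarrow> B \<in> carrier_mat n n \<Longrightarrow>
      f A B = (\<Sum>l<length ps. c l * fst (ps ! l) A B * snd (ps ! l) A B)"
    using span_of_productsE[OF assms] by blast
  then show ?thesis
    unfolding span_of_products_def
    by (intro exI[of _ "\<lambda>l. if l < length ps then c l else 0"]) (simp add: nth_append)
qed

lemma span_of_products_last: "span_of_products n (ps @ [(u, w)]) (\<lambda>A B. u A B * w A B)"
  unfolding span_of_products_def
  by (intro exI[of _ "\<lambda>l. if l < length ps then 0 else 1"]) (simp add: nth_append)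

lemma truncates_snoc: "truncates n ps f \<Longrightarrow> truncates n (ps @ [uw]) f"
  unfolding truncates_def truncation_def using span_of_products_snoc by blast

lemma truncates_cong:
  assumes "truncates n ps f"
    and "\<And>A B. A \<in> carrier_mat n n \<Longrightarrow> B \<in> carrier_mat n n \<Longrightarrow> f A B = g A B"
  shows "truncates n ps g"
proof -
  obtain c p where "truncation n ps f c p"
    using assms(1) unfolding truncates_def by blast
  note p = truncationD[OF this]
  have "g (s \<cdot>\<^sub>m A) (s \<cdot>\<^sub>m B) = poly (p A B) s"
    if "A \<in> carrier_mat n n" "B \<in> carrier_mat n n" for A B s
    using p(1)[OF that, of s] that by (subst assms(2)[symmetric]) auto
  then show ?thesis
    by (rule truncatesI[OF _ p(2-4)])
qed

lemma truncates_const: "truncates n ps (\<lambda>A B. c)"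
  by (rule truncatesI[where p = "\<lambda>A B. [:c:]"])
     (auto simp: additive_on_pairs_def numeral_2_eq_2 span_of_products_zero)

lemma truncates_entries:
  assumes "i < n" "j < n"
  shows "truncates n ps (\<lambda>A B. A $$ (i, j))" "truncates n ps (\<lambda>A B. B $$ (i, j))"
proof -
  show "truncates n ps (\<lambda>A B. A $$ (i, j))"
    by (rule truncatesI[where p = "\<lambda>A B. [:0, A $$ (i, j):]"])
       (use assms in \<open>auto simp: additive_on_pairs_def numeral_2_eq_2 span_of_products_zero\<close>)
  show "truncates n ps (\<lambda>A B. B $$ (i, j))"
    by (rule truncatesI[where p = "\<lambda>A B. [:0, B $$ (i, j):]"])
       (use assms in \<open>auto simp: additive_on_pairs_def numeral_2_eq_2 span_of_products_zero\<close>)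
qed

lemma truncates_lincomb:
  assumes "truncates n ps f" "truncates n ps g"
  shows "truncates n ps (\<lambda>A B. a * f A B + b * g A B)"
proof -
  obtain c p where "truncation n ps f c p"
    using assms(1) unfolding truncates_def by blast
  note p = truncationD[OF this]
  obtain d q where "truncation n ps g d q"
    using assms(2) unfolding truncates_def by blast
  note q = truncationD[OF this]
  show ?thesis
    by (rule truncatesI[where p = "\<lambda>A B. smult a (p A B) + smult b (q A B)" and c = "a * c + b * d"])
       (use additive_on_pairs_lincomb[OF p(3) q(3)] span_of_products_lincomb[OF p(4) q(4)]
         in \<open>simp_all add: p(1,2) q(1,2)\<close>)
qed

text \<open>The constant coefficients \<open>c\<close> and \<open>d\<close> are numbers, so the
  quadratic coefficient of the product is d p2 + c q2 + p1 q1, and only p1 q1 leaves the span of the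
  earlier products. A multiplication costs one new pair.\<close>

lemma truncates_mult:
  assumes "truncates n ps f" "truncates n ps g"
  shows "\<exists>uw. additive_on_pairs n (fst uw) \<and> additive_on_pairs n (snd uw) \<and>
    truncates n (ps @ [uw]) (\<lambda>A B. f A B * g A B)"
proof -
  obtain c p where "truncation n ps f c p"
    using assms(1) unfolding truncates_def by blast
  note p = truncationD[OF this]
  obtain d q where "truncation n ps g d q"
    using assms(2) unfolding truncates_def by blast
  note q = truncationD[OF this]
  let ?uw = "(\<lambda>A B. coeff (p A B) 1, \<lambda>A B. coeff (q A B) 1)"
  have "truncates n (ps @ [?uw]) (\<lambda>A B. f A B * g A B)"
  proof (rule truncatesI[where p = "\<lambda>A B. p A B * q A B" and c = "c * d"])
    show "additive_on_pairs n (\<lambda>A B. coeff (p A B * q A B) 1)"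
    proof -
      have "coeff (p A B * q A B) 1 = d * coeff (p A B) 1 + c * coeff (q A B) 1"
        if "A \<in> carrier_mat n n" "B \<in> carrier_mat n n" for A B
        using that by (simp add: coeff_mult p(2) q(2))
      then show ?thesis
        using additive_on_pairs_cong[OF additive_on_pairs_lincomb[OF p(3) q(3), of d c]] by presburger
    qed
    have "span_of_products n (ps @ [?uw])
        (\<lambda>A B. 1 * (d * coeff (p A B) 2 + c * coeff (q A B) 2) + 1 * (coeff (p A B) 1 * coeff (q A B) 1))"
      by (intro span_of_products_lincomb span_of_products_snoc p q span_of_products_last)
    moreover have "coeff (p A B * q A B) 2 =
        1 * (d * coeff (p A B) 2 + c * coeff (q A B) 2) + 1 * (coeff (p A B) 1 * coeff (q A B) 1)"
      if "A \<in> carrier_mat n n" "B \<in> carrier_mat n n" for A B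
      using that by (simp add: coeff_mult p(2) q(2) numeral_2_eq_2)
    ultimately show "span_of_products n (ps @ [?uw]) (\<lambda>A B. coeff (p A B * q A B) 2)"
      by (simp add: span_of_products_def)
  qed (simp_all add: p(1,2) q(1,2) coeff_mult)
  then show ?thesis
    using p(3) q(3) by (intro exI[of _ ?uw]) simp
qed

text \<open>A divisor never vanishes, so by the fundamental theorem of algebra it is constant.\<close>

lemma truncates_divide:
  assumes "truncates n ps f" "truncates n ps g"
    and nz: "\<And>A B. A \<in> carrier_mat n n \<Longrightarrow> B \<in> carrier_mat n n \<Longrightarrow> g A B \<noteq> 0"
  shows "truncates n ps (\<lambda>A B. f A B / g A B)"
proof -
  obtain d q where "truncation n ps g d q"
    using assms(2) unfolding truncates_def by blast
  note q = truncationD[OF this]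
  have "g A B = d" if AB: "A \<in> carrier_mat n n" "B \<in> carrier_mat n n" for A B
  proof -
    have nz': "poly (q A B) s \<noteq> 0" for s
      using q(1)[OF AB, of s] nz[of "s \<cdot>\<^sub>m A" "s \<cdot>\<^sub>m B"] AB by simp
    then have "constant (poly (q A B))"
      using fundamental_theorem_of_algebra by blast
    \<comment> \<open>All these lines pass through the pair of zero matrices, where the value is
      \<open>d\<close>; so the constants along different lines agree.\<close>
    then have "poly (q A B) 1 = poly (q A B) 0"
      unfolding constant_def by blast
    moreover have "1 \<cdot>\<^sub>m A = A" "1 \<cdot>\<^sub>m B = B"
      using AB by (auto intro!: eq_matI)
    ultimately show ?thesis
      using q(1)[OF AB, of 1] q(2)[OF AB] by (simp add: poly_0_coeff_0)
  qed
  then show ?thesis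
    using truncates_lincomb[OF assms(1) truncates_const[of n ps 0], of "1 / d" 1]
    by (auto elim!: truncates_cong)
qed

lemma truncates_operand:
  assumes "\<And>f. f \<in> set fs \<Longrightarrow> truncates n ps f"
    and val: "\<And>A B. A \<in> carrier_mat n n \<Longrightarrow> B \<in> carrier_mat n n \<Longrightarrow>
      operand_value A B (map (\<lambda>f. f A B) fs) p = Some (h A B)"
  shows "truncates n ps h"
proof -
  \<comment> \<open>The operand has a value on every input, so evaluating it on the zero matrices
    already shows that its indices are in range.\<close>
  have Z: "0\<^sub>m n n \<in> carrier_mat n n" for n :: nat
    by simp
  show ?thesis
  proof (cases p)
    case (Scalar c)
    show ?thesis
    proof (rule truncates_cong[OF truncates_const])
      show "c = h A B" if "A \<in> carrier_mat n n" "B \<in> carrier_mat n n" for A B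
        using val[OF that] Scalar by simp
    qed
  next
    case (EntryA i j)
    have "i < n \<and> j < n"
      using val[OF Z Z] EntryA by (auto split: if_splits)
    then have ij: "i < n" "j < n"
      by auto
    show ?thesis
    proof (rule truncates_cong[OF truncates_entries(1)[OF ij]])
      show "A $$ (i, j) = h A B" if "A \<in> carrier_mat n n" "B \<in> carrier_mat n n" for A B
        using val[OF that] that ij EntryA by simp
    qed
  next
    case (EntryB i j)
    have "i < n \<and> j < n"
      using val[OF Z Z] EntryB by (auto split: if_splits)
    then have ij: "i < n" "j < n"
      by auto
    show ?thesis
    proof (rule truncates_cong[OF truncates_entries(2)[OF ij]])
      show "B $$ (i, j) = h A B" if "A \<in> carrier_mat n n" "B \<in> carrier_mat n n" for A B
        using val[OF that] that ij EntryB by simp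
    qed
  next
    case (Result k)
    have k: "k < length fs"
      using val[OF Z Z] Result by (auto split: if_splits)
    show ?thesis
    proof (rule truncates_cong[OF assms(1)])
      show "(fs ! k) A B = h A B" if "A \<in> carrier_mat n n" "B \<in> carrier_mat n n" for A B
        using val[OF that] Result k by simp
    qed (use k in simp)
  qed
qed

lemma truncates_instr:
  assumes fs: "\<And>f. f \<in> set fs \<Longrightarrow> truncates n ps f"
    and val: "\<And>A B. A \<in> carrier_mat n n \<Longrightarrow> B \<in> carrier_mat n n \<Longrightarrow>
      instr_value A B (map (\<lambda>f. f A B) fs) c = Some (h A B)"
  shows "\<exists>uw. additive_on_pairs n (fst uw) \<and> additive_on_pairs n (snd uw) \<and> truncates n (ps @ [uw]) h"
proof -
  obtain f p q where c: "c = Instr f p q"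
    by (cases c)
  define x where "x A B = the (operand_value A B (map (\<lambda>f. f A B) fs) p)" for A B
  define y where "y A B = the (operand_value A B (map (\<lambda>f. f A B) fs) q)" for A B
  have x: "operand_value A B (map (\<lambda>f. f A B) fs) p = Some (x A B)"
    and y: "operand_value A B (map (\<lambda>f. f A B) fs) q = Some (y A B)"
    and op: "apply_op f (x A B) (y A B) = Some (h A B)"
    if "A \<in> carrier_mat n n" "B \<in> carrier_mat n n" for A B
    using val[OF that] by (auto simp: c x_def y_def bind_eq_Some_conv)
  have tx: "truncates n ps x" and ty: "truncates n ps y"
    using truncates_operand[OF fs x] truncates_operand[OF fs y] by simp_all
  \<comment> \<open>Additions, subtractions and divisions create no new product. They append the
    zero pair, so that \<open>ps\<close> grows by exactly one per instruction.\<close>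
  have zero: "additive_on_pairs n (\<lambda>A B. 0)"
    by (simp add: additive_on_pairs_def)
  show ?thesis
  proof (cases f)
    case Plus
    have "truncates n ps h"
      by (rule truncates_cong[OF truncates_lincomb[OF tx ty, of 1 1]]) (use op Plus in auto)
    then show ?thesis
      using zero by (intro exI[of _ "(\<lambda>A B. 0, \<lambda>A B. 0)"]) (simp add: truncates_snoc)
  next
    case Minus
    have "truncates n ps h"
      by (rule truncates_cong[OF truncates_lincomb[OF tx ty, of 1 "-1"]]) (use op Minus in auto)
    then show ?thesis
      using zero by (intro exI[of _ "(\<lambda>A B. 0, \<lambda>A B. 0)"]) (simp add: truncates_snoc)
  next
    case Times
    obtain uw where "additive_on_pairs n (fst uw)" "additive_on_pairs n (snd uw)"
      and t: "truncates n (ps @ [uw]) (\<lambda>A B. x A B * y A B)"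
      using truncates_mult[OF tx ty] by blast
    moreover have "truncates n (ps @ [uw]) h"
      by (rule truncates_cong[OF t]) (use op Times in auto)
    ultimately show ?thesis
      by blast
  next
    case Divide
    have nz: "y A B \<noteq> 0" if "A \<in> carrier_mat n n" "B \<in> carrier_mat n n" for A B
      using op[OF that] Divide by (auto split: if_splits)
    have "truncates n ps h"
      by (rule truncates_cong[OF truncates_divide[OF tx ty nz]]) (use op nz Divide in auto)
    then show ?thesis
      using zero by (intro exI[of _ "(\<lambda>A B. 0, \<lambda>A B. 0)"]) (simp add: truncates_snoc)
  qed
qed

text \<open>Invariant of the induction: all values computed so far truncate over one common list
  \<open>ps\<close>, and the growth of this list counts the instructions executed.\<close>

lemma truncates_program:
  assumes "\<And>f. f \<in> set fs \<Longrightarrow> truncates n ps f"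
    and "\<And>u w. (u, w) \<in> set ps \<Longrightarrow> additive_on_pairs n u \<and> additive_on_pairs n w"
    and "\<And>A B. A \<in> carrier_mat n n \<Longrightarrow> B \<in> carrier_mat n n \<Longrightarrow>
      run_program A B (map (\<lambda>f. f A B) fs) prog = Some (res A B)"
  shows "\<exists>fs' ps'. length ps' = length ps + length prog \<and> (\<forall>f\<in>set fs'. truncates n ps' f) \<and>
    (\<forall>(u, w)\<in>set ps'. additive_on_pairs n u \<and> additive_on_pairs n w) \<and>
    (\<forall>A\<in>carrier_mat n n. \<forall>B\<in>carrier_mat n n. res A B = map (\<lambda>f. f A B) fs')"
  using assms
proof (induction prog arbitrary: fs ps)
  case Nil
  then show ?case
    by (intro exI[of _ fs] exI[of _ ps]) auto
next
  case (Cons c prog)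
  define h where "h A B = the (instr_value A B (map (\<lambda>f. f A B) fs) c)" for A B
  have h: "instr_value A B (map (\<lambda>f. f A B) fs) c = Some (h A B)"
    and run: "run_program A B (map (\<lambda>f. f A B) (fs @ [h])) prog = Some (res A B)"
    if "A \<in> carrier_mat n n" "B \<in> carrier_mat n n" for A B
    using Cons.prems(3)[OF that] by (auto simp: h_def bind_eq_Some_conv)
  obtain uw where uw: "additive_on_pairs n (fst uw)" "additive_on_pairs n (snd uw)" "truncates n (ps @ [uw]) h"
    using truncates_instr[OF Cons.prems(1) h] by blast
  have "\<exists>fs' ps'. length ps' = length (ps @ [uw]) + length prog \<and> (\<forall>f\<in>set fs'. truncates n ps' f) \<and>
      (\<forall>(u, w)\<in>set ps'. additive_on_pairs n u \<and> additive_on_pairs n w) \<and>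
      (\<forall>A\<in>carrier_mat n n. \<forall>B\<in>carrier_mat n n. res A B = map (\<lambda>f. f A B) fs')"
  proof (rule Cons.IH[OF _ _ run])
    show "truncates n (ps @ [uw]) f" if "f \<in> set (fs @ [h])" for f
      using that uw(3) truncates_snoc[OF Cons.prems(1), where uw = uw] by auto
    show "additive_on_pairs n u \<and> additive_on_pairs n w" if "(u, w) \<in> set (ps @ [uw])" for u w
      using that uw(1,2) Cons.prems(2) by auto
  qed
  then show ?case
    by simp
qed

definition unit_mat :: "nat \<Rightarrow> nat \<times> nat \<Rightarrow> complex mat" where
  "unit_mat n x = mat n n (\<lambda>y. of_bool (y = x))"

lemma unit_mat_carrier: "unit_mat n x \<in> carrier_mat n n"
  by (simp add: unit_mat_def)

lemma unit_mat_mult: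
  assumes "x \<in> {..<n} \<times> {..<n}" "y \<in> {..<n} \<times> {..<n}" "z \<in> {..<n} \<times> {..<n}"
  shows "(unit_mat n x * unit_mat n y) $$ (snd z, fst z) = mm x y z"
proof -
  have "(unit_mat n x * unit_mat n y) $$ (snd z, fst z) =
      (\<Sum>k<n. of_bool ((snd z, k) = x) * of_bool ((k, fst z) = y))"
    using assms by (auto simp: unit_mat_def scalar_prod_def atLeast0LessThan)
  also have "\<dots> = (\<Sum>k<n. if k = snd x then mm x y z else 0)"
    by (intro sum.cong refl) (auto simp: mm_def prod_eq_iff)
  also have "\<dots> = mm x y z"
    using assms by (auto simp: mem_Times_iff)
  finally show ?thesis .
qed

text \<open>An entry of A * B is homogeneous of degree 2 along the line, so it equals its quadratic
  coefficient, a combination of the products \<open>u l * w l\<close>. Splitting both forms gives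
  four terms each; the pure A terms add up to an entry of A * 0 and the pure B terms to one of 0 *
  B, both zero. Two mixed terms per instruction remain, hence the factor 2.\<close>

theorem mmrank_le_program_length:
  assumes "multiplies_matrices n prog out"
  shows "mmrank n \<le> 2 * length prog"
proof -
  let ?C = "carrier_mat n n :: complex mat set" and ?O = "0\<^sub>m n n :: complex mat"
  let ?Q = "{..<n} \<times> {..<n}"
  define res where "res A B = the (run_program A B [] prog)" for A B
  have res: "run_program A B (map (\<lambda>f. f A B) []) prog = Some (res A B)"
    and out: "\<And>i j. i < n \<Longrightarrow> j < n \<Longrightarrow> operand_value A B (res A B) (out i j) = Some ((A * B) $$ (i, j))"
    if "A \<in> ?C" "B \<in> ?C" for A B
  proof -
    note AB = that
    obtain vs where "run_program A B [] prog = Some vs"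
      "\<forall>i<n. \<forall>j<n. operand_value A B vs (out i j) = Some ((A * B) $$ (i, j))"
      using bspec[OF bspec[OF assms[unfolded multiplies_matrices_def] AB(1)] AB(2)] by (elim exE conjE)
    then show "run_program A B (map (\<lambda>f. f A B) []) prog = Some (res A B)"
      "\<And>i j. i < n \<Longrightarrow> j < n \<Longrightarrow> operand_value A B (res A B) (out i j) = Some ((A * B) $$ (i, j))"
      by (simp_all add: res_def del: index_mult_mat)
  qed
  obtain fs ps where ps: "length ps = length prog"
    and fs: "\<And>f. f \<in> set fs \<Longrightarrow> truncates n ps f"
    and add: "\<And>u w. (u, w) \<in> set ps \<Longrightarrow> additive_on_pairs n u \<and> additive_on_pairs n w"
    and map: "\<And>A B. A \<in> ?C \<Longrightarrow> B \<in> ?C \<Longrightarrow> res A B = map (\<lambda>f. f A B) fs"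
    using truncates_program[of "[]" n "[]" prog res, OF _ _ res, simplified] by blast
  define u where "u l = fst (ps ! l)" for l
  define w where "w l = snd (ps ! l)" for l
  have u: "u l A B = u l A ?O + u l ?O B" and w: "w l A B = w l A ?O + w l ?O B"
    if "l < length ps" "A \<in> ?C" "B \<in> ?C" for l A B
    using add[of "u l" "w l"] that additive_on_pairsD[of n "u l" A B] additive_on_pairsD[of n "w l" A B]
    by (simp_all add: u_def w_def)
  have ex: "\<exists>c. \<forall>A\<in>?C. \<forall>B\<in>?C. (A * B) $$ (i, j) = (\<Sum>l<length ps. c l * u l A B * w l A B)"
    if ij: "i < n" "j < n" for i j
  proof -
    have "truncates n ps (\<lambda>A B. (A * B) $$ (i, j))"
    proof (rule truncates_operand[OF fs])
      show "operand_value A B (map (\<lambda>f. f A B) fs) (out i j) = Some ((A * B) $$ (i, j))"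
        if "A \<in> ?C" "B \<in> ?C" for A B
        using out[OF that ij] map[OF that] by argo
    qed
    then obtain c p where "truncation n ps (\<lambda>A B. (A * B) $$ (i, j)) c p"
      unfolding truncates_def by blast
    note p = truncationD(1)[OF this] and sp = truncationD(4)[OF this]
    have "coeff (p A B) 2 = (A * B) $$ (i, j)" if "A \<in> ?C" "B \<in> ?C" for A B
    proof -
      have "poly (p A B) s = poly (monom ((A * B) $$ (i, j)) 2) s" for s
        using p[OF that, of s, symmetric] that ij by (simp add: poly_monom power2_eq_square mult_ac)
      then have "p A B = monom ((A * B) $$ (i, j)) 2"
        using poly_eq_poly_eq_iff by blast
      then show ?thesis
        by simp
    qed
    then show ?thesis
      using sp unfolding span_of_products_def u_def w_def by auto
  qed
  define c where "c i j = (SOME c. \<forall>A\<in>?C. \<forall>B\<in>?C. (A * B) $$ (i, j) =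
      (\<Sum>l<length ps. c l * u l A B * w l A B))" for i j
  have c: "(A * B) $$ (i, j) = (\<Sum>l<length ps. c i j l * u l A B * w l A B)"
    if "i < n" "j < n" "A \<in> ?C" "B \<in> ?C" for i j A B
    using bspec[OF bspec[OF someI_ex[OF ex[OF that(1,2)], folded c_def] that(3)] that(4)] .
  have "mm_rank_le (2 * length ps) {..<n}"
    unfolding mm_rank_le_def
  \<comment> \<open>The Boolean selects which of the two linear forms reads the first matrix; the
    other form reads the second.\<close>
  proof (rule rank_leI[where A = "{..<length ps} \<times> (UNIV :: bool set)"
        and u = "\<lambda>(l, b) x. if b then u l (unit_mat n x) ?O else w l (unit_mat n x) ?O"
        and v = "\<lambda>(l, b) y. if b then w l ?O (unit_mat n y) else u l ?O (unit_mat n y)"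
        and w = "\<lambda>(l, b) z. c (snd z) (fst z) l"])
    fix x y z assume xyz: "x \<in> ?Q" "y \<in> ?Q" "z \<in> ?Q"
    let ?X = "unit_mat n x" and ?Y = "unit_mat n y" and ?c = "c (snd z) (fst z)"
    have z: "snd z < n" "fst z < n"
      using xyz by auto
    note C = unit_mat_carrier[of n x] unit_mat_carrier[of n y]
    have "(\<Sum>l<length ps. ?c l * u l ?X ?O * w l ?X ?O) = 0" "(\<Sum>l<length ps. ?c l * u l ?O ?Y * w l ?O ?Y) = 0"
      using c[OF z C(1), of ?O] c[OF z _ C(2), of ?O] z C by simp_all
    then have "mm x y z = (\<Sum>l<length ps. ?c l * u l ?X ?Y * w l ?X ?Y)
        - (\<Sum>l<length ps. ?c l * u l ?X ?O * w l ?X ?O) - (\<Sum>l<length ps. ?c l * u l ?O ?Y * w l ?O ?Y)"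
      using unit_mat_mult[OF xyz] c[OF z C] by simp
    also have "\<dots> = (\<Sum>l<length ps. u l ?X ?O * w l ?O ?Y * ?c l + w l ?X ?O * u l ?O ?Y * ?c l)"
      unfolding sum_subtractf[symmetric]
      by (intro sum.cong refl) (simp add: u[of _ ?X ?Y] w[of _ ?X ?Y] C algebra_simps)
    also have "\<dots> = (\<Sum>l<length ps. \<Sum>b\<in>UNIV. (if b then u l ?X ?O else w l ?X ?O) *
        (if b then w l ?O ?Y else u l ?O ?Y) * ?c l)"
      by (simp add: UNIV_bool add.commute)
    finally show "mm x y z = (\<Sum>lb\<in>{..<length ps} \<times> UNIV.
        (case lb of (l, b) \<Rightarrow> \<lambda>x. if b then u l (unit_mat n x) ?O else w l (unit_mat n x) ?O) x *
        (case lb of (l, b) \<Rightarrow> \<lambda>y. if b then w l ?O (unit_mat n y) else u l ?O (unit_mat n y)) y *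
        (case lb of (l, b) \<Rightarrow> \<lambda>z. c (snd z) (fst z) l) z)"
      by (simp only: sum.cartesian_product split_def)
  qed (simp_all add: card_cartesian_product)
  then show ?thesis
    using mmrank_le[of "2 * length ps" "{..<n}"] ps by simp
qed

section \<open>From rank to programs\<close>

definition denotes ::
  "nat \<Rightarrow> (complex mat \<Rightarrow> complex mat \<Rightarrow> complex) list \<Rightarrow> operand \<Rightarrow>
     (complex mat \<Rightarrow> complex mat \<Rightarrow> complex) \<Rightarrow> bool" where
  "denotes n fs p f \<longleftrightarrow>
     (\<forall>A\<in>carrier_mat n n. \<forall>B\<in>carrier_mat n n.
        operand_value A B (map (\<lambda>f. f A B) fs) p = Some (f A B))"

text \<open>\<open>S\<close> collects functions of the inputs that some operand denotes when the
  program ends. The positions of results are hidden, so programs can be extended and composed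
  through \<open>S\<close> alone; constants and input entries can belong to \<open>S\<close> at no
  cost.\<close>

definition computable ::
  "nat \<Rightarrow> nat \<Rightarrow> (complex mat \<Rightarrow> complex mat \<Rightarrow> complex) set \<Rightarrow> bool" where
  "computable n t S \<longleftrightarrow>
     (\<exists>prog fs. length prog = t \<and>
        (\<forall>A\<in>carrier_mat n n. \<forall>B\<in>carrier_mat n n.
           run_program A B [] prog = Some (map (\<lambda>f. f A B) fs)) \<and>
        (\<forall>f\<in>S. \<exists>p. denotes n fs p f))"

lemma computableE:
  assumes "computable n t S"
  obtains prog fs where "length prog = t"
    "\<And>A B. A \<in> carrier_mat n n \<Longrightarrow> B \<in> carrier_mat n n \<Longrightarrow>
       run_program A B [] prog = Some (map (\<lambda>f. f A B) fs)"
    "\<And>f. f \<in> S \<Longrightarrow> \<exists>p. denotes n fs p f"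
  using assms unfolding computable_def by (elim exE conjE) simp

lemma computableI:
  assumes "length prog = t"
    "\<And>A B. A \<in> carrier_mat n n \<Longrightarrow> B \<in> carrier_mat n n \<Longrightarrow>
       run_program A B [] prog = Some (map (\<lambda>f. f A B) fs)"
    "\<And>f. f \<in> S \<Longrightarrow> \<exists>p. denotes n fs p f"
  shows "computable n t S"
  unfolding computable_def by (intro exI[of _ prog] exI[of _ fs]) (use assms in simp)

lemma run_program_snoc:
  "run_program A B vs (cs @ [c]) =
     Option.bind (run_program A B vs cs) (\<lambda>vs'. Option.bind (instr_value A B vs' c) (\<lambda>x. Some (vs' @ [x])))"
  by (induction cs arbitrary: vs) (auto simp: Option.bind_assoc)

lemma denotes_snoc:
  assumes "denotes n fs p f"
  shows "denotes n (fs @ [g]) p f"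
  unfolding denotes_def
proof (intro ballI)
  fix A B :: "complex mat" assume "A \<in> carrier_mat n n" "B \<in> carrier_mat n n"
  then have "operand_value A B (map (\<lambda>f. f A B) fs) p = Some (f A B)"
    using assms unfolding denotes_def by blast
  then show "operand_value A B (map (\<lambda>f. f A B) (fs @ [g])) p = Some (f A B)"
    by (cases p) (auto simp: nth_append split: if_splits)
qed

lemma computable_mono: "computable n t S \<Longrightarrow> S' \<subseteq> S \<Longrightarrow> computable n t S'"
  by (erule computableE, rule computableI) blast+

lemma computable_const:
  assumes "computable n t S"
  shows "computable n t (insert (\<lambda>A B. c) S)"
proof -
  have "\<exists>p. denotes n fs p (\<lambda>A B. c)" for fs
    by (intro exI[of _ "Scalar c"]) (simp add: denotes_def)
  then show ?thesis
    using assms unfolding computable_def by (elim exE conjE) auto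
qed

lemma computable_op:
  assumes "computable n t S" "f \<in> S" "g \<in> S"
    and op: "\<And>A B. apply_op oper (f A B) (g A B) = Some (h A B)"
  shows "computable n (Suc t) (insert h S)"
proof (rule computableE[OF assms(1)])
  fix prog fs
  assume len: "length prog = t"
    and run: "\<And>A B. A \<in> carrier_mat n n \<Longrightarrow> B \<in> carrier_mat n n \<Longrightarrow>
       run_program A B [] prog = Some (map (\<lambda>f. f A B) fs)"
    and den: "\<And>f. f \<in> S \<Longrightarrow> \<exists>p. denotes n fs p f"
  obtain p q where pq: "denotes n fs p f" "denotes n fs q g"
    using den assms(2,3) by blast
  show ?thesis
  proof (rule computableI[where prog = "prog @ [Instr oper p q]" and fs = "fs @ [h]"])
    fix A B :: "complex mat" assume AB: "A \<in> carrier_mat n n" "B \<in> carrier_mat n n"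
    have "operand_value A B (map (\<lambda>f. f A B) fs) p = Some (f A B)"
      "operand_value A B (map (\<lambda>f. f A B) fs) q = Some (g A B)"
      using pq AB unfolding denotes_def by blast+
    then show "run_program A B [] (prog @ [Instr oper p q]) = Some (map (\<lambda>f. f A B) (fs @ [h]))"
      by (simp add: run_program_snoc run[OF AB] op)
  next
    fix f assume "f \<in> insert h S"
    moreover have "denotes n (fs @ [h]) (Result (length fs)) h"
      by (simp add: denotes_def nth_append)
    ultimately show "\<exists>p. denotes n (fs @ [h]) p f"
      using den denotes_snoc by blast
  qed (use len in simp)
qed

text \<open>Each term costs one scaling and one addition. The empty sum is a constant operand and
  costs nothing.\<close>

lemma computable_sum:
  assumes "finite J" "computable n t S" "\<And>j. j \<in> J \<Longrightarrow> f j \<in> S"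
  shows "computable n (t + 2 * card J) (insert (\<lambda>A B. \<Sum>j\<in>J. c j * f j A B) S)"
  using assms(1,3)
proof (induction J rule: finite_induct)
  case empty
  then show ?case
    using computable_const[OF assms(2), of 0] by simp
next
  case (insert j J)
  let ?s = "\<lambda>A B. \<Sum>j\<in>J. c j * f j A B"
  have "computable n (t + 2 * card J) (insert (\<lambda>A B. c j) (insert ?s S))"
    using computable_const[OF insert.IH] insert.prems by blast
  then have "computable n (Suc (t + 2 * card J))
      (insert (\<lambda>A B. c j * f j A B) (insert (\<lambda>A B. c j) (insert ?s S)))"
    by (rule computable_op[where f = "\<lambda>A B. c j" and g = "f j" and oper = Times])
       (use insert.prems in auto)
  then have "computable n (Suc (Suc (t + 2 * card J)))
      (insert (\<lambda>A B. c j * f j A B + ?s A B)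
        (insert (\<lambda>A B. c j * f j A B) (insert (\<lambda>A B. c j) (insert ?s S))))"
    by (rule computable_op[where f = "\<lambda>A B. c j * f j A B" and g = ?s and oper = Plus]) auto
  then have "computable n (Suc (Suc (t + 2 * card J))) (insert (\<lambda>A B. c j * f j A B + ?s A B) S)"
    by (rule computable_mono) blast
  then show ?case
    using insert.hyps by simp
qed

text \<open>The step is assumed for every \<open>S'\<close> above \<open>S\<close>, because the
  results of earlier steps accumulate and must stay available.\<close>

lemma computable_iterate:
  assumes "finite F" "computable n t S"
    and step: "\<And>x t S'. x \<in> F \<Longrightarrow> S \<subseteq> S' \<Longrightarrow> computable n t S' \<Longrightarrow> computable n (t + c) (G x \<union> S')"
  shows "computable n (t + card F * c) ((\<Union>x\<in>F. G x) \<union> S)"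
  using assms(1) step
proof (induction F rule: finite_induct)
  case (insert x F)
  have "computable n (t + card F * c) ((\<Union>x\<in>F. G x) \<union> S)"
    using insert.IH insert.prems by blast
  then have "computable n (t + card F * c + c) (G x \<union> ((\<Union>x\<in>F. G x) \<union> S))"
    using insert.prems[of x "(\<Union>x\<in>F. G x) \<union> S"] by blast
  then show ?case
    using insert.hyps by (simp add: Un_assoc add_ac)
qed (use assms(2) in simp)

section \<open>Recursive block multiplication\<close>

text \<open>The factors are matrices of arbitrary available functions instead of the inputs, and the
  program to be extended is arbitrary too: this is what lets the same bound be applied to the
  intermediate blocks of a recursion.\<close>

definition mult_cost :: "nat \<Rightarrow> nat \<Rightarrow> bool" where
  "mult_cost N c \<longleftrightarrow>
     (\<forall>n t S X Y. computable n t S \<longrightarrow> (\<forall>i<N. \<forall>j<N. X i j \<in> S \<and> Y i j \<in> S) \<longrightarrow>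
        computable n (t + c)
          ((\<lambda>(i, k) A B. \<Sum>j<N. X i j A B * Y j k A B) ` ({..<N} \<times> {..<N}) \<union> S))"

lemma mult_costD:
  "mult_cost N c \<Longrightarrow> computable n t S \<Longrightarrow> (\<And>i j. i < N \<Longrightarrow> j < N \<Longrightarrow> X i j \<in> S) \<Longrightarrow>
   (\<And>i j. i < N \<Longrightarrow> j < N \<Longrightarrow> Y i j \<in> S) \<Longrightarrow>
   computable n (t + c) ((\<lambda>(i, k) A B. \<Sum>j<N. X i j A B * Y j k A B) ` ({..<N} \<times> {..<N}) \<union> S)"
  unfolding mult_cost_def by simp

lemma mult_cost_1: "mult_cost 1 1"
  unfolding mult_cost_def
proof (intro allI impI)
  fix n t S and X Y :: "nat \<Rightarrow> nat \<Rightarrow> complex mat \<Rightarrow> complex mat \<Rightarrow> complex"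
  assume "computable n t S" and mem: "\<forall>i<1. \<forall>j<1. X i j \<in> S \<and> Y i j \<in> S"
  then have "computable n (Suc t) (insert (\<lambda>A B. X 0 0 A B * Y 0 0 A B) S)"
    by (intro computable_op[where f = "X 0 0" and g = "Y 0 0" and oper = Times]) auto
  then show "computable n (t + 1)
      ((\<lambda>(i, k) A B. \<Sum>j<1. X i j A B * Y j k A B) ` ({..<1} \<times> {..<1}) \<union> S)"
    by (simp add: lessThan_Suc)
qed

lemma sum_mm:
  fixes m :: nat
  assumes "i < m" "k < m"
  shows "(\<Sum>x\<in>{..<m} \<times> {..<m}. \<Sum>y\<in>{..<m} \<times> {..<m}. a x * b y * mm x y (k, i)) = (\<Sum>j<m. a (i, j) * b (j, k))"
proof -
  let ?Q = "{..<m} \<times> {..<m}" and ?h = "\<lambda>j. ((i, j), (j, k))"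
  have "(\<Sum>x\<in>?Q. \<Sum>y\<in>?Q. a x * b y * mm x y (k, i)) = (\<Sum>(x, y)\<in>?Q \<times> ?Q. a x * b y * mm x y (k, i))"
    by (rule sum.cartesian_product)
  also have "\<dots> = (\<Sum>(x, y)\<in>?h ` {..<m}. a x * b y * mm x y (k, i))"
    by (rule sum.mono_neutral_right) (use assms in \<open>auto simp: mm_def image_iff\<close>)
  also have "\<dots> = (\<Sum>j<m. a (i, j) * b (j, k))"
    by (subst sum.reindex) (auto simp: inj_on_def mm_def)
  finally show ?thesis .
qed

text \<open>A rank decomposition read as a bilinear algorithm: form \<open>r\<close> linear
  combinations on each side, multiply them pairwise and recombine with \<open>w\<close>. The output
  entry \<open>(i, k)\<close> uses \<open>w l (k, i)\<close> because \<open>mm\<close> carries the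
  product transposed.\<close>

lemma mm_decomposition_multiplies:
  fixes m :: nat
  assumes mm: "\<And>x y z. x \<in> Q \<Longrightarrow> y \<in> Q \<Longrightarrow> z \<in> Q \<Longrightarrow> mm x y z = (\<Sum>l<r. u l x * v l y * w l z)"
    and Q: "Q = {..<m} \<times> {..<m}" and ik: "i < m" "k < m"
  shows "(\<Sum>l<r. w l (k, i) * ((\<Sum>x\<in>Q. u l x * a x) * (\<Sum>y\<in>Q. v l y * b y))) = (\<Sum>j<m. a (i, j) * b (j, k))"
proof -
  have "(\<Sum>l<r. w l (k, i) * ((\<Sum>x\<in>Q. u l x * a x) * (\<Sum>y\<in>Q. v l y * b y))) =
      (\<Sum>l<r. \<Sum>x\<in>Q. \<Sum>y\<in>Q. a x * b y * (u l x * v l y * w l (k, i)))"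
    by (intro sum.cong refl, simp only: sum_product, simp only: sum_distrib_left,
        intro sum.cong refl, simp add: mult_ac)
  also have "\<dots> = (\<Sum>x\<in>Q. \<Sum>l<r. \<Sum>y\<in>Q. a x * b y * (u l x * v l y * w l (k, i)))"
    by (rule sum.swap)
  also have "\<dots> = (\<Sum>x\<in>Q. \<Sum>y\<in>Q. \<Sum>l<r. a x * b y * (u l x * v l y * w l (k, i)))"
    by (intro sum.cong refl sum.swap)
  also have "\<dots> = (\<Sum>x\<in>Q. \<Sum>y\<in>Q. a x * b y * mm x y (k, i))"
    by (intro sum.cong refl) (use mm Q ik in \<open>simp add: sum_distrib_left\<close>)
  finally show ?thesis
    using sum_mm[OF ik] Q by simp
qed

lemma sum_lessThan_mult:
  fixes m N :: nat
  shows "(\<Sum>j<m * N. f j) = (\<Sum>q<N. \<Sum>j<m. f (j * N + q))"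
proof -
  have "(\<Sum>j<m * N. f j) = (\<Sum>j<m. \<Sum>q = j * N..<j * N + N. f q)"
    by (rule sum.nat_group[symmetric])
  also have "\<dots> = (\<Sum>j<m. \<Sum>q<N. f (j * N + q))"
  proof (rule sum.cong[OF refl])
    show "(\<Sum>q = j * N..<j * N + N. f q) = (\<Sum>q<N. f (j * N + q))" for j
      using sum.shift_bounds_nat_ivl[of f 0 "j * N" N] by (simp add: add.commute atLeast0LessThan)
  qed
  also have "\<dots> = (\<Sum>q<N. \<Sum>j<m. f (j * N + q))"
    by (rule sum.swap)
  finally show ?thesis .
qed

text \<open>The entries of the \<open>m\<close> by \<open>m\<close> algorithm become
  \<open>N\<close> by \<open>N\<close> blocks. The second summand is three times
  \<open>2 * r * m\<^sup>2 * N\<^sup>2\<close>: there are \<open>r * N\<^sup>2\<close> functions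
  \<open>U\<close> and as many \<open>V\<close>, each a sum of \<open>m\<^sup>2\<close> terms, and
  \<open>m\<^sup>2 * N\<^sup>2\<close> functions \<open>Z\<close>, each a sum of \<open>r\<close>
  terms. The \<open>r\<close> block products \<open>W\<close> cost \<open>c\<close> each.\<close>

lemma mult_cost_step:
  assumes rank: "mm_rank_le r {..<m}" and cost: "mult_cost N c"
  shows "mult_cost (m * N) (r * c + 6 * r * m\<^sup>2 * N\<^sup>2)"
  unfolding mult_cost_def
proof (intro allI impI)
  fix n t S and X Y :: "nat \<Rightarrow> nat \<Rightarrow> complex mat \<Rightarrow> complex mat \<Rightarrow> complex"
  assume comp: "computable n t S" and mem: "\<forall>i<m * N. \<forall>j<m * N. X i j \<in> S \<and> Y i j \<in> S"
  define Q where "Q = {..<m} \<times> {..<m}"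
  have Q: "finite Q" "card Q = m\<^sup>2"
    by (simp_all add: Q_def power2_eq_square)
  obtain u v w where mm: "\<And>x y z. x \<in> Q \<Longrightarrow> y \<in> Q \<Longrightarrow> z \<in> Q \<Longrightarrow> mm x y z = (\<Sum>l<r. u l x * v l y * w l z)"
    using rank unfolding mm_rank_le_def Q_def[symmetric] by (rule rank_leE) blast
  have idx: "i * N + p < m * N" if "i < m" "p < N" for i p
  proof -
    have "i * N + p < Suc i * N"
      using that by simp
    also have "\<dots> \<le> m * N"
      using that by (intro mult_right_mono) auto
    finally show ?thesis .
  qed
  define a where "a x p q = X (fst x * N + p) (snd x * N + q)" for x p q
  define b where "b x p q = Y (fst x * N + p) (snd x * N + q)" for x p q
  have ab: "a x p q \<in> S" "b x p q \<in> S" if "x \<in> Q" "p < N" "q < N" for x p q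
    using that mem idx unfolding a_def b_def Q_def by auto
  define U where "U l p q = (\<lambda>A B. \<Sum>x\<in>Q. u l x * a x p q A B)" for l p q
  define V where "V l p q = (\<lambda>A B. \<Sum>x\<in>Q. v l x * b x p q A B)" for l p q
  define W where "W l p s = (\<lambda>A B. \<Sum>q<N. U l p q A B * V l q s A B)" for l p s
  define Z where "Z i k p s = (\<lambda>A B. \<Sum>l<r. w l (k, i) * W l p s A B)" for i k p s
  let ?F = "{..<r} \<times> {..<N} \<times> {..<N}"
  define S1 where "S1 = (\<Union>(l, p, q)\<in>?F. {U l p q}) \<union> S"
  have "computable n (t + card ?F * (2 * m\<^sup>2)) S1"
    unfolding S1_def
  proof (rule computable_iterate[OF _ comp])
    fix f t S' assume f: "f \<in> ?F" and S': "S \<subseteq> S'" "computable n t S'"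
    then obtain l p q where f: "f = (l, p, q)" "p < N" "q < N"
      by auto
    have "computable n (t + 2 * card Q) (insert (U l p q) S')"
      unfolding U_def by (rule computable_sum[OF Q(1) S'(2)]) (use ab(1) f S' in blast)
    then show "computable n (t + 2 * m\<^sup>2) ((case f of (l, p, q) \<Rightarrow> {U l p q}) \<union> S')"
      by (simp add: f Q)
  qed simp
  moreover have "U l p q \<in> S1" if "l < r" "p < N" "q < N" for l p q
    using that by (auto simp: S1_def)
  moreover define S2 where "S2 = (\<Union>(l, p, q)\<in>?F. {V l p q}) \<union> S1"
  ultimately have "computable n (t + card ?F * (2 * m\<^sup>2) + card ?F * (2 * m\<^sup>2)) S2"
    and U: "\<And>l p q. l < r \<Longrightarrow> p < N \<Longrightarrow> q < N \<Longrightarrow> U l p q \<in> S2"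
    and V: "\<And>l p q. l < r \<Longrightarrow> p < N \<Longrightarrow> q < N \<Longrightarrow> V l p q \<in> S2"
  proof -
    assume S1: "computable n (t + card ?F * (2 * m\<^sup>2)) S1"
    show "computable n (t + card ?F * (2 * m\<^sup>2) + card ?F * (2 * m\<^sup>2)) S2"
      unfolding S2_def
    proof (rule computable_iterate[OF _ S1])
      fix f t S' assume f: "f \<in> ?F" and S': "S1 \<subseteq> S'" "computable n t S'"
      then obtain l p q where f: "f = (l, p, q)" "p < N" "q < N"
        by auto
      have "computable n (t + 2 * card Q) (insert (V l p q) S')"
        unfolding V_def
        by (rule computable_sum[OF Q(1) S'(2)]) (use ab(2) f S'(1) S1_def in blast)
      then show "computable n (t + 2 * m\<^sup>2) ((case f of (l, p, q) \<Rightarrow> {V l p q}) \<union> S')"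
        by (simp add: f Q)
    qed simp
  qed (auto simp: S2_def)
  define S3 where "S3 = (\<Union>l<r. (\<lambda>(p, s). W l p s) ` ({..<N} \<times> {..<N})) \<union> S2"
  have S3: "computable n (t + card ?F * (2 * m\<^sup>2) + card ?F * (2 * m\<^sup>2) + card {..<r} * c) S3"
    unfolding S3_def
  proof (rule computable_iterate)
    show "computable n (t + card ?F * (2 * m\<^sup>2) + card ?F * (2 * m\<^sup>2)) S2" by fact
    fix l t S' assume l: "l \<in> {..<r}" and S': "S2 \<subseteq> S'" "computable n t S'"
    show "computable n (t + c) ((\<lambda>(p, s). W l p s) ` ({..<N} \<times> {..<N}) \<union> S')"
      unfolding W_def by (rule mult_costD[OF cost S'(2)]) (use U V l S'(1) in auto)
  qed simp
  have W: "W l p s \<in> S3" if "l < r" "p < N" "s < N" for l p s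
    using that by (auto simp: S3_def)
  let ?G = "{..<m} \<times> {..<m} \<times> {..<N} \<times> {..<N}"
  define S4 where "S4 = (\<Union>(i, k, p, s)\<in>?G. {Z i k p s}) \<union> S3"
  have "computable n (t + card ?F * (2 * m\<^sup>2) + card ?F * (2 * m\<^sup>2) + card {..<r} * c + card ?G * (2 * r)) S4"
    unfolding S4_def
  proof (rule computable_iterate[OF _ S3])
    fix f t S' assume f: "f \<in> ?G" and S': "S3 \<subseteq> S'" "computable n t S'"
    then obtain i k p s where f: "f = (i, k, p, s)" "p < N" "s < N"
      by auto
    have "computable n (t + 2 * card {..<r}) (insert (Z i k p s) S')"
      unfolding Z_def by (rule computable_sum[OF _ S'(2)]) (use W f S'(1) in auto)
    then show "computable n (t + 2 * r) ((case f of (i, k, p, s) \<Rightarrow> {Z i k p s}) \<union> S')"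
      by (simp add: f)
  qed simp
  then have "computable n (t + (r * c + 6 * r * m\<^sup>2 * N\<^sup>2)) S4"
    by (elim back_subst[of "\<lambda>k. computable n k S4"]) (simp add: power2_eq_square algebra_simps)
  moreover have "(\<lambda>(i, k) A B. \<Sum>j<m * N. X i j A B * Y j k A B) ` ({..<m * N} \<times> {..<m * N}) \<union> S \<subseteq> S4"
  proof -
    have "(\<lambda>A B. \<Sum>j<m * N. X i' j A B * Y j k' A B) \<in> S4" if ik': "i' < m * N" "k' < m * N" for i' k'
    proof -
      define i p k s where "i = i' div N" and "p = i' mod N" and "k = k' div N" and "s = k' mod N"
      have N: "N > 0"
        using that(1) by (cases N) auto
      have ik: "i < m" "k < m" and ps: "p < N" "s < N"
        using that N by (auto simp: i_def k_def p_def s_def less_mult_imp_div_less)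
      have i': "i' = i * N + p" and k': "k' = k * N + s"
        by (simp_all add: i_def p_def k_def s_def)
      have "Z i k p s = (\<lambda>A B. \<Sum>j<m * N. X i' j A B * Y j k' A B)"
      proof (intro ext)
        fix A B
        have "Z i k p s A B = (\<Sum>q<N. \<Sum>l<r. w l (k, i) *
            ((\<Sum>x\<in>Q. u l x * a x p q A B) * (\<Sum>y\<in>Q. v l y * b y q s A B)))"
          unfolding Z_def W_def U_def V_def sum_distrib_left by (rule sum.swap)
        also have "\<dots> = (\<Sum>q<N. \<Sum>j<m. a (i, j) p q A B * b (j, k) q s A B)"
          by (intro sum.cong refl mm_decomposition_multiplies[OF mm Q_def ik])
        also have "\<dots> = (\<Sum>j<m * N. X i' j A B * Y j k' A B)"
          unfolding sum_lessThan_mult by (simp add: a_def b_def i' k')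
        finally show "Z i k p s A B = (\<Sum>j<m * N. X i' j A B * Y j k' A B)" .
      qed
      moreover have "Z i k p s \<in> S4"
        using ik ps by (auto simp: S4_def)
      ultimately show ?thesis
        by simp
    qed
    moreover have "S \<subseteq> S4"
      unfolding S4_def S3_def S2_def S1_def by blast
    ultimately show ?thesis
      by fast
  qed
  ultimately show "computable n (t + (r * c + 6 * r * m\<^sup>2 * N\<^sup>2))
      ((\<lambda>(i, k) A B. \<Sum>j<m * N. X i j A B * Y j k A B) ` ({..<m * N} \<times> {..<m * N}) \<union> S)"
    by (rule computable_mono)
qed

text \<open>Smaller matrices are padded with zeros to size \<open>N\<close>; the padding is a
  constant operand and therefore free.\<close>

lemma mult_cost_imp_ops:
  assumes "mult_cost N c" "n \<le> N"
  shows "matrix_mult_in_ops n c"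
proof -
  define S where "S = {\<lambda>(A :: complex mat) (B :: complex mat). (0 :: complex)} \<union>
    (\<lambda>x A B. A $$ x) ` ({..<n} \<times> {..<n}) \<union> (\<lambda>x A B. B $$ x) ` ({..<n} \<times> {..<n})"
  define X where "X i j = (if i < n \<and> j < n then (\<lambda>(A :: complex mat) (B :: complex mat). A $$ (i, j)) else (\<lambda>A B. 0))" for i j
  define Y where "Y i j = (if i < n \<and> j < n then (\<lambda>(A :: complex mat) (B :: complex mat). B $$ (i, j)) else (\<lambda>A B. 0))" for i j
  have "computable n 0 S"
  proof (rule computableI[where prog = "[]" and fs = "[]"])
    fix f assume "f \<in> S"
    then consider "f = (\<lambda>A B. 0)" | i j where "i < n" "j < n" "f = (\<lambda>A B. A $$ (i, j))"
      | i j where "i < n" "j < n" "f = (\<lambda>A B. B $$ (i, j))"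
      unfolding S_def by auto
    then show "\<exists>p. denotes n [] p f"
    proof cases
      case 1
      then show ?thesis
        by (intro exI[of _ "Scalar 0"]) (simp add: denotes_def)
    next
      case (2 i j)
      then show ?thesis
        by (intro exI[of _ "EntryA i j"]) (simp add: denotes_def)
    next
      case (3 i j)
      then show ?thesis
        by (intro exI[of _ "EntryB i j"]) (simp add: denotes_def)
    qed
  qed auto
  moreover have "X i j \<in> S" "Y i j \<in> S" for i j
    unfolding X_def Y_def S_def by auto
  ultimately have "computable n (0 + c) ((\<lambda>(i, k) A B. \<Sum>j<N. X i j A B * Y j k A B) ` ({..<N} \<times> {..<N}) \<union> S)"
    by (intro mult_costD[OF assms(1)]) auto
  then show ?thesis
  proof (rule computableE)
    fix prog fs
    assume len: "length prog = 0 + c"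
      and run: "\<And>A B. A \<in> carrier_mat n n \<Longrightarrow> B \<in> carrier_mat n n \<Longrightarrow>
         run_program A B [] prog = Some (map (\<lambda>f. f A B) fs)"
      and den: "\<And>f. f \<in> (\<lambda>(i, k) A B. \<Sum>j<N. X i j A B * Y j k A B) ` ({..<N} \<times> {..<N}) \<union> S \<Longrightarrow>
         \<exists>p. denotes n fs p f"
    define out where "out i k = (SOME p. denotes n fs p (\<lambda>A B. \<Sum>j<N. X i j A B * Y j k A B))" for i k
    have out: "denotes n fs (out i k) (\<lambda>A B. \<Sum>j<N. X i j A B * Y j k A B)" if "i < n" "k < n" for i k
      unfolding out_def by (rule someI_ex, rule den) (use that assms(2) in force)
    have "multiplies_matrices n prog out"
      unfolding multiplies_matrices_def
    proof (intro ballI exI conjI allI impI)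
      fix A B :: "complex mat" assume AB: "A \<in> carrier_mat n n" "B \<in> carrier_mat n n"
      show "run_program A B [] prog = Some (map (\<lambda>f. f A B) fs)"
        by (rule run[OF AB])
      fix i k assume ik: "i < n" "k < n"
      have "operand_value A B (map (\<lambda>f. f A B) fs) (out i k) = Some (\<Sum>j<N. X i j A B * Y j k A B)"
        using out[OF ik] AB unfolding denotes_def by blast
      also have "(\<Sum>j<N. X i j A B * Y j k A B) = (\<Sum>j<n. A $$ (i, j) * B $$ (j, k))"
        using assms(2) ik by (intro sum.mono_neutral_cong_right) (auto simp: X_def Y_def)
      also have "\<dots> = (A * B) $$ (i, k)"
        using AB ik by (simp add: scalar_prod_def atLeast0LessThan)
      finally show "operand_value A B (map (\<lambda>f. f A B) fs) (out i k) = Some ((A * B) $$ (i, k))" .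
    qed
    then show ?thesis
      unfolding matrix_mult_in_ops_def using len by auto
  qed
qed

fun block_cost :: "nat \<Rightarrow> nat \<Rightarrow> nat \<Rightarrow> nat" where
  "block_cost m r 0 = 1"
| "block_cost m r (Suc s) = r * block_cost m r s + 6 * r * m\<^sup>2 * (m ^ s)\<^sup>2"

lemma mult_cost_block_cost:
  assumes "mm_rank_le r {..<m}"
  shows "mult_cost (m ^ s) (block_cost m r s)"
  by (induction s) (use mult_cost_1 mult_cost_step[OF assms] in auto)

text \<open>Base \<open>r + 1\<close> instead of \<open>r\<close> absorbs the linear combinations:
  they cost at most K (r + 1)^s in step s, and r K (r + 1)^s + K (r + 1)^s is exactly the next
  bound. The loss in the base disappears in \<open>powr_exponent_le_mmrank\<close>.\<close>

lemma block_cost_le: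
  assumes "m\<^sup>2 \<le> r"
  shows "block_cost m r s \<le> (6 * r * m\<^sup>2 + 1) * (r + 1) ^ s"
proof (induction s)
  case (Suc s)
  have "(m ^ s)\<^sup>2 = (m\<^sup>2) ^ s"
    by (metis power_mult mult.commute)
  also have "\<dots> \<le> (r + 1) ^ s"
    using assms by (intro power_mono) auto
  finally have "6 * r * m\<^sup>2 * (m ^ s)\<^sup>2 \<le> (6 * r * m\<^sup>2 + 1) * (r + 1) ^ s"
    by (intro mult_mono) auto
  moreover have "r * block_cost m r s \<le> r * ((6 * r * m\<^sup>2 + 1) * (r + 1) ^ s)"
    using Suc.IH by (intro mult_left_mono) auto
  ultimately have "block_cost m r (Suc s) \<le>
      r * ((6 * r * m\<^sup>2 + 1) * (r + 1) ^ s) + (6 * r * m\<^sup>2 + 1) * (r + 1) ^ s"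
    unfolding block_cost.simps by (rule add_mono[rotated])
  also have "\<dots> = (6 * r * m\<^sup>2 + 1) * (r + 1) ^ Suc s"
    by (simp add: algebra_simps)
  finally show ?case .
qed simp

lemma powr_power_swap:
  fixes x :: real
  assumes "0 \<le> x"
  shows "(x powr a) ^ k = (x ^ k) powr a"
proof (cases "x = 0")
  case True
  then show ?thesis
    by (cases k) auto
next
  case False
  then show ?thesis
    using assms by (simp add: powr_realpow[symmetric] powr_powr mult.commute)
qed

text \<open>The least power \<open>m ^ s\<close> that reaches n is at most \<open>m * n\<close>, and
  (r + 1)^s is \<open>m ^ s\<close> raised to the logarithm in the claim. So rounding n up to a
  power of m costs a constant factor.\<close>

theorem matrix_mult_in_bigo_log_mmrank:
  assumes m: "m \<ge> 2"
  shows "matrix_mult_in_bigo (log (real m) (real (mmrank m) + 1))"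
proof -
  let ?r = "mmrank m" and ?\<tau> = "log (real m) (real (mmrank m) + 1)"
  define K where "K = real (6 * ?r * m\<^sup>2 + 1)"
  define s where "s n = (LEAST s. n \<le> m ^ s)" for n
  define t where "t n = block_cost m ?r (s n)" for n
  have ex: "\<exists>s. n \<le> m ^ s" for n
  proof
    have "n \<le> 2 ^ n"
      by (simp add: less_imp_le)
    also have "\<dots> \<le> m ^ n"
      using m by (rule power_mono) simp
    finally show "n \<le> m ^ n" .
  qed
  have s: "n \<le> m ^ s n" for n
    unfolding s_def using ex by (rule LeastI_ex)
  have upper: "m ^ s n \<le> m * n" if "n \<ge> 1" for n
  proof (cases "s n")
    case 0
    then show ?thesis
      using that m by simp
  next
    case (Suc s')
    then have "\<not> n \<le> m ^ s'"
      using not_less_Least[of s' "\<lambda>s. n \<le> m ^ s"] by (simp add: s_def)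
    then show ?thesis
      using Suc by simp
  qed
  have \<tau>: "?\<tau> \<ge> 0"
    using m by simp
  have "real (t n) \<le> (K * real m powr ?\<tau>) * real n powr ?\<tau>" if n: "n \<ge> 1" for n
  proof -
    have "real (t n) \<le> K * (real ?r + 1) ^ s n"
      using of_nat_mono[where 'a = real, OF block_cost_le[OF mmrank_ge_square, of m "s n"]]
      unfolding t_def K_def by (simp only: of_nat_mult of_nat_add of_nat_power of_nat_1)
    also have "(real ?r + 1) ^ s n \<le> real m powr ?\<tau> * real n powr ?\<tau>"
    proof -
      have "(real ?r + 1) ^ s n = (real m powr ?\<tau>) ^ s n"
        using m by simp
      also have "\<dots> = real (m ^ s n) powr ?\<tau>"
        by (simp only: powr_power_swap of_nat_0_le_iff of_nat_power)
      also have "\<dots> \<le> real (m * n) powr ?\<tau>"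
        using \<tau> of_nat_mono[OF upper[OF n], where 'a = real] by (intro powr_mono2) auto
      also have "\<dots> = real m powr ?\<tau> * real n powr ?\<tau>"
        by (simp add: powr_mult)
      finally show ?thesis .
    qed
    finally show ?thesis
      by (simp add: K_def mult.assoc mult_left_mono)
  qed
  then have "(\<lambda>n. real (t n)) \<in> O(\<lambda>n. real n powr ?\<tau>)"
    by (intro bigoI[where c = "K * real m powr ?\<tau>"] eventually_sequentiallyI[of 1]) auto
  moreover have "matrix_mult_in_ops n (t n)" for n
    unfolding t_def using s
    by (intro mult_cost_imp_ops[OF mult_cost_block_cost]) (use mm_rank_le_mmrank[of "{..<m}" m] in auto)
  ultimately show ?thesis
    unfolding matrix_mult_in_bigo_def by blast
qed

section \<open>The exponent and the rank\<close>

abbreviation fst_part :: "('i \<times> 'p) \<times> ('j \<times> 'q) \<Rightarrow> 'i \<times> 'j" where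
  "fst_part x \<equiv> (fst (fst x), fst (snd x))"

abbreviation snd_part :: "('i \<times> 'p) \<times> ('j \<times> 'q) \<Rightarrow> 'p \<times> 'q" where
  "snd_part x \<equiv> (snd (fst x), snd (snd x))"

text \<open>The Kronecker product of two matrix multiplication tensors is again one.
  Submultiplicativity of \<open>mmrank\<close> and the combination of outer and inner products in
  the batches rest on this.\<close>

lemma mm_times:
  "mm x y z = mm (fst_part x) (fst_part y) (fst_part z) * mm (snd_part x) (snd_part y) (snd_part z)"
  by (auto simp: mm_def prod_eq_iff)

lemma mm_rank_le_times:
  assumes "mm_rank_le r S" "mm_rank_le r' T"
  shows "mm_rank_le (r * r') (S \<times> T)"
proof -
  obtain u v w where uvw: "\<And>x y z. x \<in> S \<times> S \<Longrightarrow> y \<in> S \<times> S \<Longrightarrow> z \<in> S \<times> S \<Longrightarrow>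
      mm x y z = (\<Sum>l<r. u l x * v l y * w l z)"
    using assms(1) unfolding mm_rank_le_def by (rule rank_leE) blast
  obtain u' v' w' where uvw': "\<And>x y z. x \<in> T \<times> T \<Longrightarrow> y \<in> T \<times> T \<Longrightarrow> z \<in> T \<times> T \<Longrightarrow>
      mm x y z = (\<Sum>l<r'. u' l x * v' l y * w' l z)"
    using assms(2) unfolding mm_rank_le_def by (rule rank_leE) blast
  show ?thesis
    unfolding mm_rank_le_def
  proof (rule rank_leI[where A = "{..<r} \<times> {..<r'}"
        and u = "\<lambda>(l, l') x. u l (fst_part x) * u' l' (snd_part x)"
        and v = "\<lambda>(l, l') x. v l (fst_part x) * v' l' (snd_part x)"
        and w = "\<lambda>(l, l') x. w l (fst_part x) * w' l' (snd_part x)"])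
    fix x y z assume xyz: "x \<in> (S \<times> T) \<times> (S \<times> T)" "y \<in> (S \<times> T) \<times> (S \<times> T)" "z \<in> (S \<times> T) \<times> (S \<times> T)"
    have "mm x y z = (\<Sum>l<r. u l (fst_part x) * v l (fst_part y) * w l (fst_part z)) *
        (\<Sum>l<r'. u' l (snd_part x) * v' l (snd_part y) * w' l (snd_part z))"
      using xyz by (subst mm_times, subst uvw, simp_all add: mem_Times_iff, subst uvw', simp_all add: mem_Times_iff)
    also have "\<dots> = (\<Sum>l<r. \<Sum>l'<r'. (u l (fst_part x) * u' l' (snd_part x)) *
        (v l (fst_part y) * v' l' (snd_part y)) * (w l (fst_part z) * w' l' (snd_part z)))"
      unfolding sum_product by (intro sum.cong refl) (simp add: mult_ac)
    finally show "mm x y z = (\<Sum>ll\<in>{..<r} \<times> {..<r'}.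
        (case ll of (l, l') \<Rightarrow> \<lambda>x. u l (fst_part x) * u' l' (snd_part x)) x *
        (case ll of (l, l') \<Rightarrow> \<lambda>x. v l (fst_part x) * v' l' (snd_part x)) y *
        (case ll of (l, l') \<Rightarrow> \<lambda>x. w l (fst_part x) * w' l' (snd_part x)) z)"
      by (simp only: sum.cartesian_product split_def)
  qed auto
qed

lemma mmrank_mult: "mmrank (m * k) \<le> mmrank m * mmrank k"
  by (rule mmrank_le[OF mm_rank_le_times[OF mm_rank_le_mmrank mm_rank_le_mmrank],
        of "{..<m}" m "{..<k}" k]) auto

lemma mmrank_power: "mmrank (m ^ k) \<le> mmrank m ^ k"
proof (induction k)
  case 0
  show ?case
    using mmrank_le[OF mm_rank_le_cube[of 1]] by simp
next
  case (Suc k)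
  show ?case
    using mmrank_mult[of m "m ^ k"] Suc by (simp add: order_trans[OF _ mult_le_mono2])
qed

text \<open>A constant and a polynomial factor lose against every geometric sequence. This turns
  bounds on powers that carry such losses into exact bounds on the bases.\<close>

lemma le_if_powers_le:
  fixes x y C :: real
  assumes "0 \<le> x" "0 \<le> y" and le: "\<And>k. x ^ k \<le> C * (real k + 1) ^ e * y ^ k"
  shows "x \<le> y"
proof (rule ccontr)
  assume "\<not> x \<le> y"
  define z where "z = y / x"
  have x: "x > 0" and z: "0 \<le> z" "z < 1"
    using \<open>\<not> x \<le> y\<close> assms(2) by (auto simp: z_def)
  have ge: "1 \<le> C * (real k + 1) ^ e * z ^ k" for k
    using le[of k] x by (simp add: z_def power_divide field_simps)
  then have "z \<noteq> 0"
    using ge[of 1] by auto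
  then have "0 < z"
    using z by simp
  then have "(\<lambda>k. C * (real k + 1) ^ e * z ^ k) \<longlonglongrightarrow> 0"
    using z(2) by real_asymp
  then have "\<forall>\<^sub>F k in sequentially. C * (real k + 1) ^ e * z ^ k < 1"
    by (rule order_tendstoD) simp
  then obtain k where "C * (real k + 1) ^ e * z ^ k < 1"
    by (auto simp: eventually_sequentially)
  then show False
    using ge[of k] by simp
qed

section \<open>The exponent as an infimum\<close>

lemma matrix_mult_in_bigoD:
  assumes "matrix_mult_in_bigo \<tau>"
  shows "\<exists>c>0. \<exists>N. \<forall>n\<ge>N. real (mmrank n) \<le> c * real n powr \<tau>"
proof -
  obtain t where t: "\<And>n. matrix_mult_in_ops n (t n)" and bigo: "(\<lambda>n. real (t n)) \<in> O(\<lambda>n. real n powr \<tau>)"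
    using assms unfolding matrix_mult_in_bigo_def by auto
  obtain c where c: "c > 0" "\<forall>\<^sub>F n in sequentially. norm (real (t n)) \<le> c * norm (real n powr \<tau>)"
    using bigo by (rule landau_o.bigE)
  obtain N where N: "\<And>n. n \<ge> N \<Longrightarrow> real (t n) \<le> c * real n powr \<tau>"
    using c(2) by (auto simp: eventually_sequentially)
  have "mmrank n \<le> 2 * t n" for n
  proof -
    obtain prog out where "multiplies_matrices n prog out" "length prog = t n"
      using t[of n] unfolding matrix_mult_in_ops_def by (elim exE conjE)
    then show ?thesis
      using mmrank_le_program_length[of n prog out] by simp
  qed
  then have "real (mmrank n) \<le> 2 * real (t n)" for n
    using of_nat_mono[where 'a = real] by fastforce
  then have "real (mmrank n) \<le> (2 * c) * real n powr \<tau>" if "n \<ge> N" for n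
    using N[OF that] order_trans[of "real (mmrank n)" "2 * real (t n)" "2 * c * real n powr \<tau>"] by simp
  then show ?thesis
    using c(1) by (intro exI[of _ "2 * c"] conjI exI[of _ N]) auto
qed

lemma matrix_mult_in_bigo_mono:
  assumes "matrix_mult_in_bigo \<tau>" "\<tau> \<le> \<tau>'"
  shows "matrix_mult_in_bigo \<tau>'"
proof -
  have "(\<lambda>n. real n powr \<tau>) \<in> O(\<lambda>n. real n powr \<tau>')"
    using assms(2) by (intro bigoI[where c = 1] eventually_sequentiallyI[of 1]) (auto intro: powr_mono)
  then show ?thesis
    using assms(1) landau_o.big_trans unfolding matrix_mult_in_bigo_def by blast
qed

lemma matrix_mult_in_bigo_ge_2:
  assumes "matrix_mult_in_bigo \<tau>"
  shows "\<tau> \<ge> 2"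
proof (rule ccontr)
  assume "\<not> \<tau> \<ge> 2"
  then have \<tau>: "\<tau> < 2"
    by simp
  obtain c N where c: "\<forall>n\<ge>N. real (mmrank n) \<le> c * real n powr \<tau>"
    using matrix_mult_in_bigoD[OF assms] by (elim exE conjE)
  have "filterlim (\<lambda>n. real n powr (2 - \<tau>)) at_top sequentially"
    using \<tau> by real_asymp
  then have "\<forall>\<^sub>F n in sequentially. real n powr (2 - \<tau>) > c"
    by (simp add: filterlim_at_top_dense)
  then obtain N' where N': "\<And>n. n \<ge> N' \<Longrightarrow> real n powr (2 - \<tau>) > c"
    by (auto simp: eventually_sequentially)
  define n where "n = N + N' + 1"
  have n: "n \<ge> N" "n \<ge> N'" "real n > 0"
    by (simp_all add: n_def)
  have "real n powr (2 - \<tau>) * real n powr \<tau> = (real n)\<^sup>2"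
    using n(3) by (simp add: powr_diff)
  also have "\<dots> \<le> real (mmrank n)"
    using of_nat_mono[OF mmrank_ge_square[of n], where 'a = real] by simp
  also have "\<dots> \<le> c * real n powr \<tau>"
    using c n(1) by blast
  finally have "real n powr (2 - \<tau>) \<le> c"
    using n(3) by simp
  then show False
    using N'[OF n(2)] by simp
qed

text \<open>The condition under \<open>LEAST\<close> quantifies over all positive
  \<open>\<epsilon>\<close>, so it holds at the infimum and the minimum is attained, whether or not
  the infimum is itself an admissible exponent. The set is nonempty by block recursion for m = 2 and
  bounded below by the quadratic lower bound on the rank.\<close>

lemma matrix_mult_exponent_eq: "matrix_mult_exponent = Inf {\<tau>. matrix_mult_in_bigo \<tau>}"
proof -
  let ?T = "{\<tau>. matrix_mult_in_bigo \<tau>}"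
  have ne: "?T \<noteq> {}"
    using matrix_mult_in_bigo_log_mmrank[of 2] by blast
  have bdd: "bdd_below ?T"
    using matrix_mult_in_bigo_ge_2 by (intro bdd_belowI[of _ 2]) auto
  show ?thesis
    unfolding matrix_mult_exponent_def
  proof (rule Least_equality)
    show "\<forall>\<epsilon>>0. matrix_mult_in_bigo (Inf ?T + \<epsilon>)"
    proof (intro allI impI)
      fix \<epsilon> :: real assume "\<epsilon> > 0"
      then have "Inf ?T < Inf ?T + \<epsilon>"
        by simp
      then obtain \<tau> where "\<tau> \<in> ?T" "\<tau> < Inf ?T + \<epsilon>"
        using cInf_less_iff[OF ne bdd] by blast
      then show "matrix_mult_in_bigo (Inf ?T + \<epsilon>)"
        using matrix_mult_in_bigo_mono by auto
    qed
    fix w assume w: "\<forall>\<epsilon>>0. matrix_mult_in_bigo (w + \<epsilon>)"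
    show "Inf ?T \<le> w"
      by (rule field_le_epsilon) (use w in \<open>auto intro: cInf_lower[OF _ bdd]\<close>)
  qed
qed

lemma matrix_mult_exponent_le:
  assumes "matrix_mult_in_bigo \<tau>"
  shows "matrix_mult_exponent \<le> \<tau>"
  unfolding matrix_mult_exponent_eq
  using assms matrix_mult_in_bigo_ge_2 by (intro cInf_lower bdd_belowI[of _ 2]) auto

lemma matrix_mult_exponent_ge_2: "matrix_mult_exponent \<ge> 2"
  unfolding matrix_mult_exponent_eq
  using matrix_mult_in_bigo_log_mmrank[of 2] matrix_mult_in_bigo_ge_2 by (intro cInf_greatest) auto

lemma matrix_mult_in_bigo_exponent:
  assumes "\<epsilon> > 0"
  shows "matrix_mult_in_bigo (matrix_mult_exponent + \<epsilon>)"
proof -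
  have "Inf {\<tau>. matrix_mult_in_bigo \<tau>} < matrix_mult_exponent + \<epsilon>"
    using assms by (simp add: matrix_mult_exponent_eq)
  then obtain \<tau> where "matrix_mult_in_bigo \<tau>" "\<tau> < matrix_mult_exponent + \<epsilon>"
    using cInf_lessD[of "{\<tau>. matrix_mult_in_bigo \<tau>}"] matrix_mult_in_bigo_log_mmrank[of 2] by blast
  then show ?thesis
    using matrix_mult_in_bigo_mono by simp
qed

text \<open>For \<open>m ^ k\<close> block recursion bounds the w-th power of \<open>m ^ k\<close>
  by \<open>mmrank (m ^ k) + 1\<close>, and submultiplicativity bounds this by
  \<open>2 * mmrank m ^ k\<close>. Taking k-th roots removes the 2, and with it the additive 1 of
  the recursion. The case m = 1 is separate because 1 is not the base of a logarithm.\<close>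

theorem powr_exponent_le_mmrank:
  assumes "m \<ge> 1"
  shows "real m powr matrix_mult_exponent \<le> real (mmrank m)"
proof (cases "m = 1")
  case True
  then show ?thesis
    using mmrank_ge_square[of 1] by simp
next
  case False
  then have m: "m \<ge> 2"
    using assms by simp
  let ?w = matrix_mult_exponent
  show ?thesis
  proof (rule le_if_powers_le[where C = 2 and e = 0])
    fix k :: nat
    show "(real m powr ?w) ^ k \<le> 2 * (real k + 1) ^ 0 * real (mmrank m) ^ k"
    proof (cases "k = 0")
      case k: False
      have "m ^ 1 \<le> m ^ k"
        using m k by (intro power_increasing) auto
      then have mk: "m ^ k \<ge> 2"
        using m by simp
      have pos: "real (mmrank m) ^ k \<ge> 1"
      proof -
        have "1 \<le> m\<^sup>2"
          using m by simp
        then have "1 \<le> real (mmrank m)"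
          using mmrank_ge_square[of m] by linarith
        then show ?thesis
          by simp
      qed
      have "(real m powr ?w) ^ k = real (m ^ k) powr ?w"
        by (simp only: powr_power_swap of_nat_0_le_iff of_nat_power)
      also have "\<dots> \<le> real (m ^ k) powr log (real (m ^ k)) (real (mmrank (m ^ k)) + 1)"
        using mk matrix_mult_exponent_le[OF matrix_mult_in_bigo_log_mmrank[OF mk]]
        by (intro powr_mono) linarith+
      also have "\<dots> = real (mmrank (m ^ k)) + 1"
        using mk by (intro powr_log_cancel) linarith+
      also have "\<dots> \<le> real (mmrank m ^ k) + 1"
        using mmrank_power[of m k] by linarith
      also have "\<dots> \<le> 2 * real (mmrank m) ^ k"
        using pos by simp
      finally show ?thesis
        by simp
    qed simp
  qed auto
qed

theorem mmrank_le_powr_exponent: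
  assumes "\<epsilon> > 0"
  shows "\<exists>C>0. \<forall>m\<ge>1. real (mmrank m) \<le> C * real m powr (matrix_mult_exponent + \<epsilon>)"
proof -
  let ?\<tau> = "matrix_mult_exponent + \<epsilon>"
  obtain c N where c: "c > 0" "\<forall>n\<ge>N. real (mmrank n) \<le> c * real n powr ?\<tau>"
    using matrix_mult_in_bigoD[OF matrix_mult_in_bigo_exponent[OF assms]] by (elim exE conjE)
  \<comment> \<open>The asymptotic bound starts at \<open>N\<close>. The finitely many smaller ranks
    are added to the constant, which suffices because the power of \<open>m\<close> is at least
    1.\<close>
  define C where "C = c + (\<Sum>n<N. real (mmrank n))"
  have C: "c \<le> C"
    by (simp add: C_def sum_nonneg)
  have "real (mmrank m) \<le> C * real m powr ?\<tau>" if m: "m \<ge> 1" for m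
  proof (cases "m \<ge> N")
    case True
    then show ?thesis
      using c(2)[rule_format, OF True] mult_right_mono[OF C, of "real m powr ?\<tau>"] by simp
  next
    case False
    have "real (mmrank m) \<le> (\<Sum>n<N. real (mmrank n))"
      using False by (intro member_le_sum) auto
    also have "\<dots> \<le> C"
      using c(1) by (simp add: C_def)
    also have "\<dots> \<le> C * real m powr ?\<tau>"
    proof -
      have "1 \<le> real m powr ?\<tau>"
        using m assms matrix_mult_exponent_ge_2 by (intro ge_one_powr_ge_zero) auto
      then show ?thesis
        using C c(1) by simp
    qed
    finally show ?thesis .
  qed
  then show ?thesis
    using C c(1) by (intro exI[of _ C]) auto
qed

section \<open>Matrix coefficients of irreducible representations\<close>

lemma subspace_vec_iff:
  "subspace class_ring W (module_vec TYPE(complex) d) \<longleftrightarrow>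
     W \<subseteq> carrier_vec d \<and> 0\<^sub>v d \<in> W \<and> (\<forall>v\<in>W. \<forall>w\<in>W. v + w \<in> W) \<and> (\<forall>c. \<forall>v\<in>W. c \<cdot>\<^sub>v v \<in> W)"
  using vec_vs[where 'a = complex, of d] vectorspace.axioms(1)[OF vec_vs[where 'a = complex, of d]]
  unfolding VectorSpace.subspace_def submodule_def by (auto simp: module_vec_def)

lemma index_mult_mat_sum:
  assumes "A \<in> carrier_mat n m" "B \<in> carrier_mat m k" "i < n" "j < k"
  shows "(A * B) $$ (i, j) = (\<Sum>l<m. A $$ (i, l) * B $$ (l, j))"
  using assms by (simp add: scalar_prod_def atLeast0LessThan)

lemma mult_mat_vec_eq_0_imp:
  fixes P Q :: "complex mat"
  assumes "P \<in> carrier_mat d d" "Q \<in> carrier_mat d d" "P * Q = 1\<^sub>m d" "w \<in> carrier_vec d"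
    and "\<And>i. i < d \<Longrightarrow> (Q *\<^sub>v w) $ i = 0"
  shows "w = 0\<^sub>v d"
proof -
  have "Q *\<^sub>v w = 0\<^sub>v d"
    using assms by (intro eq_vecI) auto
  then have "(P * Q) *\<^sub>v w = 0\<^sub>v d"
    using assms by (subst assoc_mult_mat_vec[of _ d d _ d]) auto
  then show ?thesis
    using assms(3,4) by (simp only: one_mult_mat_vec)
qed

lemma subspace_sum:
  assumes W: "subspace class_ring W (module_vec TYPE(complex) d)"
    and "P \<in> carrier_mat d d" "finite J" "J \<subseteq> {..<d}" "\<And>j. j \<in> J \<Longrightarrow> col P j \<in> W"
  shows "vec d (\<lambda>i. \<Sum>j\<in>J. P $$ (i, j) * v j) \<in> W"
  using assms(3-5)
proof (induction J rule: finite_induct)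
  case empty
  have "vec d (\<lambda>i. 0) = (0\<^sub>v d :: complex vec)"
    by (intro eq_vecI) auto
  then show ?case
    using W by (simp add: subspace_vec_iff)
next
  case (insert j J)
  have "vec d (\<lambda>i. \<Sum>j\<in>insert j J. P $$ (i, j) * v j) = v j \<cdot>\<^sub>v col P j + vec d (\<lambda>i. \<Sum>j\<in>J. P $$ (i, j) * v j)"
    using insert.hyps insert.prems assms(2) by (intro eq_vecI) auto
  then show ?case
    using W insert by (simp add: subspace_vec_iff)
qed

text \<open>Among the invertible matrices take one with the most columns in the subspace.\<close>

lemma adapted_basis:
  assumes W: "subspace class_ring W (module_vec TYPE(complex) d)"
    and proper: "W \<noteq> {0\<^sub>v d}" "W \<noteq> carrier_vec d"
  shows "\<exists>P Q J. P \<in> carrier_mat d d \<and> Q \<in> carrier_mat d d \<and> P * Q = 1\<^sub>m d \<and> Q * P = 1\<^sub>m d \<and>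
    J \<subseteq> {..<d} \<and> J \<noteq> {} \<and> J \<noteq> {..<d} \<and> (\<forall>j\<in>J. col P j \<in> W) \<and>
    (\<forall>w\<in>W. \<forall>i<d. i \<notin> J \<longrightarrow> (Q *\<^sub>v w) $ i = 0)"
proof -
  define good where "good = (\<lambda>(P, Q, J). P \<in> carrier_mat d d \<and> Q \<in> carrier_mat d d \<and>
    P * Q = 1\<^sub>m d \<and> J \<subseteq> {..<d} \<and> (\<forall>j\<in>J. col P j \<in> W))"
  have Wd: "W \<subseteq> carrier_vec d"
    using W by (simp add: subspace_vec_iff)
  have "good (1\<^sub>m d, 1\<^sub>m d, {})"
    by (simp add: good_def)
  moreover have "card (snd (snd x)) < Suc d" if "good x" for x
    using that card_mono[of "{..<d}" "snd (snd x)"] by (auto simp: good_def)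
  ultimately obtain x where x: "good x" and max: "\<And>y. good y \<Longrightarrow> card (snd (snd y)) \<le> card (snd (snd x))"
    using ex_has_greatest_nat[of good _ "\<lambda>x. card (snd (snd x))" "Suc d"] by blast
  obtain P Q J where PQJ: "x = (P, Q, J)"
    by (cases x)
  have P: "P \<in> carrier_mat d d" and Q: "Q \<in> carrier_mat d d" and PQ: "P * Q = 1\<^sub>m d"
    and J: "J \<subseteq> {..<d}" and colW: "\<And>j. j \<in> J \<Longrightarrow> col P j \<in> W"
    using x by (auto simp: PQJ good_def)
  have fin: "finite J"
    using J finite_subset by blast
  have zero: "(Q *\<^sub>v w) $ i = 0" if w: "w \<in> W" and i: "i < d" "i \<notin> J" for w i
  proof (rule ccontr)
    define v where "v = Q *\<^sub>v w"
    assume "(Q *\<^sub>v w) $ i \<noteq> 0"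
    then have vi: "v $ i \<noteq> 0"
      by (simp add: v_def)
    \<comment> \<open>\<open>M\<close> is the identity with column \<open>i\<close> replaced by the
      coordinates \<open>v\<close> of \<open>w\<close>, and \<open>N\<close> is its inverse. Then
      \<open>P * M\<close> is invertible, has \<open>w\<close> as column \<open>i\<close>, and
      agrees with \<open>P\<close> on the columns in \<open>J\<close>: one more column lies in
      \<open>W\<close>, against maximality.\<close>
    define M where "M = mat d d (\<lambda>(a, b). if b = i then v $ a else of_bool (a = b))"
    define N where "N = mat d d (\<lambda>(a, b). if b = i then (if a = i then 1 / v $ i else - v $ a / v $ i) else of_bool (a = b))"
    have M: "M \<in> carrier_mat d d" and N: "N \<in> carrier_mat d d"
      by (simp_all add: M_def N_def)
    have MN: "M * N = 1\<^sub>m d"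
    proof (rule eq_matI)
      fix a b assume "a < dim_row (1\<^sub>m d)" "b < dim_col (1\<^sub>m d)"
      then have ab: "a < d" "b < d"
        by auto
      have eq: "(M * N) $$ (a, b) = (\<Sum>c<d. M $$ (a, c) * N $$ (c, b))"
        by (rule index_mult_mat_sum[OF M N ab])
      have "(\<Sum>c<d. M $$ (a, c) * N $$ (c, b)) = of_bool (a = b)"
      proof (cases "b = i")
        case False
        have "(\<Sum>c<d. M $$ (a, c) * N $$ (c, b)) = (\<Sum>c<d. if c = b then M $$ (a, b) else 0)"
          using False ab by (intro sum.cong refl) (auto simp: N_def)
        also have "\<dots> = M $$ (a, b)"
          using ab by simp
        also have "\<dots> = of_bool (a = b)"
          using False ab by (simp add: M_def)
        finally show ?thesis .
      next
        case True
        have "(\<Sum>c<d. M $$ (a, c) * N $$ (c, b)) =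
            M $$ (a, i) * N $$ (i, b) + (\<Sum>c\<in>{..<d} - {i}. M $$ (a, c) * N $$ (c, b))"
          using i(1) by (intro sum.remove) auto
        also have "(\<Sum>c\<in>{..<d} - {i}. M $$ (a, c) * N $$ (c, b)) =
            (\<Sum>c\<in>{..<d} - {i}. if c = a then - v $ a / v $ i else 0)"
          using True ab i(1) by (intro sum.cong refl) (auto simp: M_def N_def)
        also have "M $$ (a, i) * N $$ (i, b) + \<dots> = of_bool (a = b)"
          using True ab i(1) vi by (simp add: M_def N_def)
        finally show ?thesis .
      qed
      then show "(M * N) $$ (a, b) = 1\<^sub>m d $$ (a, b)"
        unfolding eq using ab by simp
    qed (use M N in auto)
    have NM: "N * M = 1\<^sub>m d"
      by (rule mat_mult_left_right_inverse[OF M N MN])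
    have "P * M * (N * Q) = P * (M * N) * Q"
      using P M N Q by (simp add: assoc_mult_mat[of _ d d _ d _ d])
    then have inv: "P * M * (N * Q) = 1\<^sub>m d"
      using MN P PQ by simp
    have col_i: "col (P * M) i = w"
    proof -
      have "col M i = v"
        using i(1) Q w Wd by (intro eq_vecI) (auto simp: M_def v_def)
      then have "col (P * M) i = P *\<^sub>v (Q *\<^sub>v w)"
        using col_mult2[OF P M i(1)] by (simp add: v_def)
      also have "\<dots> = (P * Q) *\<^sub>v w"
        using P Q w Wd by (intro assoc_mult_mat_vec[symmetric]) auto
      finally show ?thesis
        using PQ w Wd by auto
    qed
    have col_j: "col (P * M) j = col P j" if "j \<in> J" for j
    proof -
      have j: "j < d" "j \<noteq> i"
        using that J i by auto
      then have "col M j = unit_vec d j"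
        by (intro eq_vecI) (auto simp: M_def)
      then have "col (P * M) j = P *\<^sub>v unit_vec d j"
        using col_mult2[OF P M j(1)] by simp
      also have "\<dots> = col P j"
        using P j by (intro eq_vecI) (auto simp: scalar_prod_right_unit)
      finally show ?thesis .
    qed
    have "good (P * M, N * Q, insert i J)"
      using P M N Q inv J i w colW col_i col_j by (auto simp: good_def)
    then have "card (insert i J) \<le> card J"
      using max PQJ by fastforce
    then show False
      using i fin by simp
  qed
  \<comment> \<open>With \<open>J\<close> empty every vector of \<open>W\<close> has zero
    coordinates and \<open>W\<close> is zero; with \<open>J\<close> full the columns of
    \<open>P\<close> span the whole space inside \<open>W\<close>.\<close>
  have "J \<noteq> {}"
  proof
    assume "J = {}"
    then have "w = 0\<^sub>v d" if "w \<in> W" for w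
      using mult_mat_vec_eq_0_imp[OF P Q PQ, of w] zero that Wd by auto
    then show False
      using proper(1) W by (auto simp: subspace_vec_iff)
  qed
  moreover have "J \<noteq> {..<d}"
  proof
    assume J: "J = {..<d}"
    have "v \<in> W" if v: "v \<in> carrier_vec d" for v
    proof -
      have "vec d (\<lambda>i. \<Sum>j\<in>J. P $$ (i, j) * (Q *\<^sub>v v) $ j) = P *\<^sub>v (Q *\<^sub>v v)"
        using P Q v J
        by (intro eq_vecI) (auto simp: scalar_prod_def atLeast0LessThan)
      also have "\<dots> = (P * Q) *\<^sub>v v"
        using P Q v by (intro assoc_mult_mat_vec[symmetric]) auto
      also have "\<dots> = v"
        using PQ v by simp
      finally show ?thesis
        using subspace_sum[OF W P fin, of "\<lambda>j. (Q *\<^sub>v v) $ j"] J colW by simp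
    qed
    then show False
      using proper(2) Wd by auto
  qed
  ultimately show ?thesis
    using P Q PQ mat_mult_left_right_inverse[OF P Q PQ] J colW zero
    by (intro exI[of _ P] exI[of _ Q] exI[of _ J] conjI ballI allI impI)
qed

section \<open>Representations in coordinates\<close>

lemma representationD:
  assumes "group G" "representation G d \<rho>"
  shows "\<And>g. g \<in> carrier G \<Longrightarrow> \<rho> g \<in> carrier_mat d d"
    and "\<And>g h. g \<in> carrier G \<Longrightarrow> h \<in> carrier G \<Longrightarrow> \<rho> (g \<otimes>\<^bsub>G\<^esub> h) = \<rho> g * \<rho> h"
    and "\<rho> \<one>\<^bsub>G\<^esub> = 1\<^sub>m d"
proof -
  interpret group G by fact
  have units: "\<rho> g \<in> Units (ring_mat TYPE(complex) d ())" if "g \<in> carrier G" for g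
    using assms(2) that by (auto simp: representation_def hom_def units_of_def)
  then show carrier: "\<rho> g \<in> carrier_mat d d" if "g \<in> carrier G" for g
    using that by (auto simp: Units_def ring_mat_def)
  show mult: "\<rho> (g \<otimes>\<^bsub>G\<^esub> h) = \<rho> g * \<rho> h" if "g \<in> carrier G" "h \<in> carrier G" for g h
    using assms(2) that by (auto simp: representation_def hom_def units_of_def ring_mat_def)
  \<comment> \<open>The matrix of the group identity is idempotent; its left inverse
    \<open>Y\<close> cancels one factor and leaves the identity matrix.\<close>
  obtain Y where Y: "Y \<in> carrier_mat d d" "Y * \<rho> \<one>\<^bsub>G\<^esub> = 1\<^sub>m d"
    using units[OF one_closed] by (auto simp: Units_def ring_mat_def)
  have "\<rho> \<one>\<^bsub>G\<^esub> = (Y * \<rho> \<one>\<^bsub>G\<^esub>) * \<rho> \<one>\<^bsub>G\<^esub>"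
    using Y carrier[OF one_closed] by simp
  also have "\<dots> = Y * (\<rho> \<one>\<^bsub>G\<^esub> * \<rho> \<one>\<^bsub>G\<^esub>)"
    using Y carrier[OF one_closed] by (intro assoc_mult_mat) auto
  also have "\<rho> \<one>\<^bsub>G\<^esub> * \<rho> \<one>\<^bsub>G\<^esub> = \<rho> \<one>\<^bsub>G\<^esub>"
    using mult[OF one_closed one_closed] by simp
  finally show "\<rho> \<one>\<^bsub>G\<^esub> = 1\<^sub>m d"
    using Y by simp
qed

lemma representationI:
  assumes "group G"
    and carrier: "\<And>g. g \<in> carrier G \<Longrightarrow> \<rho> g \<in> carrier_mat d d"
    and mult: "\<And>g h. g \<in> carrier G \<Longrightarrow> h \<in> carrier G \<Longrightarrow> \<rho> (g \<otimes>\<^bsub>G\<^esub> h) = \<rho> g * \<rho> h"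
    and one: "\<rho> \<one>\<^bsub>G\<^esub> = 1\<^sub>m d"
  shows "representation G d \<rho>"
proof -
  interpret group G by fact
  have "\<rho> g \<in> Units (ring_mat TYPE(complex) d ())" if "g \<in> carrier G" for g
  proof -
    have "\<rho> (inv\<^bsub>G\<^esub> g) * \<rho> g = 1\<^sub>m d" "\<rho> g * \<rho> (inv\<^bsub>G\<^esub> g) = 1\<^sub>m d"
      using that one mult[of "inv\<^bsub>G\<^esub> g" g] mult[of g "inv\<^bsub>G\<^esub> g"] by simp_all
    then show ?thesis
      using that carrier inv_closed[OF that] unfolding Units_def ring_mat_def by force
  qed
  then show ?thesis
    using mult by (auto simp: representation_def hom_def units_of_def ring_mat_def)
qed

lemma representation_mult_index:
  assumes "group G" "representation G d \<rho>" "g \<in> carrier G" "h \<in> carrier G" "i < d" "j < d"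
  shows "\<rho> (g \<otimes>\<^bsub>G\<^esub> h) $$ (i, j) = (\<Sum>k<d. \<rho> g $$ (i, k) * \<rho> h $$ (k, j))"
  using assms index_mult_mat_sum[of "\<rho> g" d d "\<rho> h" d i j] representationD[OF assms(1,2)] by simp

section \<open>The span of irreducible coefficients and Maschke's theorem\<close>

text \<open>The linear span of the entries of all irreducible representations, as functions on the
  group; \<open>restrict_cong\<close> identifies functions that agree on the carrier, where alone a
  representation is constrained. The inductive form supplies the induction that carries
  orthogonality and expansions from single entries to the span.\<close>

inductive_set matrix_coefficients :: "('a, 'b) monoid_scheme \<Rightarrow> ('a \<Rightarrow> complex) set" for G where
  entry: "irreducible_representation G d \<rho> \<Longrightarrow> i < d \<Longrightarrow> j < d \<Longrightarrow>
    (\<lambda>g. \<rho> g $$ (i, j)) \<in> matrix_coefficients G"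
| zero: "(\<lambda>g. 0) \<in> matrix_coefficients G"
| add: "f \<in> matrix_coefficients G \<Longrightarrow> f' \<in> matrix_coefficients G \<Longrightarrow>
    (\<lambda>g. f g + f' g) \<in> matrix_coefficients G"
| scale: "f \<in> matrix_coefficients G \<Longrightarrow> (\<lambda>g. c * f g) \<in> matrix_coefficients G"
| restrict_cong: "f \<in> matrix_coefficients G \<Longrightarrow> (\<And>g. g \<in> carrier G \<Longrightarrow> f g = f' g) \<Longrightarrow>
    f' \<in> matrix_coefficients G"

lemma matrix_coefficients_sum:
  assumes "finite J" "\<And>j. j \<in> J \<Longrightarrow> f j \<in> matrix_coefficients G"
  shows "(\<lambda>g. \<Sum>j\<in>J. c j * f j g) \<in> matrix_coefficients G"
  using assms
proof (induction J rule: finite_induct)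
  case empty
  show ?case
    using matrix_coefficients.zero by simp
next
  case (insert j J)
  have "(\<lambda>g. c j * f j g + (\<Sum>j\<in>J. c j * f j g)) \<in> matrix_coefficients G"
    using insert by (intro matrix_coefficients.add matrix_coefficients.scale) auto
  then show ?case
    using insert.hyps by simp
qed

text \<open>A diagonal block is indexed by a subset \<open>J\<close> of the index range. Renumbering
  it by an initial segment makes it a representation in the sense of the definition.\<close>

lemma representation_on_indices:
  fixes R :: "'a \<Rightarrow> nat \<Rightarrow> nat \<Rightarrow> complex"
  assumes "group G" and h: "bij_betw h {..<n} J"
    and mult: "\<And>g g' i j. g \<in> carrier G \<Longrightarrow> g' \<in> carrier G \<Longrightarrow> i \<in> J \<Longrightarrow> j \<in> J \<Longrightarrow>
      R (g \<otimes>\<^bsub>G\<^esub> g') i j = (\<Sum>k\<in>J. R g i k * R g' k j)"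
    and one: "\<And>i j. i \<in> J \<Longrightarrow> j \<in> J \<Longrightarrow> R \<one>\<^bsub>G\<^esub> i j = of_bool (i = j)"
  shows "representation G n (\<lambda>g. mat n n (\<lambda>(i, j). R g (h i) (h j)))"
proof (rule representationI[OF assms(1)])
  have mem: "h i \<in> J" if "i < n" for i
    using h that by (auto simp: bij_betw_def)
  show "mat n n (\<lambda>(i, j). R g (h i) (h j)) \<in> carrier_mat n n" for g
    by simp
  show "mat n n (\<lambda>(i, j). R \<one>\<^bsub>G\<^esub> (h i) (h j)) = 1\<^sub>m n"
    using h mem by (intro eq_matI) (auto simp: one bij_betw_def inj_on_def)
  fix g g' assume g: "g \<in> carrier G" "g' \<in> carrier G"
  show "mat n n (\<lambda>(i, j). R (g \<otimes>\<^bsub>G\<^esub> g') (h i) (h j)) =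
      mat n n (\<lambda>(i, j). R g (h i) (h j)) * mat n n (\<lambda>(i, j). R g' (h i) (h j))"
  proof (rule eq_matI)
    fix i j assume "i < dim_row (mat n n (\<lambda>(i, j). R g (h i) (h j)) * mat n n (\<lambda>(i, j). R g' (h i) (h j)))"
      "j < dim_col (mat n n (\<lambda>(i, j). R g (h i) (h j)) * mat n n (\<lambda>(i, j). R g' (h i) (h j)))"
    then have ij: "i < n" "j < n"
      by auto
    have "R (g \<otimes>\<^bsub>G\<^esub> g') (h i) (h j) = (\<Sum>k<n. R g (h i) (h k) * R g' (h k) (h j))"
      using mult[OF g mem mem, OF ij] sum.reindex_bij_betw[OF h, of "\<lambda>k. R g (h i) k * R g' k (h j)"] by simp
    then show "mat n n (\<lambda>(i, j). R (g \<otimes>\<^bsub>G\<^esub> g') (h i) (h j)) $$ (i, j) =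
        (mat n n (\<lambda>(i, j). R g (h i) (h j)) * mat n n (\<lambda>(i, j). R g' (h i) (h j))) $$ (i, j)"
      using ij index_mult_mat_sum[of "mat n n (\<lambda>(i, j). R g (h i) (h j))" n n
          "mat n n (\<lambda>(i, j). R g' (h i) (h j))" n i j] by simp
  qed auto
qed

lemma sum_group_translate:
  assumes "group G" "a \<in> carrier G"
  shows "(\<Sum>g\<in>carrier G. f (a \<otimes>\<^bsub>G\<^esub> g)) = (\<Sum>g\<in>carrier G. f g)"
proof -
  interpret group G by fact
  show ?thesis
    using assms(2)
    by (intro sum.reindex_bij_witness[of _ "\<lambda>g. inv\<^bsub>G\<^esub> a \<otimes>\<^bsub>G\<^esub> g" "\<lambda>g. a \<otimes>\<^bsub>G\<^esub> g"])
       (auto simp: m_assoc[symmetric])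
qed

text \<open>
  Maschke's theorem in coordinates: the off-diagonal block of a block triangular representation
  is the coboundary of the average \<open>X\<close>.
\<close>

lemma maschke_off_diagonal:
  fixes R :: "'a \<Rightarrow> nat \<Rightarrow> nat \<Rightarrow> complex"
  assumes "group G" "finite (carrier G)"
    and mult_JK: "\<And>g g' i j. g \<in> carrier G \<Longrightarrow> g' \<in> carrier G \<Longrightarrow> i \<in> J \<Longrightarrow> j \<in> K \<Longrightarrow>
      R (g \<otimes>\<^bsub>G\<^esub> g') i j = (\<Sum>k\<in>J. R g i k * R g' k j) + (\<Sum>k\<in>K. R g i k * R g' k j)"
    and mult_K: "\<And>g g' i j. g \<in> carrier G \<Longrightarrow> g' \<in> carrier G \<Longrightarrow> i \<in> K \<Longrightarrow> j \<in> K \<Longrightarrow>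
      R (g \<otimes>\<^bsub>G\<^esub> g') i j = (\<Sum>k\<in>K. R g i k * R g' k j)"
    and one: "\<And>i j. i \<in> K \<Longrightarrow> j \<in> K \<Longrightarrow> R \<one>\<^bsub>G\<^esub> i j = of_bool (i = j)"
    and "finite K"
  obtains X where "\<And>g i j. g \<in> carrier G \<Longrightarrow> i \<in> J \<Longrightarrow> j \<in> K \<Longrightarrow>
    R g i j = (\<Sum>k\<in>K. X i k * R g k j) - (\<Sum>k\<in>J. X k j * R g i k)"
proof -
  interpret group G by fact
  define N where "N = complex_of_nat (card (carrier G))"
  have N: "N \<noteq> 0"
    using assms(2) by (auto simp: N_def card_eq_0_iff)
  \<comment> \<open>Write B for the J x K block and D for the K x K block of \<open>R\<close>. This
    is the sum of B(h) D(h^-1) over the group.\<close>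
  define Y where "Y i j = (\<Sum>h\<in>carrier G. \<Sum>l\<in>K. R h i l * R (inv\<^bsub>G\<^esub> h) l j)" for i j
  have "N * R g i j = (\<Sum>k\<in>K. Y i k * R g k j) - (\<Sum>k\<in>J. Y k j * R g i k)"
    if g: "g \<in> carrier G" and ij: "i \<in> J" "j \<in> K" for g i j
  proof -
    have "(\<Sum>k\<in>J. Y k j * R g i k) = (\<Sum>k\<in>J. \<Sum>h\<in>carrier G. \<Sum>l\<in>K. R g i k * R h k l * R (inv\<^bsub>G\<^esub> h) l j)"
      unfolding Y_def sum_distrib_right by (intro sum.cong refl) (simp add: mult_ac)
    also have "\<dots> = (\<Sum>h\<in>carrier G. \<Sum>k\<in>J. \<Sum>l\<in>K. R g i k * R h k l * R (inv\<^bsub>G\<^esub> h) l j)"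
      by (rule sum.swap)
    also have "\<dots> = (\<Sum>h\<in>carrier G. \<Sum>l\<in>K. (\<Sum>k\<in>J. R g i k * R h k l) * R (inv\<^bsub>G\<^esub> h) l j)"
      unfolding sum_distrib_right by (intro sum.cong refl sum.swap)
    \<comment> \<open>With A the J x J block, block triangularity gives A(g) B(h) = B(gh) - B(g)
      D(h). Summed against D(h^-1), the last product contributes N B(g), and translation by g turns
      the other sum into Y D(g).\<close>
    also have "\<dots> = (\<Sum>h\<in>carrier G. \<Sum>l\<in>K. (R (g \<otimes>\<^bsub>G\<^esub> h) i l - (\<Sum>k\<in>K. R g i k * R h k l)) * R (inv\<^bsub>G\<^esub> h) l j)"
      by (intro sum.cong refl) (simp add: mult_JK g ij)
    also have "\<dots> = (\<Sum>h\<in>carrier G. \<Sum>l\<in>K. R (g \<otimes>\<^bsub>G\<^esub> h) i l * R (inv\<^bsub>G\<^esub> h) l j) -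
        (\<Sum>h\<in>carrier G. \<Sum>l\<in>K. \<Sum>k\<in>K. R g i k * R h k l * R (inv\<^bsub>G\<^esub> h) l j)"
      by (simp only: left_diff_distrib sum_subtractf sum_distrib_right)
    also have "(\<Sum>h\<in>carrier G. \<Sum>l\<in>K. \<Sum>k\<in>K. R g i k * R h k l * R (inv\<^bsub>G\<^esub> h) l j) = (\<Sum>h\<in>carrier G. R g i j)"
    proof (rule sum.cong[OF refl])
      fix h assume h: "h \<in> carrier G"
      have "(\<Sum>l\<in>K. \<Sum>k\<in>K. R g i k * R h k l * R (inv\<^bsub>G\<^esub> h) l j) =
          (\<Sum>k\<in>K. R g i k * (\<Sum>l\<in>K. R h k l * R (inv\<^bsub>G\<^esub> h) l j))"
        unfolding sum_distrib_left mult.assoc by (rule sum.swap)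
      also have "\<dots> = (\<Sum>k\<in>K. if k = j then R g i j else 0)"
      proof (rule sum.cong[OF refl])
        fix k assume k: "k \<in> K"
        have "(\<Sum>l\<in>K. R h k l * R (inv\<^bsub>G\<^esub> h) l j) = of_bool (k = j)"
          using mult_K[OF h inv_closed[OF h] k ij(2)] one[OF k ij(2)] h by simp
        then show "R g i k * (\<Sum>l\<in>K. R h k l * R (inv\<^bsub>G\<^esub> h) l j) = (if k = j then R g i j else 0)"
          by simp
      qed
      also have "\<dots> = R g i j"
        using ij \<open>finite K\<close> by simp
      finally show "(\<Sum>l\<in>K. \<Sum>k\<in>K. R g i k * R h k l * R (inv\<^bsub>G\<^esub> h) l j) = R g i j" .
    qed
    also have "(\<Sum>h\<in>carrier G. R g i j) = N * R g i j"
      by (simp add: N_def)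
    also have "(\<Sum>h\<in>carrier G. \<Sum>l\<in>K. R (g \<otimes>\<^bsub>G\<^esub> h) i l * R (inv\<^bsub>G\<^esub> h) l j) =
        (\<Sum>h\<in>carrier G. \<Sum>l\<in>K. R h i l * R (inv\<^bsub>G\<^esub> h \<otimes>\<^bsub>G\<^esub> g) l j)"
    proof -
      have "(\<Sum>h\<in>carrier G. \<Sum>l\<in>K. R (g \<otimes>\<^bsub>G\<^esub> h) i l * R (inv\<^bsub>G\<^esub> h) l j) =
          (\<Sum>h\<in>carrier G. \<Sum>l\<in>K. R (g \<otimes>\<^bsub>G\<^esub> h) i l * R (inv\<^bsub>G\<^esub> (g \<otimes>\<^bsub>G\<^esub> h) \<otimes>\<^bsub>G\<^esub> g) l j)"
      proof (intro sum.cong refl)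
        fix h l assume "h \<in> carrier G"
        then have "inv\<^bsub>G\<^esub> (g \<otimes>\<^bsub>G\<^esub> h) \<otimes>\<^bsub>G\<^esub> g = inv\<^bsub>G\<^esub> h"
          using g by (simp add: inv_mult_group m_assoc)
        then show "R (g \<otimes>\<^bsub>G\<^esub> h) i l * R (inv\<^bsub>G\<^esub> h) l j = R (g \<otimes>\<^bsub>G\<^esub> h) i l * R (inv\<^bsub>G\<^esub> (g \<otimes>\<^bsub>G\<^esub> h) \<otimes>\<^bsub>G\<^esub> g) l j"
          by simp
      qed
      also have "\<dots> = (\<Sum>h\<in>carrier G. \<Sum>l\<in>K. R h i l * R (inv\<^bsub>G\<^esub> h \<otimes>\<^bsub>G\<^esub> g) l j)"
        by (rule sum_group_translate[OF assms(1) g, of "\<lambda>h. \<Sum>l\<in>K. R h i l * R (inv\<^bsub>G\<^esub> h \<otimes>\<^bsub>G\<^esub> g) l j"])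
      finally show ?thesis .
    qed
    also have "\<dots> = (\<Sum>h\<in>carrier G. \<Sum>l\<in>K. \<Sum>k\<in>K. R h i l * R (inv\<^bsub>G\<^esub> h) l k * R g k j)"
      by (intro sum.cong refl) (simp add: mult_K g ij sum_distrib_left mult.assoc)
    also have "\<dots> = (\<Sum>h\<in>carrier G. \<Sum>k\<in>K. \<Sum>l\<in>K. R h i l * R (inv\<^bsub>G\<^esub> h) l k * R g k j)"
      by (intro sum.cong refl sum.swap)
    also have "\<dots> = (\<Sum>k\<in>K. \<Sum>h\<in>carrier G. \<Sum>l\<in>K. R h i l * R (inv\<^bsub>G\<^esub> h) l k * R g k j)"
      by (rule sum.swap)
    also have "\<dots> = (\<Sum>k\<in>K. Y i k * R g k j)"
      by (simp only: Y_def sum_distrib_right)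
    finally show ?thesis
      by simp
  qed
  then have "R g i j = (\<Sum>k\<in>K. (Y i k / N) * R g k j) - (\<Sum>k\<in>J. (Y k j / N) * R g i k)"
    if "g \<in> carrier G" "i \<in> J" "j \<in> K" for g i j
    using N that by (simp add: field_simps flip: sum_divide_distrib)
  then show ?thesis
    using that[of "\<lambda>i k. Y i k / N"] by blast
qed

text \<open>Strong induction on the dimension. In a basis adapted to a proper invariant subspace the
  matrices are block triangular; the diagonal blocks are representations of smaller dimension, and
  the off-diagonal entries are combinations of theirs. Maschke's theorem thus enters at the level of
  coefficients.\<close>

lemma representation_coefficients:
  assumes "group G" "finite (carrier G)"
  shows "representation G d \<rho> \<Longrightarrow> i < d \<Longrightarrow> j < d \<Longrightarrow> (\<lambda>g. \<rho> g $$ (i, j)) \<in> matrix_coefficients G"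
proof (induction d arbitrary: \<rho> i j rule: less_induct)
  case (less d)
  interpret group G by fact
  note rep = representationD[OF assms(1) less.prems(1)]
  show ?case
  proof (cases "irreducible_representation G d \<rho>")
    case True
    then show ?thesis
      using less.prems by (intro matrix_coefficients.entry)
  next
    case False
    have "\<not> (\<forall>W. subspace class_ring W (module_vec TYPE(complex) d) \<and>
        (\<forall>g\<in>carrier G. \<forall>v\<in>W. \<rho> g *\<^sub>v v \<in> W) \<longrightarrow> W = {0\<^sub>v d} \<or> W = carrier_vec d)"
      (is "\<not> ?irr")
    proof
      assume ?irr
      with less.prems have "irreducible_representation G d \<rho>"
        unfolding irreducible_representation_def by (intro conjI) simp_all
      then show False
        using False by contradiction
    qed
    then obtain W where W: "subspace class_ring W (module_vec TYPE(complex) d)"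
      and inv: "\<And>g v. g \<in> carrier G \<Longrightarrow> v \<in> W \<Longrightarrow> \<rho> g *\<^sub>v v \<in> W"
      and proper: "W \<noteq> {0\<^sub>v d}" "W \<noteq> carrier_vec d"
      by (simp only: not_all not_imp de_Morgan_disj) (elim exE conjE, blast)
    obtain P Q J where P: "P \<in> carrier_mat d d" and Q: "Q \<in> carrier_mat d d"
      and PQ: "P * Q = 1\<^sub>m d" and QP: "Q * P = 1\<^sub>m d"
      and J: "J \<subseteq> {..<d}" "J \<noteq> {}" "J \<noteq> {..<d}" and col: "\<forall>j\<in>J. col P j \<in> W"
      and zero: "\<forall>w\<in>W. \<forall>i<d. i \<notin> J \<longrightarrow> (Q *\<^sub>v w) $ i = 0"
      using adapted_basis[OF W proper] by (elim exE conjE)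
    define K where "K = {..<d} - J"
    have fin: "finite J" "finite K" and JK: "J \<union> K = {..<d}" "J \<inter> K = {}"
      using J finite_subset[OF J(1)] by (auto simp: K_def)
    have card: "card J < d" "card K < d"
      using J psubset_card_mono[of "{..<d}" J] psubset_card_mono[of "{..<d}" K] by (auto simp: K_def)
    define S where "S g = Q * (\<rho> g * P)" for g
    have rP: "\<rho> g * P \<in> carrier_mat d d" if "g \<in> carrier G" for g
      by (rule mult_carrier_mat[OF rep(1)[OF that] P])
    have S: "S g \<in> carrier_mat d d" if "g \<in> carrier G" for g
      unfolding S_def by (rule mult_carrier_mat[OF Q rP[OF that]])
    define R where "R g i j = S g $$ (i, j)" for g i j
    have S_mult: "S (g \<otimes>\<^bsub>G\<^esub> g') = S g * S g'" if g: "g \<in> carrier G" "g' \<in> carrier G" for g g'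
    proof -
      note r = rep(1)[OF g(1)] and r' = rP[OF g(2)]
      have "S g * S g' = Q * ((\<rho> g * P) * (Q * (\<rho> g' * P)))"
        unfolding S_def by (rule assoc_mult_mat[OF Q rP[OF g(1)] S[OF g(2), unfolded S_def]])
      also have "(\<rho> g * P) * (Q * (\<rho> g' * P)) = \<rho> g * (P * (Q * (\<rho> g' * P)))"
        by (rule assoc_mult_mat[OF r P S[OF g(2), unfolded S_def]])
      also have "P * (Q * (\<rho> g' * P)) = (P * Q) * (\<rho> g' * P)"
        by (rule assoc_mult_mat[OF P Q r', symmetric])
      also have "\<dots> = \<rho> g' * P"
        using PQ left_mult_one_mat[OF r'] by simp
      also have "\<rho> g * (\<rho> g' * P) = (\<rho> g * \<rho> g') * P"
        by (rule assoc_mult_mat[OF r rep(1)[OF g(2)] P, symmetric])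
      finally show ?thesis
        using rep(2)[OF g] by (simp add: S_def)
    qed
    have R_mult: "R (g \<otimes>\<^bsub>G\<^esub> g') i j = (\<Sum>k\<in>J. R g i k * R g' k j) + (\<Sum>k\<in>K. R g i k * R g' k j)"
      if "g \<in> carrier G" "g' \<in> carrier G" "i < d" "j < d" for g g' i j
    proof -
      have "R (g \<otimes>\<^bsub>G\<^esub> g') i j = (\<Sum>k\<in>J \<union> K. R g i k * R g' k j)"
        unfolding R_def S_mult[OF that(1,2)] JK(1)
        by (rule index_mult_mat_sum[OF S S]) (use that in auto)
      then show ?thesis
        using fin JK(2) by (simp add: sum.union_disjoint)
    qed
    have R_zero: "R g i j = 0" if g: "g \<in> carrier G" and ij: "i \<in> K" "j \<in> J" for g i j
    proof -
      have ij': "i < d" "i \<notin> J" "j < d"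
        using ij J by (auto simp: K_def)
      have "R g i j = col (S g) j $ i"
        using S[OF g] ij' by (simp add: R_def)
      also have "col (S g) j = Q *\<^sub>v (\<rho> g *\<^sub>v col P j)"
        unfolding S_def using col_mult2[OF Q rP[OF g] ij'(3)] col_mult2[OF rep(1)[OF g] P ij'(3)] by simp
      also have "\<dots> $ i = 0"
        using zero inv[OF g] col ij(2) ij'(1,2) by blast
      finally show ?thesis .
    qed
    have R_J: "R (g \<otimes>\<^bsub>G\<^esub> g') i j = (\<Sum>k\<in>J. R g i k * R g' k j)"
      if "g \<in> carrier G" "g' \<in> carrier G" "i \<in> J" "j \<in> J" for g g' i j
    proof -
      have "(\<Sum>k\<in>K. R g i k * R g' k j) = 0"
        using R_zero that by simp
      then show ?thesis
        using R_mult[of g g' i j] that JK(1) by auto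
    qed
    have R_K: "R (g \<otimes>\<^bsub>G\<^esub> g') i j = (\<Sum>k\<in>K. R g i k * R g' k j)"
      if "g \<in> carrier G" "g' \<in> carrier G" "i \<in> K" "j \<in> K" for g g' i j
    proof -
      have "(\<Sum>k\<in>J. R g i k * R g' k j) = 0"
        using R_zero that by simp
      then show ?thesis
        using R_mult[of g g' i j] that JK(1) by auto
    qed
    have R_one: "R \<one>\<^bsub>G\<^esub> i j = of_bool (i = j)" if "i < d" "j < d" for i j
      using rep(3) left_mult_one_mat[OF P] QP that by (simp add: R_def S_def)
    have diag: "(\<lambda>g. R g i j) \<in> matrix_coefficients G"
      if L: "finite L" "card L < d" "L \<subseteq> {..<d}" and ij: "i \<in> L" "j \<in> L"
        and mult: "\<And>g g' i j. g \<in> carrier G \<Longrightarrow> g' \<in> carrier G \<Longrightarrow> i \<in> L \<Longrightarrow> j \<in> L \<Longrightarrow>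
          R (g \<otimes>\<^bsub>G\<^esub> g') i j = (\<Sum>k\<in>L. R g i k * R g' k j)" for L i j
    proof -
      obtain h where h: "bij_betw h {..<card L} L"
        using ex_bij_betw_nat_finite[OF L(1)] by (auto simp: atLeast0LessThan)
      obtain i' j' where ij': "i' < card L" "h i' = i" "j' < card L" "h j' = j"
        using ij h by (metis bij_betw_imp_surj_on imageE lessThan_iff)
      have "representation G (card L) (\<lambda>g. mat (card L) (card L) (\<lambda>(i, j). R g (h i) (h j)))"
      proof (rule representation_on_indices[OF assms(1) h mult])
        show "R \<one>\<^bsub>G\<^esub> i j = of_bool (i = j)" if "i \<in> L" "j \<in> L" for i j
          using subsetD[OF L(3) that(1)] subsetD[OF L(3) that(2)] by (intro R_one) simp_all
      qed
      from less.IH[OF L(2) this ij'(1,3)] show ?thesis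
        using ij' by simp
    qed
    have diag_J: "(\<lambda>g. R g i j) \<in> matrix_coefficients G" if "i \<in> J" "j \<in> J" for i j
      by (rule diag[OF fin(1) card(1) J(1) that R_J])
    have diag_K: "(\<lambda>g. R g i j) \<in> matrix_coefficients G" if "i \<in> K" "j \<in> K" for i j
      by (rule diag[OF fin(2) card(2) _ that R_K]) (auto simp: K_def)
    obtain X where X: "\<And>g i j. g \<in> carrier G \<Longrightarrow> i \<in> J \<Longrightarrow> j \<in> K \<Longrightarrow>
        R g i j = (\<Sum>k\<in>K. X i k * R g k j) - (\<Sum>k\<in>J. X k j * R g i k)"
    proof (rule maschke_off_diagonal[OF assms, of J K R])
      show "R (g \<otimes>\<^bsub>G\<^esub> g') i j = (\<Sum>k\<in>J. R g i k * R g' k j) + (\<Sum>k\<in>K. R g i k * R g' k j)"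
        if "g \<in> carrier G" "g' \<in> carrier G" "i \<in> J" "j \<in> K" for g g' i j
        using R_mult[of g g' i j] that JK(1) by auto
      show "R \<one>\<^bsub>G\<^esub> i j = of_bool (i = j)" if "i \<in> K" "j \<in> K" for i j
        using R_one[of i j] that by (auto simp: K_def)
    qed (use R_K fin in auto)
    have off: "(\<lambda>g. R g i j) \<in> matrix_coefficients G" if ij: "i \<in> J" "j \<in> K" for i j
    proof -
      have "(\<lambda>g. (\<Sum>k\<in>K. X i k * R g k j) + - 1 * (\<Sum>k\<in>J. X k j * R g i k)) \<in> matrix_coefficients G"
        by (intro matrix_coefficients.add matrix_coefficients.scale matrix_coefficients_sum fin diag_J diag_K ij)
      then show ?thesis
        by (rule matrix_coefficients.restrict_cong) (use X ij in auto)
    qed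
    have R_coeff: "(\<lambda>g. R g i j) \<in> matrix_coefficients G" if "i < d" "j < d" for i j
    proof -
      have "(\<lambda>g. R g i j) \<in> matrix_coefficients G" if "i \<in> K" "j \<in> J"
        by (rule matrix_coefficients.restrict_cong[OF matrix_coefficients.zero]) (use R_zero that in auto)
      then show ?thesis
        using that JK(1) diag_J diag_K off by blast
    qed
    have "\<rho> g $$ (i, j) = (\<Sum>(k, l)\<in>{..<d} \<times> {..<d}. (P $$ (i, k) * Q $$ (l, j)) * R g k l)"
      if g: "g \<in> carrier G" for g
    proof -
      have "P * S g = (P * Q) * (\<rho> g * P)"
        unfolding S_def by (rule assoc_mult_mat[OF P Q rP[OF g], symmetric])
      then have "P * S g = \<rho> g * P"
        using PQ left_mult_one_mat[OF rP[OF g]] by simp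
      then have "(P * S g) * Q = \<rho> g * (P * Q)"
        using assoc_mult_mat[OF rep(1)[OF g] P Q] by simp
      then have "\<rho> g = (P * S g) * Q"
        using PQ rep(1)[OF g] by simp
      then have "\<rho> g $$ (i, j) = (\<Sum>l<d. (P * S g) $$ (i, l) * Q $$ (l, j))"
        using index_mult_mat_sum[OF mult_carrier_mat[OF P S[OF g]] Q less.prems(2,3)] by simp
      also have "\<dots> = (\<Sum>l<d. \<Sum>k<d. (P $$ (i, k) * Q $$ (l, j)) * R g k l)"
        using index_mult_mat_sum[OF P S[OF g] less.prems(2)]
        by (intro sum.cong refl) (simp add: R_def sum_distrib_right sum_distrib_left mult_ac)
      also have "\<dots> = (\<Sum>k<d. \<Sum>l<d. (P $$ (i, k) * Q $$ (l, j)) * R g k l)"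
        by (rule sum.swap)
      finally show ?thesis
        by (simp add: sum.cartesian_product)
    qed
    moreover have "(\<lambda>g. \<Sum>kl\<in>{..<d} \<times> {..<d}. (P $$ (i, fst kl) * Q $$ (snd kl, j)) * R g (fst kl) (snd kl))
        \<in> matrix_coefficients G"
      by (rule matrix_coefficients_sum) (use R_coeff in auto)
    ultimately show ?thesis
      by (elim matrix_coefficients.restrict_cong) (simp add: split_def)
  qed
qed

text \<open>In the regular representation, which permutes a basis labelled by the group, the
  diagonal entry at the identity is 1 exactly when g maps the identity to itself.\<close>

lemma delta_coefficient:
  assumes "group G" "finite (carrier G)"
  shows "(\<lambda>g. of_bool (g = \<one>\<^bsub>G\<^esub>)) \<in> matrix_coefficients G"
proof -
  interpret group G by fact
  let ?n = "card (carrier G)"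
  obtain h where h: "bij_betw h {..<?n} (carrier G)"
    using ex_bij_betw_nat_finite[OF assms(2)] by (auto simp: atLeast0LessThan)
  have mem: "h i \<in> carrier G" if "i < ?n" for i
    using h that by (auto simp: bij_betw_def)
  have inj: "h i = h j \<longleftrightarrow> i = j" if "i < ?n" "j < ?n" for i j
    using h that by (auto simp: bij_betw_def inj_on_def)
  obtain e where e: "e < ?n" "h e = \<one>\<^bsub>G\<^esub>"
    using h one_closed by (metis bij_betw_imp_surj_on imageE lessThan_iff)
  define R :: "'a \<Rightarrow> nat \<Rightarrow> nat \<Rightarrow> complex" where "R g i j = of_bool (h i = g \<otimes>\<^bsub>G\<^esub> h j)" for g i j
  have "representation G ?n (\<lambda>g. mat ?n ?n (\<lambda>(i, j). R g (id i) (id j)))"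
  proof (rule representation_on_indices[OF assms(1), where J = "{..<?n}"])
    show "R (g \<otimes>\<^bsub>G\<^esub> g') i j = (\<Sum>k<?n. R g i k * R g' k j)"
      if g: "g \<in> carrier G" "g' \<in> carrier G" and ij: "i \<in> {..<?n}" "j \<in> {..<?n}" for g g' i j
    proof -
      have hj: "h j \<in> carrier G"
        using ij mem by auto
      obtain k where k: "k < ?n" "h k = g' \<otimes>\<^bsub>G\<^esub> h j"
        using h m_closed[OF g(2) hj] by (metis bij_betw_imp_surj_on imageE lessThan_iff)
      have "(\<Sum>k'<?n. R g i k' * R g' k' j) = (\<Sum>k'<?n. if k' = k then R g i k else 0)"
        using k inj by (intro sum.cong refl) (auto simp: R_def k(2)[symmetric])
      also have "\<dots> = R (g \<otimes>\<^bsub>G\<^esub> g') i j"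
        using k g hj by (simp add: R_def m_assoc)
      finally show ?thesis
        by simp
    qed
    show "R \<one>\<^bsub>G\<^esub> i j = of_bool (i = j)" if "i \<in> {..<?n}" "j \<in> {..<?n}" for i j
      using that mem inj by (simp add: R_def)
  qed (rule bij_betw_id)
  from representation_coefficients[OF assms this e(1) e(1)]
  show ?thesis
  proof (rule matrix_coefficients.restrict_cong)
    show "mat ?n ?n (\<lambda>(i, j). R g (id i) (id j)) $$ (e, e) = of_bool (g = \<one>\<^bsub>G\<^esub>)" if "g \<in> carrier G" for g
      using e that by (auto simp: R_def)
  qed
qed

section \<open>Schur's lemma and orthogonality\<close>

lemma irreducible_representationD:
  assumes "irreducible_representation G d \<rho>"
  shows "representation G d \<rho>" "d \<noteq> 0"
    and "\<And>W. subspace class_ring W (module_vec TYPE(complex) d) \<Longrightarrow>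
      (\<And>g v. g \<in> carrier G \<Longrightarrow> v \<in> W \<Longrightarrow> \<rho> g *\<^sub>v v \<in> W) \<Longrightarrow> W = {0\<^sub>v d} \<or> W = carrier_vec d"
  using assms unfolding irreducible_representation_def by simp_all

lemma isomorphic_representations_iff:
  "isomorphic_representations G (d, \<rho>) (d', \<rho>') \<longleftrightarrow>
     d = d' \<and> (\<exists>P\<in>carrier_mat d d. \<exists>Q\<in>carrier_mat d d. P * Q = 1\<^sub>m d \<and> Q * P = 1\<^sub>m d \<and>
       (\<forall>g\<in>carrier G. P * \<rho> g = \<rho>' g * P))"
proof -
  have "invertible_mat P \<longleftrightarrow> (\<exists>Q\<in>carrier_mat d d. P * Q = 1\<^sub>m d \<and> Q * P = 1\<^sub>m d)"
    if P: "P \<in> carrier_mat d d" for P :: "complex mat"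
  proof
    assume "invertible_mat P"
    then obtain Q where Q: "P * Q = 1\<^sub>m (dim_row P)" "Q * P = 1\<^sub>m (dim_row Q)"
      unfolding invertible_mat_def inverts_mat_def by blast
    then have "dim_col (P * Q) = d" "dim_col (Q * P) = dim_row Q"
      using P by auto
    then have "Q \<in> carrier_mat d d"
      using P by auto
    then show "\<exists>Q\<in>carrier_mat d d. P * Q = 1\<^sub>m d \<and> Q * P = 1\<^sub>m d"
      using Q P by auto
  next
    assume "\<exists>Q\<in>carrier_mat d d. P * Q = 1\<^sub>m d \<and> Q * P = 1\<^sub>m d"
    then show "invertible_mat P"
      using P unfolding invertible_mat_def inverts_mat_def by auto
  qed
  then show ?thesis
    unfolding isomorphic_representations_def by auto
qed

text \<open>Kernel and image of the intertwiner are invariant, so irreducibility makes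
  \<open>Y\<close> injective and surjective. Its inverse is assembled from preimages of the unit
  vectors, and the dimensions agree by \<open>left_inverse_dimension_le\<close> in both
  directions.\<close>

lemma schur:
  assumes "group G" and \<rho>: "irreducible_representation G d \<rho>" and \<sigma>: "irreducible_representation G e \<sigma>"
    and Y: "Y \<in> carrier_mat d e" and comm: "\<And>g. g \<in> carrier G \<Longrightarrow> \<rho> g * Y = Y * \<sigma> g"
    and nonzero: "Y \<noteq> 0\<^sub>m d e"
  shows "isomorphic_representations G (e, \<sigma>) (d, \<rho>)"
proof -
  note rep_\<rho> = representationD[OF assms(1) irreducible_representationD(1)[OF \<rho>]]
  note rep_\<sigma> = representationD[OF assms(1) irreducible_representationD(1)[OF \<sigma>]]
  have equivariant: "Y *\<^sub>v (\<sigma> g *\<^sub>v v) = \<rho> g *\<^sub>v (Y *\<^sub>v v)" if "g \<in> carrier G" "v \<in> carrier_vec e" for g v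
    using comm[OF that(1)] assoc_mult_mat_vec[OF Y rep_\<sigma>(1)[OF that(1)] that(2)]
      assoc_mult_mat_vec[OF rep_\<rho>(1)[OF that(1)] Y that(2)] by simp
  have Y_col: "Y *\<^sub>v unit_vec e j = col Y j" if "j < e" for j
    using that Y by (intro eq_vecI) (auto simp: scalar_prod_right_unit)
  have zero_if: "Y = 0\<^sub>m d e" if "\<And>j. j < e \<Longrightarrow> Y *\<^sub>v unit_vec e j = 0\<^sub>v d"
  proof (rule eq_matI)
    fix i j assume "i < dim_row (0\<^sub>m d e)" "j < dim_col (0\<^sub>m d e)"
    then have ij: "i < d" "j < e"
      by auto
    have "col Y j $ i = 0"
      using that[OF ij(2)] Y_col[OF ij(2)] ij by simp
    then show "Y $$ (i, j) = 0\<^sub>m d e $$ (i, j)"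
      using Y ij by simp
  qed (use Y in auto)
  let ?ker = "{v \<in> carrier_vec e. Y *\<^sub>v v = 0\<^sub>v d}"
  have "?ker = {0\<^sub>v e} \<or> ?ker = carrier_vec e"
  proof (rule irreducible_representationD(3)[OF \<sigma>])
    show "subspace class_ring ?ker (module_vec TYPE(complex) e)"
      using Y by (auto simp: subspace_vec_iff mult_add_distrib_mat_vec[OF Y] mult_mat_vec[OF Y])
    show "\<sigma> g *\<^sub>v v \<in> ?ker" if "g \<in> carrier G" "v \<in> ?ker" for g v
      using that equivariant[of g v] rep_\<rho>(1)[OF that(1)] rep_\<sigma>(1)[OF that(1)] by auto
  qed
  moreover have "?ker \<noteq> carrier_vec e"
    using zero_if nonzero unit_vec_carrier[of e] by blast
  ultimately have ker: "v = 0\<^sub>v e" if "v \<in> carrier_vec e" "Y *\<^sub>v v = 0\<^sub>v d" for v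
    using that by blast
  let ?im = "(\<lambda>v. Y *\<^sub>v v) ` carrier_vec e"
  have "?im = {0\<^sub>v d} \<or> ?im = carrier_vec d"
  proof (rule irreducible_representationD(3)[OF \<rho>])
    show "subspace class_ring ?im (module_vec TYPE(complex) d)"
      unfolding subspace_vec_iff
    proof (intro conjI ballI allI)
      show "?im \<subseteq> carrier_vec d"
        using Y by auto
      show "0\<^sub>v d \<in> ?im"
        using Y by (intro image_eqI[of _ _ "0\<^sub>v e"]) auto
      fix v assume "v \<in> ?im"
      then obtain v' where v': "v' \<in> carrier_vec e" "v = Y *\<^sub>v v'"
        by auto
      show "v + w \<in> ?im" if w: "w \<in> ?im" for w
      proof -
        obtain w' where w': "w' \<in> carrier_vec e" "w = Y *\<^sub>v w'"
          using w by auto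
        then show ?thesis
          using v' mult_add_distrib_mat_vec[OF Y v'(1) w'(1)]
          by (intro image_eqI[of _ _ "v' + w'"]) auto
      qed
      show "c \<cdot>\<^sub>v v \<in> ?im" for c
        using v' mult_mat_vec[OF Y v'(1), of c] by (intro image_eqI[of _ _ "c \<cdot>\<^sub>v v'"]) auto
    qed
    show "\<rho> g *\<^sub>v v \<in> ?im" if g: "g \<in> carrier G" and v: "v \<in> ?im" for g v
    proof -
      obtain v' where v': "v' \<in> carrier_vec e" "v = Y *\<^sub>v v'"
        using v by auto
      then show ?thesis
        using equivariant[OF g v'(1)] rep_\<sigma>(1)[OF g] by (intro image_eqI[of _ _ "\<sigma> g *\<^sub>v v'"]) auto
    qed
  qed
  moreover have "?im \<noteq> {0\<^sub>v d}"
    using zero_if nonzero unit_vec_carrier[of e] by blast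
  ultimately have im: "carrier_vec d \<subseteq> ?im"
    by blast
  define z where "z i = (SOME v. v \<in> carrier_vec e \<and> Y *\<^sub>v v = unit_vec d i)" for i
  have z: "z i \<in> carrier_vec e" "Y *\<^sub>v z i = unit_vec d i" for i
  proof -
    have "\<exists>v. v \<in> carrier_vec e \<and> Y *\<^sub>v v = unit_vec d i"
      using subsetD[OF im unit_vec_carrier[of d i]] by auto
    from someI_ex[OF this] show "z i \<in> carrier_vec e" "Y *\<^sub>v z i = unit_vec d i"
      by (simp_all add: z_def)
  qed
  define Z where "Z = mat e d (\<lambda>(a, i). z i $ a)"
  have Z: "Z \<in> carrier_mat e d"
    by (simp add: Z_def)
  have col_Z: "col Z i = z i" if "i < d" for i
    using z(1)[of i] that by (intro eq_vecI) (auto simp: Z_def)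
  have YZ: "Y * Z = 1\<^sub>m d"
  proof (rule mat_col_eqI)
    fix i assume "i < dim_col (1\<^sub>m d)"
    then show "col (Y * Z) i = col (1\<^sub>m d) i"
      using col_mult2[OF Y Z, of i] col_Z[of i] z(2)[of i] by simp
  qed (use Y Z in auto)
  have ZY: "Z * Y = 1\<^sub>m e"
  proof (rule mat_col_eqI)
    fix j assume "j < dim_col (1\<^sub>m e)"
    then have j: "j < e"
      by simp
    have c: "col (Z * Y) j \<in> carrier_vec e"
      using Z Y j by auto
    \<comment> \<open>\<open>Y\<close> sends column \<open>j\<close> of \<open>Z * Y\<close> and the
      unit vector to the same image, so injectivity identifies them.\<close>
    have "Y *\<^sub>v col (Z * Y) j = col (Y * (Z * Y)) j"
      using col_mult2[OF Y mult_carrier_mat[OF Z Y] j] by simp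
    also have "Y * (Z * Y) = (Y * Z) * Y"
      by (rule assoc_mult_mat[OF Y Z Y, symmetric])
    also have "\<dots> = Y"
      using YZ left_mult_one_mat[OF Y] by simp
    finally have "Y *\<^sub>v (col (Z * Y) j - unit_vec e j) = 0\<^sub>v d"
      using mult_minus_distrib_mat_vec[OF Y c unit_vec_carrier] Y_col[OF j] Y j by simp
    then have zero: "col (Z * Y) j - unit_vec e j = 0\<^sub>v e"
      using c by (intro ker) auto
    have "col (Z * Y) j = unit_vec e j"
    proof (rule eq_vecI)
      fix i assume "i < dim_vec (unit_vec e j)"
      then have i: "i < e"
        by simp
      have "(col (Z * Y) j - unit_vec e j) $ i = 0"
        using zero i by simp
      then show "col (Z * Y) j $ i = unit_vec e j $ i"
        using i by simp
    qed (use Z in simp)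
    then show "col (Z * Y) j = col (1\<^sub>m e) j"
      using j by simp
  qed (use Y Z in auto)
  have "(\<Sum>l<e. Y $$ (i, l) * Z $$ (l, j)) = of_bool (i = j)" if "i < d" "j < d" for i j
    using index_mult_mat_sum[OF Y Z that, symmetric] YZ that by simp
  then have "d \<le> e"
    by (rule left_inverse_dimension_le)
  moreover have "(\<Sum>l<d. Z $$ (i, l) * Y $$ (l, j)) = of_bool (i = j)" if "i < e" "j < e" for i j
    using index_mult_mat_sum[OF Z Y that, symmetric] ZY that by simp
  then have "e \<le> d"
    by (rule left_inverse_dimension_le)
  ultimately have "e = d"
    by simp
  then show ?thesis
    unfolding isomorphic_representations_iff
    using Y Z YZ ZY comm by (intro conjI ballI bexI[of _ Y] bexI[of _ Z]) auto
qed

text \<open>Averaging a matrix unit over the group gives an intertwiner.\<close>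

lemma coefficients_orthogonal:
  assumes "group G" and \<rho>: "irreducible_representation G d \<rho>" and \<sigma>: "irreducible_representation G e \<sigma>"
    and not_iso: "\<not> isomorphic_representations G (e, \<sigma>) (d, \<rho>)"
    and ij: "i < d" "j < d" and kl: "k < e" "l < e"
  shows "(\<Sum>g\<in>carrier G. \<rho> g $$ (i, j) * \<sigma> (inv\<^bsub>G\<^esub> g) $$ (k, l)) = 0"
proof -
  interpret group G by fact
  note rep_\<rho> = irreducible_representationD(1)[OF \<rho>] and rep_\<sigma> = irreducible_representationD(1)[OF \<sigma>]
  \<comment> \<open>With \<open>j\<close> and \<open>k\<close> fixed, these are the entries of the
    sum of rho(g) E sigma(g^-1) over the group, E being the matrix unit at
    \<open>(j, k)\<close>.\<close>
  define y where "y i l = (\<Sum>g\<in>carrier G. \<rho> g $$ (i, j) * \<sigma> (inv\<^bsub>G\<^esub> g) $$ (k, l))" for i l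
  define Y where "Y = mat d e (\<lambda>(i, l). y i l)"
  have Y: "Y \<in> carrier_mat d e"
    by (simp add: Y_def)
  have comm: "\<rho> h * Y = Y * \<sigma> h" if h: "h \<in> carrier G" for h
  proof (rule eq_matI)
    note \<rho>h = representationD(1)[OF assms(1) rep_\<rho> h] and \<sigma>h = representationD(1)[OF assms(1) rep_\<sigma> h]
    fix i l assume "i < dim_row (Y * \<sigma> h)" "l < dim_col (Y * \<sigma> h)"
    then have il: "i < d" "l < e"
      using Y \<sigma>h by auto
    have "(\<rho> h * Y) $$ (i, l) = (\<Sum>m<d. \<rho> h $$ (i, m) * y m l)"
      using index_mult_mat_sum[OF \<rho>h Y il] il by (simp add: Y_def)
    also have "\<dots> = (\<Sum>m<d. \<Sum>g\<in>carrier G. \<rho> h $$ (i, m) * \<rho> g $$ (m, j) * \<sigma> (inv\<^bsub>G\<^esub> g) $$ (k, l))"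
      unfolding y_def sum_distrib_left mult.assoc ..
    also have "\<dots> = (\<Sum>g\<in>carrier G. \<Sum>m<d. \<rho> h $$ (i, m) * \<rho> g $$ (m, j) * \<sigma> (inv\<^bsub>G\<^esub> g) $$ (k, l))"
      by (rule sum.swap)
    also have "\<dots> = (\<Sum>g\<in>carrier G. \<rho> (h \<otimes>\<^bsub>G\<^esub> g) $$ (i, j) * \<sigma> (inv\<^bsub>G\<^esub> (h \<otimes>\<^bsub>G\<^esub> g) \<otimes>\<^bsub>G\<^esub> h) $$ (k, l))"
    proof (rule sum.cong[OF refl])
      fix g assume g: "g \<in> carrier G"
      have "inv\<^bsub>G\<^esub> (h \<otimes>\<^bsub>G\<^esub> g) \<otimes>\<^bsub>G\<^esub> h = inv\<^bsub>G\<^esub> g"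
        using g h by (simp add: inv_mult_group m_assoc)
      then show "(\<Sum>m<d. \<rho> h $$ (i, m) * \<rho> g $$ (m, j) * \<sigma> (inv\<^bsub>G\<^esub> g) $$ (k, l)) =
          \<rho> (h \<otimes>\<^bsub>G\<^esub> g) $$ (i, j) * \<sigma> (inv\<^bsub>G\<^esub> (h \<otimes>\<^bsub>G\<^esub> g) \<otimes>\<^bsub>G\<^esub> h) $$ (k, l)"
        using representation_mult_index[OF assms(1) rep_\<rho> h g il(1) ij(2)] by (simp add: sum_distrib_right)
    qed
    also have "\<dots> = (\<Sum>g\<in>carrier G. \<rho> g $$ (i, j) * \<sigma> (inv\<^bsub>G\<^esub> g \<otimes>\<^bsub>G\<^esub> h) $$ (k, l))"
      by (rule sum_group_translate[OF assms(1) h,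
            of "\<lambda>g. \<rho> g $$ (i, j) * \<sigma> (inv\<^bsub>G\<^esub> g \<otimes>\<^bsub>G\<^esub> h) $$ (k, l)"])
    also have "\<dots> = (\<Sum>g\<in>carrier G. \<Sum>m<e. \<rho> g $$ (i, j) * \<sigma> (inv\<^bsub>G\<^esub> g) $$ (k, m) * \<sigma> h $$ (m, l))"
      using representation_mult_index[OF assms(1) rep_\<sigma> _ h kl(1) il(2)]
      by (intro sum.cong refl) (simp add: sum_distrib_left mult.assoc)
    also have "\<dots> = (\<Sum>m<e. \<Sum>g\<in>carrier G. \<rho> g $$ (i, j) * \<sigma> (inv\<^bsub>G\<^esub> g) $$ (k, m) * \<sigma> h $$ (m, l))"
      by (rule sum.swap)
    also have "\<dots> = (\<Sum>m<e. y i m * \<sigma> h $$ (m, l))"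
      unfolding y_def sum_distrib_right ..
    also have "\<dots> = (Y * \<sigma> h) $$ (i, l)"
      using index_mult_mat_sum[OF Y \<sigma>h il] il by (simp add: Y_def)
    finally show "(\<rho> h * Y) $$ (i, l) = (Y * \<sigma> h) $$ (i, l)" .
  qed (use Y representationD(1)[OF assms(1) rep_\<rho> h] representationD(1)[OF assms(1) rep_\<sigma> h] in auto)
  have "Y = 0\<^sub>m d e"
    using schur[OF assms(1) \<rho> \<sigma> Y comm] not_iso by blast
  then have "Y $$ (i, l) = 0"
    using ij kl by simp
  then show ?thesis
    using ij kl by (simp add: Y_def y_def)
qed

text \<open>A function in the span is built from finitely many irreducibles, so it is orthogonal to
  the coefficients of every irreducible outside their isomorphism classes. For the delta function
  this bounds the number of classes.\<close>

lemma matrix_coefficients_orthogonal: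
  assumes "group G" "f \<in> matrix_coefficients G"
  shows "\<exists>\<R>. finite \<R> \<and> \<R> \<subseteq> irreducibles G \<and>
    (\<forall>e \<sigma> k l. (e, \<sigma>) \<in> irreducibles G \<longrightarrow> (\<forall>R\<in>\<R>. \<not> isomorphic_representations G (e, \<sigma>) R) \<longrightarrow>
      k < e \<longrightarrow> l < e \<longrightarrow> (\<Sum>g\<in>carrier G. f g * \<sigma> (inv\<^bsub>G\<^esub> g) $$ (k, l)) = 0)"
    (is "\<exists>\<R>. ?P \<R> f")
  using assms(2)
proof (induction f rule: matrix_coefficients.induct)
  case (entry d \<rho> i j)
  have "?P {(d, \<rho>)} (\<lambda>g. \<rho> g $$ (i, j))"
    using coefficients_orthogonal[OF assms(1) entry(1) _ _ entry(2,3)] entry(1) by (simp add: irreducibles_def)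
  then show ?case
    by (rule exI)
next
  case zero
  have "?P {} (\<lambda>g. 0)"
    by simp
  then show ?case
    by (rule exI)
next
  case (add f f')
  obtain \<R> \<R>' where "?P \<R> f" "?P \<R>' f'"
    using add.IH by (elim exE)
  then have "?P (\<R> \<union> \<R>') (\<lambda>g. f g + f' g)"
    by (simp add: distrib_right sum.distrib)
  then show ?case
    by (rule exI)
next
  case (scale f c)
  obtain \<R> where "?P \<R> f"
    using scale.IH by (elim exE)
  then have "?P \<R> (\<lambda>g. c * f g)"
    by (simp add: mult.assoc flip: sum_distrib_left)
  then show ?case
    by (rule exI)
next
  case (restrict_cong f f')
  obtain \<R> where \<R>: "?P \<R> f"
    using restrict_cong.IH by (elim exE)
  have "(\<Sum>g\<in>carrier G. f' g * x g) = (\<Sum>g\<in>carrier G. f g * x g)" for x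
    using restrict_cong.hyps by simp
  with \<R> have "?P \<R> f'"
    by simp
  then show ?case
    by (rule exI)
qed

section \<open>Isomorphism classes of irreducible representations\<close>

abbreviation isomorphism_relation ::
  "('a, 'b) monoid_scheme \<Rightarrow> ((nat \<times> ('a \<Rightarrow> complex mat)) \<times> (nat \<times> ('a \<Rightarrow> complex mat))) set" where
  "isomorphism_relation G \<equiv>
     {(R, R'). R \<in> irreducibles G \<and> R' \<in> irreducibles G \<and> isomorphic_representations G R R'}"

lemma equiv_isomorphism_relation:
  assumes "group G"
  shows "equiv (irreducibles G) (isomorphism_relation G)"
proof -
  have carrier: "\<rho> g \<in> carrier_mat d d" if "(d, \<rho>) \<in> irreducibles G" "g \<in> carrier G" for d \<rho> g
    using that representationD(1)[OF assms irreducible_representationD(1)] by (auto simp: irreducibles_def)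
  have refl: "isomorphic_representations G (d, \<rho>) (d, \<rho>)" if "(d, \<rho>) \<in> irreducibles G" for d \<rho>
    unfolding isomorphic_representations_iff
  proof (intro conjI refl bexI[of _ "1\<^sub>m d"] ballI)
    show "1\<^sub>m d * \<rho> g = \<rho> g * 1\<^sub>m d" if "g \<in> carrier G" for g
      using left_mult_one_mat right_mult_one_mat carrier[OF \<open>(d, \<rho>) \<in> irreducibles G\<close> that] by metis
  qed simp_all
  have sym: "isomorphic_representations G (d', \<rho>') (d, \<rho>)"
    if mem: "(d, \<rho>) \<in> irreducibles G" "(d', \<rho>') \<in> irreducibles G"
      and iso: "isomorphic_representations G (d, \<rho>) (d', \<rho>')" for d d' \<rho> \<rho>'
  proof -
    have d': "d' = d"
      using iso by (simp add: isomorphic_representations_iff)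
    obtain P Q where P: "P \<in> carrier_mat d d" and Q: "Q \<in> carrier_mat d d" and PQ: "P * Q = 1\<^sub>m d"
      and QP: "Q * P = 1\<^sub>m d" and comm: "\<And>g. g \<in> carrier G \<Longrightarrow> P * \<rho> g = \<rho>' g * P"
      using iso unfolding isomorphic_representations_iff by blast
    have "Q * \<rho>' g = \<rho> g * Q" if g: "g \<in> carrier G" for g
    proof -
      note \<rho> = carrier[OF mem(1) g] and \<rho>' = carrier[OF mem(2) g, unfolded d']
      have "Q * \<rho>' g = Q * (\<rho>' g * (P * Q))"
        using PQ right_mult_one_mat[OF \<rho>'] by simp
      also have "\<dots> = Q * ((P * \<rho> g) * Q)"
        using assoc_mult_mat[OF \<rho>' P Q] comm[OF g] by simp
      also have "\<dots> = Q * (P * (\<rho> g * Q))"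
        using assoc_mult_mat[OF P \<rho> Q] by simp
      also have "\<dots> = (Q * P) * (\<rho> g * Q)"
        by (rule assoc_mult_mat[OF Q P mult_carrier_mat[OF \<rho> Q], symmetric])
      also have "\<dots> = \<rho> g * Q"
        using QP left_mult_one_mat[OF mult_carrier_mat[OF \<rho> Q]] by simp
      finally show ?thesis .
    qed
    then show ?thesis
      unfolding isomorphic_representations_iff d' using P Q PQ QP by blast
  qed
  have trans: "isomorphic_representations G (d, \<rho>) (d'', \<rho>'')"
    if mem: "(d, \<rho>) \<in> irreducibles G" "(d', \<rho>') \<in> irreducibles G" "(d'', \<rho>'') \<in> irreducibles G"
      and iso: "isomorphic_representations G (d, \<rho>) (d', \<rho>')" "isomorphic_representations G (d', \<rho>') (d'', \<rho>'')"
    for d d' d'' \<rho> \<rho>' \<rho>''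
  proof -
    have d: "d' = d" "d'' = d"
      using iso by (simp_all add: isomorphic_representations_iff)
    obtain P Q where P: "P \<in> carrier_mat d d" and Q: "Q \<in> carrier_mat d d" and PQ: "P * Q = 1\<^sub>m d"
      and QP: "Q * P = 1\<^sub>m d" and comm: "\<And>g. g \<in> carrier G \<Longrightarrow> P * \<rho> g = \<rho>' g * P"
      using iso(1) unfolding isomorphic_representations_iff by blast
    obtain P' Q' where P': "P' \<in> carrier_mat d d" and Q': "Q' \<in> carrier_mat d d" and PQ': "P' * Q' = 1\<^sub>m d"
      and comm': "\<And>g. g \<in> carrier G \<Longrightarrow> P' * \<rho>' g = \<rho>'' g * P'"
      using iso(2) unfolding isomorphic_representations_iff d by blast
    have inv: "(P' * P) * (Q * Q') = 1\<^sub>m d"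
    proof -
      have "(P' * P) * (Q * Q') = P' * (P * (Q * Q'))"
        by (rule assoc_mult_mat[OF P' P mult_carrier_mat[OF Q Q']])
      also have "P * (Q * Q') = (P * Q) * Q'"
        by (rule assoc_mult_mat[OF P Q Q', symmetric])
      finally show ?thesis
        using PQ PQ' left_mult_one_mat[OF Q'] by simp
    qed
    have "(P' * P) * \<rho> g = \<rho>'' g * (P' * P)" if g: "g \<in> carrier G" for g
    proof -
      note \<rho> = carrier[OF mem(1) g] and \<rho>' = carrier[OF mem(2) g, unfolded d]
        and \<rho>'' = carrier[OF mem(3) g, unfolded d]
      have "(P' * P) * \<rho> g = P' * (\<rho>' g * P)"
        using assoc_mult_mat[OF P' P \<rho>] comm[OF g] by simp
      also have "\<dots> = (\<rho>'' g * P') * P"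
        using assoc_mult_mat[OF P' \<rho>' P] comm'[OF g] by simp
      also have "\<dots> = \<rho>'' g * (P' * P)"
        by (rule assoc_mult_mat[OF \<rho>'' P' P])
      finally show ?thesis .
    qed
    then show ?thesis
      unfolding isomorphic_representations_iff d
      using inv mult_carrier_mat[OF P' P] mult_carrier_mat[OF Q Q']
        mat_mult_left_right_inverse[OF mult_carrier_mat[OF P' P] mult_carrier_mat[OF Q Q'] inv] by blast
  qed
  show ?thesis
  proof (rule equivI)
    show "isomorphism_relation G \<subseteq> irreducibles G \<times> irreducibles G"
      by blast
    show "refl_on (irreducibles G) (isomorphism_relation G)"
      using refl by (auto simp: refl_on_def)
    show "Relation.sym (isomorphism_relation G)"
    proof (rule symI)
      fix x y assume xy: "(x, y) \<in> isomorphism_relation G"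
      then show "(y, x) \<in> isomorphism_relation G"
        using sym[of "fst x" "snd x" "fst y" "snd y"] by simp
    qed
    show "Relation.trans (isomorphism_relation G)"
    proof (rule transI)
      fix x y z assume "(x, y) \<in> isomorphism_relation G" "(y, z) \<in> isomorphism_relation G"
      then show "(x, z) \<in> isomorphism_relation G"
        using trans[of "fst x" "snd x" "fst y" "snd y" "fst z" "snd z"] by simp
    qed
  qed
qed

lemma irreducible_classes_eq: "irreducible_classes G = irreducibles G // isomorphism_relation G"
  by (simp add: irreducible_classes_def)

text \<open>Pairing the delta function with the entry \<open>(0, 0)\<close> of any irreducible gives
  1, so no irreducible is orthogonal to it. Hence each is isomorphic to one of the finitely many
  that build the delta function.\<close>

lemma finite_irreducible_classes:
  assumes "group G" "finite (carrier G)"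
  shows "finite (irreducible_classes G)"
proof -
  interpret group G by fact
  obtain \<R> where \<R>: "finite \<R>" "\<R> \<subseteq> irreducibles G"
    and orth: "\<forall>e \<sigma> k l. (e, \<sigma>) \<in> irreducibles G \<longrightarrow> (\<forall>R\<in>\<R>. \<not> isomorphic_representations G (e, \<sigma>) R) \<longrightarrow>
      k < e \<longrightarrow> l < e \<longrightarrow> (\<Sum>g\<in>carrier G. of_bool (g = \<one>\<^bsub>G\<^esub>) * \<sigma> (inv\<^bsub>G\<^esub> g) $$ (k, l)) = 0"
    using matrix_coefficients_orthogonal[OF assms(1) delta_coefficient[OF assms]] by (elim exE conjE)
  have "\<exists>R\<in>\<R>. isomorphic_representations G (e, \<sigma>) R" if mem: "(e, \<sigma>) \<in> irreducibles G" for e \<sigma>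
  proof (rule ccontr)
    assume "\<not> (\<exists>R\<in>\<R>. isomorphic_representations G (e, \<sigma>) R)"
    have \<sigma>: "irreducible_representation G e \<sigma>"
      using mem by (simp add: irreducibles_def)
    then have e: "0 < e"
      using irreducible_representationD(2) by blast
    then have "(\<Sum>g\<in>carrier G. of_bool (g = \<one>\<^bsub>G\<^esub>) * \<sigma> (inv\<^bsub>G\<^esub> g) $$ (0, 0)) = 0"
      using orth mem \<open>\<not> (\<exists>R\<in>\<R>. isomorphic_representations G (e, \<sigma>) R)\<close> by blast
    moreover have "(\<Sum>g\<in>carrier G. of_bool (g = \<one>\<^bsub>G\<^esub>) * \<sigma> (inv\<^bsub>G\<^esub> g) $$ (0, 0)) =
        (\<Sum>g\<in>carrier G. if g = \<one>\<^bsub>G\<^esub> then 1 else 0)"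
      using representationD(3)[OF assms(1) irreducible_representationD(1)[OF \<sigma>]] e
      by (intro sum.cong refl) simp
    ultimately show False
      using assms(2) by simp
  qed
  then have "irreducible_classes G \<subseteq> (\<lambda>R. isomorphism_relation G `` {R}) ` \<R>"
    unfolding irreducible_classes_eq
  proof (intro subsetI, elim quotientE)
    fix X R
    assume iso: "\<And>e \<sigma>. (e, \<sigma>) \<in> irreducibles G \<Longrightarrow> \<exists>R\<in>\<R>. isomorphic_representations G (e, \<sigma>) R"
      and R: "R \<in> irreducibles G" and X: "X = isomorphism_relation G `` {R}"
    obtain R' where R': "R' \<in> \<R>" "isomorphic_representations G R R'"
      using iso[of "fst R" "snd R"] R by auto
    then have "(R, R') \<in> isomorphism_relation G"
      using R \<R>(2) by blast
    then have "X = isomorphism_relation G `` {R'}"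
      unfolding X by (rule equiv_class_eq[OF equiv_isomorphism_relation[OF assms(1)]])
    then show "X \<in> (\<lambda>R. isomorphism_relation G `` {R}) ` \<R>"
      using R'(1) by blast
  qed
  then show ?thesis
    using \<R>(1) finite_surj by blast
qed

section \<open>Class representatives and the expansion of the delta function\<close>

definition class_dim :: "(nat \<times> ('a \<Rightarrow> complex mat)) set \<Rightarrow> nat" where
  "class_dim X = the_elem (fst ` X)"

definition class_rep :: "('a, 'b) monoid_scheme \<Rightarrow> (nat \<times> ('a \<Rightarrow> complex mat)) set \<Rightarrow> 'a \<Rightarrow> complex mat" where
  "class_rep G X = snd (SOME R. R \<in> irreducibles G \<and> X = isomorphism_relation G `` {R})"

lemma class_rep:
  assumes "group G" "X \<in> irreducible_classes G"
  shows "(class_dim X, class_rep G X) \<in> irreducibles G"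
    and "X = isomorphism_relation G `` {(class_dim X, class_rep G X)}"
proof -
  define R where "R = (SOME R. R \<in> irreducibles G \<and> X = isomorphism_relation G `` {R})"
  have "\<exists>R. R \<in> irreducibles G \<and> X = isomorphism_relation G `` {R}"
    using assms(2) unfolding irreducible_classes_eq by (auto elim!: quotientE)
  then have *: "R \<in> irreducibles G \<and> X = isomorphism_relation G `` {R}"
    unfolding R_def by (rule someI_ex)
  note R = conjunct1[OF *] conjunct2[OF *]
  have RX: "R \<in> X"
    by (subst R(2)) (rule equiv_class_self[OF equiv_isomorphism_relation[OF assms(1)] R(1)])
  have fst_eq: "fst R' = fst R" if "R' \<in> X" for R'
  proof -
    have "(R, R') \<in> isomorphism_relation G"
      using that by (subst (asm) R(2)) simp
    then show ?thesis
      by (simp add: isomorphic_representations_def)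
  qed
  have "fst ` X = {fst R}"
  proof (intro equalityI subsetI)
    fix x assume "x \<in> fst ` X"
    then obtain R' where "R' \<in> X" "x = fst R'"
      by (elim imageE)
    then show "x \<in> {fst R}"
      using fst_eq[of R'] by simp
  next
    fix x assume "x \<in> {fst R}"
    then show "x \<in> fst ` X"
      using RX by (intro image_eqI[of _ _ R]) simp_all
  qed
  then have eq: "(class_dim X, class_rep G X) = R"
    unfolding class_dim_def class_rep_def R_def[symmetric] by simp
  show "(class_dim X, class_rep G X) \<in> irreducibles G"
    "X = isomorphism_relation G `` {(class_dim X, class_rep G X)}"
    unfolding eq by (fact R)+
qed

lemma class_dim_pos:
  assumes "group G" "X \<in> irreducible_classes G"
  shows "class_dim X \<ge> 1"
proof -
  have "irreducible_representation G (class_dim X) (class_rep G X)"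
    using class_rep(1)[OF assms] by (simp add: irreducibles_def)
  from irreducible_representationD(2)[OF this] show ?thesis
    by simp
qed

text \<open>Isomorphic representations are conjugate by a fixed matrix, so an entry of one is a
  fixed linear combination of the entries of the other.\<close>

lemma irreducible_coefficient_in_class:
  assumes "group G" and \<rho>: "irreducible_representation G d \<rho>" and ij: "i < d" "j < d"
  shows "\<exists>X\<in>irreducible_classes G. \<exists>N. \<forall>g\<in>carrier G.
    \<rho> g $$ (i, j) = (\<Sum>p<class_dim X. \<Sum>q<class_dim X. N p q * class_rep G X g $$ (p, q))"
proof -
  have mem: "(d, \<rho>) \<in> irreducibles G"
    using \<rho> by (simp add: irreducibles_def)
  define X where "X = isomorphism_relation G `` {(d, \<rho>)}"
  have X: "X \<in> irreducible_classes G"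
    unfolding X_def irreducible_classes_eq by (rule quotientI[OF mem])
  define \<tau> where "\<tau> = class_rep G X"
  have "(d, \<rho>) \<in> X"
    unfolding X_def by (rule equiv_class_self[OF equiv_isomorphism_relation[OF assms(1)] mem])
  then have "(d, \<rho>) \<in> isomorphism_relation G `` {(class_dim X, \<tau>)}"
    unfolding \<tau>_def by (rule subst[OF class_rep(2)[OF assms(1) X], where P = "\<lambda>Y. (d, \<rho>) \<in> Y"])
  then have "((class_dim X, \<tau>), (d, \<rho>)) \<in> isomorphism_relation G"
    by (simp only: Image_singleton_iff)
  then have iso: "isomorphic_representations G (class_dim X, \<tau>) (d, \<rho>)"
    and \<tau>_irr: "irreducible_representation G (class_dim X) \<tau>"
    by (simp_all add: irreducibles_def)
  have dim: "class_dim X = d"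
    using iso by (simp add: isomorphic_representations_iff)
  obtain P Q where P: "P \<in> carrier_mat d d" and Q: "Q \<in> carrier_mat d d" and PQ: "P * Q = 1\<^sub>m d"
    and comm: "\<forall>g\<in>carrier G. P * \<tau> g = \<rho> g * P"
    using iso unfolding isomorphic_representations_iff dim by (elim conjE bexE)
  have "\<rho> g $$ (i, j) = (\<Sum>p<d. \<Sum>q<d. (P $$ (i, p) * Q $$ (q, j)) * \<tau> g $$ (p, q))"
    if g: "g \<in> carrier G" for g
  proof -
    have \<rho>g: "\<rho> g \<in> carrier_mat d d"
      by (rule representationD(1)[OF assms(1) irreducible_representationD(1)[OF \<rho>] g])
    have \<tau>g: "\<tau> g \<in> carrier_mat d d"
      using representationD(1)[OF assms(1) irreducible_representationD(1)[OF \<tau>_irr] g] dim by simp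
    have "(P * \<tau> g) * Q = \<rho> g * (P * Q)"
      using comm g assoc_mult_mat[OF \<rho>g P Q] by simp
    then have "\<rho> g = (P * \<tau> g) * Q"
      using PQ right_mult_one_mat[OF \<rho>g] by simp
    then have "\<rho> g $$ (i, j) = (\<Sum>q<d. (P * \<tau> g) $$ (i, q) * Q $$ (q, j))"
      using index_mult_mat_sum[OF mult_carrier_mat[OF P \<tau>g] Q ij] by simp
    also have "\<dots> = (\<Sum>q<d. \<Sum>p<d. (P $$ (i, p) * Q $$ (q, j)) * \<tau> g $$ (p, q))"
      using index_mult_mat_sum[OF P \<tau>g ij(1)]
      by (intro sum.cong refl) (simp add: sum_distrib_left sum_distrib_right mult_ac)
    also have "\<dots> = (\<Sum>p<d. \<Sum>q<d. (P $$ (i, p) * Q $$ (q, j)) * \<tau> g $$ (p, q))"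
      by (rule sum.swap)
    finally show ?thesis .
  qed
  then show ?thesis
    using X dim \<tau>_def by (intro bexI[of _ X] exI[of _ "\<lambda>p q. P $$ (i, p) * Q $$ (q, j)"]) simp_all
qed

lemma matrix_coefficients_decomposition:
  assumes "group G" "finite (carrier G)" "f \<in> matrix_coefficients G"
  shows "\<exists>N. \<forall>g\<in>carrier G. f g =
    (\<Sum>X\<in>irreducible_classes G. \<Sum>p<class_dim X. \<Sum>q<class_dim X. N X p q * class_rep G X g $$ (p, q))"
    (is "\<exists>N. \<forall>g\<in>_. f g = ?S N g")
  using assms(3)
proof (induction f rule: matrix_coefficients.induct)
  case (entry d \<rho> i j)
  obtain X N where X: "X \<in> irreducible_classes G" and N: "\<forall>g\<in>carrier G. \<rho> g $$ (i, j) =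
      (\<Sum>p<class_dim X. \<Sum>q<class_dim X. N p q * class_rep G X g $$ (p, q))"
    using irreducible_coefficient_in_class[OF assms(1) entry] by (elim bexE exE)
  have "?S (\<lambda>Y p q. if Y = X then N p q else 0) g =
      (\<Sum>p<class_dim X. \<Sum>q<class_dim X. N p q * class_rep G X g $$ (p, q))" for g
  proof -
    have "?S (\<lambda>Y p q. if Y = X then N p q else 0) g =
        (\<Sum>Y\<in>irreducible_classes G. if Y = X then
           (\<Sum>p<class_dim X. \<Sum>q<class_dim X. N p q * class_rep G X g $$ (p, q)) else 0)"
      by (intro sum.cong refl) auto
    also have "\<dots> = (\<Sum>p<class_dim X. \<Sum>q<class_dim X. N p q * class_rep G X g $$ (p, q))"
      using X finite_irreducible_classes[OF assms(1,2)] by simp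
    finally show ?thesis .
  qed
  then have "\<forall>g\<in>carrier G. \<rho> g $$ (i, j) = ?S (\<lambda>Y p q. if Y = X then N p q else 0) g"
    using N by simp
  then show ?case
    by (rule exI[of _ "\<lambda>Y p q. if Y = X then N p q else 0"])
next
  case zero
  have "\<forall>g\<in>carrier G. 0 = ?S (\<lambda>_ _ _. 0) g"
    by simp
  then show ?case
    by (rule exI[of _ "\<lambda>_ _ _. 0"])
next
  case (add f f')
  obtain N N' where "\<forall>g\<in>carrier G. f g = ?S N g" "\<forall>g\<in>carrier G. f' g = ?S N' g"
    using add.IH by (elim exE)
  then have "\<forall>g\<in>carrier G. f g + f' g = ?S (\<lambda>X p q. N X p q + N' X p q) g"
    by (simp add: distrib_right sum.distrib)
  then show ?case
    by (rule exI[of _ "\<lambda>X p q. N X p q + N' X p q"])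
next
  case (scale f c)
  obtain N where "\<forall>g\<in>carrier G. f g = ?S N g"
    using scale.IH by (elim exE)
  then have "\<forall>g\<in>carrier G. c * f g = ?S (\<lambda>X p q. c * N X p q) g"
    by (simp add: sum_distrib_left mult.assoc)
  then show ?case
    by (rule exI[of _ "\<lambda>X p q. c * N X p q"])
next
  case (restrict_cong f f')
  obtain N where "\<forall>g\<in>carrier G. f g = ?S N g"
    using restrict_cong.IH by (elim exE)
  then have "\<forall>g\<in>carrier G. f' g = ?S N g"
    using restrict_cong.hyps by simp
  then show ?case
    by (rule exI[of _ "N"])
qed

text \<open>The coordinate form of the Wedderburn decomposition of the group algebra.\<close>

theorem group_tensor_decomposition:
  assumes "group G" "finite (carrier G)"
  shows "\<exists>\<alpha> \<beta> \<gamma>. \<forall>x\<in>carrier G. \<forall>y\<in>carrier G. \<forall>z\<in>carrier G.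
    of_bool (x \<otimes>\<^bsub>G\<^esub> y \<otimes>\<^bsub>G\<^esub> z = \<one>\<^bsub>G\<^esub>) =
      (\<Sum>X\<in>irreducible_classes G. \<Sum>p<class_dim X. \<Sum>q<class_dim X. \<Sum>r<class_dim X.
         \<alpha> X p q x * \<beta> X q r y * (\<gamma> X r p z :: complex))"
proof -
  interpret group G by fact
  obtain N where N: "\<forall>g\<in>carrier G. (of_bool (g = \<one>\<^bsub>G\<^esub>) :: complex) =
      (\<Sum>X\<in>irreducible_classes G. \<Sum>p<class_dim X. \<Sum>q<class_dim X. N X p q * class_rep G X g $$ (p, q))"
    using matrix_coefficients_decomposition[OF assms delta_coefficient[OF assms]] by (elim exE)
  let ?\<rho> = "class_rep G"
  \<comment> \<open>Expanding entry \<open>(p, s)\<close> of rho(x) rho(y) rho(z) creates the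
    indices q and r. Merging the weights \<open>N\<close> and the sum over \<open>s\<close> into the
    factor of z closes the triangle p, q, r of a matrix multiplication tensor.\<close>
  define \<gamma> where "\<gamma> X r p z = (\<Sum>s<class_dim X. N X p s * ?\<rho> X z $$ (r, s))" for X r p z
  have main: "of_bool (x \<otimes>\<^bsub>G\<^esub> y \<otimes>\<^bsub>G\<^esub> z = \<one>\<^bsub>G\<^esub>) =
      (\<Sum>X\<in>irreducible_classes G. \<Sum>p<class_dim X. \<Sum>q<class_dim X. \<Sum>r<class_dim X.
         ?\<rho> X x $$ (p, q) * ?\<rho> X y $$ (q, r) * \<gamma> X r p z)"
    if xyz: "x \<in> carrier G" "y \<in> carrier G" "z \<in> carrier G" for x y z
  proof -
    have "of_bool (x \<otimes>\<^bsub>G\<^esub> y \<otimes>\<^bsub>G\<^esub> z = \<one>\<^bsub>G\<^esub>) =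
        (\<Sum>X\<in>irreducible_classes G. \<Sum>p<class_dim X. \<Sum>s<class_dim X.
           N X p s * ?\<rho> X (x \<otimes>\<^bsub>G\<^esub> y \<otimes>\<^bsub>G\<^esub> z) $$ (p, s))"
      using N xyz by blast
    also have "\<dots> = (\<Sum>X\<in>irreducible_classes G. \<Sum>p<class_dim X. \<Sum>q<class_dim X. \<Sum>r<class_dim X.
         ?\<rho> X x $$ (p, q) * ?\<rho> X y $$ (q, r) * \<gamma> X r p z)"
    proof (rule sum.cong[OF refl], rule sum.cong[OF refl])
      fix X p assume X: "X \<in> irreducible_classes G" and "p \<in> {..<class_dim X}"
      then have p: "p < class_dim X"
        by simp
      have rep: "representation G (class_dim X) (?\<rho> X)"
        using class_rep(1)[OF assms(1) X] irreducible_representationD(1) by (auto simp: irreducibles_def)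
      have "(\<Sum>s<class_dim X. N X p s * ?\<rho> X (x \<otimes>\<^bsub>G\<^esub> y \<otimes>\<^bsub>G\<^esub> z) $$ (p, s)) =
          (\<Sum>s<class_dim X. \<Sum>r<class_dim X. \<Sum>q<class_dim X.
             ?\<rho> X x $$ (p, q) * ?\<rho> X y $$ (q, r) * (N X p s * ?\<rho> X z $$ (r, s)))"
      proof (intro sum.cong refl)
        fix s assume "s \<in> {..<class_dim X}"
        then have s: "s < class_dim X"
          by simp
        have "N X p s * ?\<rho> X (x \<otimes>\<^bsub>G\<^esub> y \<otimes>\<^bsub>G\<^esub> z) $$ (p, s) =
            N X p s * (\<Sum>r<class_dim X. (\<Sum>q<class_dim X. ?\<rho> X x $$ (p, q) * ?\<rho> X y $$ (q, r)) * ?\<rho> X z $$ (r, s))"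
          using representation_mult_index[OF assms(1) rep m_closed[OF xyz(1,2)] xyz(3) p s]
            representation_mult_index[OF assms(1) rep xyz(1,2) p] by simp
        also have "\<dots> = (\<Sum>r<class_dim X. \<Sum>q<class_dim X.
             ?\<rho> X x $$ (p, q) * ?\<rho> X y $$ (q, r) * (N X p s * ?\<rho> X z $$ (r, s)))"
          unfolding sum_distrib_left sum_distrib_right by (intro sum.cong refl) (simp add: mult_ac)
        finally show "N X p s * ?\<rho> X (x \<otimes>\<^bsub>G\<^esub> y \<otimes>\<^bsub>G\<^esub> z) $$ (p, s) = (\<Sum>r<class_dim X. \<Sum>q<class_dim X.
             ?\<rho> X x $$ (p, q) * ?\<rho> X y $$ (q, r) * (N X p s * ?\<rho> X z $$ (r, s)))" .
      qed
      also have "\<dots> = (\<Sum>r<class_dim X. \<Sum>s<class_dim X. \<Sum>q<class_dim X.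
             ?\<rho> X x $$ (p, q) * ?\<rho> X y $$ (q, r) * (N X p s * ?\<rho> X z $$ (r, s)))"
        by (rule sum.swap)
      also have "\<dots> = (\<Sum>r<class_dim X. \<Sum>q<class_dim X. \<Sum>s<class_dim X.
             ?\<rho> X x $$ (p, q) * ?\<rho> X y $$ (q, r) * (N X p s * ?\<rho> X z $$ (r, s)))"
        by (intro sum.cong refl sum.swap)
      also have "\<dots> = (\<Sum>q<class_dim X. \<Sum>r<class_dim X. \<Sum>s<class_dim X.
             ?\<rho> X x $$ (p, q) * ?\<rho> X y $$ (q, r) * (N X p s * ?\<rho> X z $$ (r, s)))"
        by (rule sum.swap)
      finally show "(\<Sum>s<class_dim X. N X p s * ?\<rho> X (x \<otimes>\<^bsub>G\<^esub> y \<otimes>\<^bsub>G\<^esub> z) $$ (p, s)) =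
          (\<Sum>q<class_dim X. \<Sum>r<class_dim X. ?\<rho> X x $$ (p, q) * ?\<rho> X y $$ (q, r) * \<gamma> X r p z)"
        by (simp only: \<gamma>_def sum_distrib_left)
    qed
    finally show ?thesis .
  qed
  show ?thesis
    by (rule exI[of _ "\<lambda>X p q x. ?\<rho> X x $$ (p, q)"], rule exI[of _ "\<lambda>X p q x. ?\<rho> X x $$ (p, q)"],
        rule exI[of _ \<gamma>], intro ballI, rule main)
qed

lemma sum_character_degrees:
  "(\<Sum>d\<in>#character_degrees G. f d) = (\<Sum>X\<in>irreducible_classes G. f (class_dim X))"
  by (simp add: character_degrees_def class_dim_def sum_unfold_sum_mset multiset.map_comp comp_def)

section \<open>Direct sums of matrix multiplications\<close>

definition mm_sum :: "'l \<times> ('i \<times> 'j) \<Rightarrow> 'l \<times> ('j \<times> 'k) \<Rightarrow> 'l \<times> ('k \<times> 'i) \<Rightarrow> complex" where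
  "mm_sum x y z = of_bool (fst x = fst y \<and> fst y = fst z) * mm (snd x) (snd y) (snd z)"

definition mm_sum_rank_le :: "nat \<Rightarrow> 'l set \<Rightarrow> nat \<Rightarrow> bool" where
  "mm_sum_rank_le g \<Lambda> q \<longleftrightarrow>
     (let X = \<Lambda> \<times> ({..<q} \<times> {..<q}) in rank_le g X X X mm_sum)"

text \<open>
  Schoenhage's argument: the outer products of an optimal \<open>D \<times> D\<close> algorithm are performed
  in batches, one summand of the direct sum for each product of a batch.
\<close>

lemma mmrank_le_batches:
  assumes "finite \<Lambda>" "card \<Lambda> = L" "L > 0"
    and rank: "mm_sum_rank_le g \<Lambda> q"
  shows "mmrank (D * q) \<le> (mmrank D div L + 1) * g"
proof -
  define R where "R = mmrank D"
  obtain u v w where uvw: "\<And>x y z. x \<in> {..<D} \<times> {..<D} \<Longrightarrow> y \<in> {..<D} \<times> {..<D} \<Longrightarrow> z \<in> {..<D} \<times> {..<D} \<Longrightarrow>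
      mm x y z = (\<Sum>l<R. u l x * v l y * w l z)"
    using mm_rank_le_mmrank[of "{..<D}" D] unfolding mm_rank_le_def rank_le_def R_def by auto
  obtain h where h: "bij_betw h {..<L} \<Lambda>"
    using ex_bij_betw_nat_finite[OF assms(1)] assms(2) by (auto simp: atLeast0LessThan)
  have h_mem: "h (l mod L) \<in> \<Lambda>" for l
    using h assms(3) by (auto simp: bij_betw_def)
  have h_eq: "h (l mod L) = h (m mod L) \<longleftrightarrow> l mod L = m mod L" for l m
    using h assms(3) by (auto simp: bij_betw_def inj_on_def)
  let ?S = "{..<D} \<times> {..<q}"
  \<comment> \<open>\<open>l div L\<close> numbers the batch and \<open>l mod L\<close> the summand
    of the direct sum that performs product \<open>l\<close>; within a batch the latter determines
    \<open>l\<close>.\<close>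
  define batch where "batch b = {l\<in>{..<R}. l div L = b}" for b
  have batch_eq: "h (l mod L) = h (m mod L) \<longleftrightarrow> l = m" if "l \<in> batch b" "m \<in> batch b" for b l m
  proof -
    have "l = b * L + l mod L" "m = b * L + m mod L"
      using that div_mult_mod_eq[of l L] div_mult_mod_eq[of m L] by (simp_all add: batch_def)
    then show ?thesis
      unfolding h_eq by metis
  qed
  define t where "t b x y z = (\<Sum>l\<in>batch b. u l (fst_part x) * v l (fst_part y) * w l (fst_part z) *
      mm (snd_part x) (snd_part y) (snd_part z))"
    for b :: nat and x y z :: "(nat \<times> nat) \<times> (nat \<times> nat)"
  have "rank_le g (?S \<times> ?S) (?S \<times> ?S) (?S \<times> ?S) (t b)" for b
  proof (rule rank_le_restrict[OF rank[unfolded mm_sum_rank_le_def Let_def], where A = "batch b" and B = "batch b" and C = "batch b"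
        and \<alpha> = "\<lambda>l x. u l (fst_part x)" and \<beta> = "\<lambda>l x. v l (fst_part x)" and \<gamma> = "\<lambda>l x. w l (fst_part x)"
        and f = "\<lambda>l x. (h (l mod L), snd_part x)" and g = "\<lambda>l x. (h (l mod L), snd_part x)"
        and h = "\<lambda>l x. (h (l mod L), snd_part x)"])
    fix x y z :: "(nat \<times> nat) \<times> (nat \<times> nat)"
    have fin: "finite (batch b)"
      by (simp add: batch_def)
    \<comment> \<open>Cross terms address different summands, where \<open>mm_sum\<close> vanishes;
      the substitution leaves exactly the products of the batch.\<close>
    have "(\<Sum>l\<in>batch b. \<Sum>m\<in>batch b. \<Sum>n\<in>batch b. u l (fst_part x) * v m (fst_part y) * w n (fst_part z) *
          mm_sum (h (l mod L), snd_part x) (h (m mod L), snd_part y) (h (n mod L), snd_part z)) =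
        (\<Sum>l\<in>batch b. \<Sum>m\<in>batch b. if l = m then \<Sum>n\<in>batch b. if m = n then
          u l (fst_part x) * v m (fst_part y) * w n (fst_part z) * mm (snd_part x) (snd_part y) (snd_part z)
          else 0 else 0)"
      by (intro sum.cong refl) (auto simp: mm_sum_def batch_eq intro!: sum.cong sum.neutral)
    also have "\<dots> = t b x y z"
      using fin by (simp add: t_def)
    finally show "t b x y z = (\<Sum>l\<in>batch b. \<Sum>m\<in>batch b. \<Sum>n\<in>batch b. u l (fst_part x) * v m (fst_part y) * w n (fst_part z) *
          mm_sum (h (l mod L), snd_part x) (h (m mod L), snd_part y) (h (n mod L), snd_part z))"
      by (rule sym)
  qed (use h_mem in auto)
  \<comment> \<open>The batch numbers of all \<open>l < R\<close> lie below
    \<open>R div L + 1\<close>; when \<open>L\<close> divides \<open>R\<close> the last batch is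
    empty.\<close>
  then have "rank_le (\<Sum>b<R div L + 1. g) (?S \<times> ?S) (?S \<times> ?S) (?S \<times> ?S) (\<lambda>x y z. \<Sum>b<R div L + 1. t b x y z)"
    by (intro rank_le_sum) auto
  then have t_rank: "rank_le ((R div L + 1) * g) (?S \<times> ?S) (?S \<times> ?S) (?S \<times> ?S) (\<lambda>x y z. \<Sum>b<R div L + 1. t b x y z)"
    by (simp only: sum_constant card_lessThan of_nat_id)
  have t_sum: "(\<Sum>b<R div L + 1. t b x y z) = mm x y z" if "x \<in> ?S \<times> ?S" "y \<in> ?S \<times> ?S" "z \<in> ?S \<times> ?S" for x y z
  proof -
    have "(\<Sum>b<R div L + 1. t b x y z) = (\<Sum>l<R. u l (fst_part x) * v l (fst_part y) * w l (fst_part z) *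
      mm (snd_part x) (snd_part y) (snd_part z))"
      unfolding t_def batch_def
      by (rule sum.group) (auto simp: less_Suc_eq_le intro!: div_le_mono)
    also have "\<dots> = mm (fst_part x) (fst_part y) (fst_part z) * mm (snd_part x) (snd_part y) (snd_part z)"
      using uvw[of "fst_part x" "fst_part y" "fst_part z"] that by (auto simp: sum_distrib_right)
    also have "\<dots> = mm x y z"
      by (rule mm_times[symmetric])
    finally show ?thesis .
  qed
  have "mm_rank_le ((R div L + 1) * g) ?S"
    unfolding mm_rank_le_def
    by (rule rank_le_pullback[OF t_rank, where f = id and g = id and h = id])
       (simp_all only: id_apply image_id order_refl t_sum)
  then show ?thesis
    unfolding R_def by (rule mmrank_le) auto
qed

lemma sum_mm_triangle:
  assumes "finite S"
  shows "(\<Sum>x\<in>S \<times> S. \<Sum>y\<in>S \<times> S. \<Sum>z\<in>S \<times> S. a x * b y * c z * mm x y z) =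
    (\<Sum>i\<in>S. \<Sum>j\<in>S. \<Sum>k\<in>S. a (i, j) * b (j, k) * c (k, i))"
proof -
  let ?h = "\<lambda>(i, j, k). ((i, j), (j, k), (k, i))" and ?T = "(S \<times> S) \<times> (S \<times> S) \<times> (S \<times> S)"
  have "(\<Sum>x\<in>S \<times> S. \<Sum>y\<in>S \<times> S. \<Sum>z\<in>S \<times> S. a x * b y * c z * mm x y z) =
      (\<Sum>(x, y, z)\<in>?T. a x * b y * c z * mm x y z)"
    by (simp only: sum.cartesian_product split_def)
  also have "\<dots> = (\<Sum>(x, y, z)\<in>?h ` (S \<times> S \<times> S). a x * b y * c z * mm x y z)"
  proof (rule sum.mono_neutral_right)
    show "\<forall>p\<in>?T - ?h ` (S \<times> S \<times> S). (case p of (x, y, z) \<Rightarrow> a x * b y * c z * mm x y z) = 0"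
      by (force simp: mm_def)
  qed (use assms in auto)
  also have "\<dots> = (\<Sum>(i, j, k)\<in>S \<times> S \<times> S. a (i, j) * b (j, k) * c (k, i))"
    by (subst sum.reindex) (auto simp: inj_on_def mm_def intro!: sum.cong)
  also have "\<dots> = (\<Sum>i\<in>S. \<Sum>j\<in>S. \<Sum>k\<in>S. a (i, j) * b (j, k) * c (k, i))"
    by (simp only: sum.cartesian_product split_def)
  finally show ?thesis .
qed

text \<open>A tensor in triangle form is a matrix multiplication into which linear forms have been
  substituted, with \<open>S\<close> as the common range of its three indices.\<close>

lemma rank_le_triangle:
  assumes "finite S"
    and eq: "\<And>x y z. x \<in> X \<Longrightarrow> y \<in> Y \<Longrightarrow> z \<in> Z \<Longrightarrow>
      t x y z = (\<Sum>i\<in>S. \<Sum>j\<in>S. \<Sum>k\<in>S. \<alpha> (i, j) x * \<beta> (j, k) y * \<gamma> (k, i) z)"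
  shows "rank_le (mmrank (card S)) X Y Z t"
proof -
  have "rank_le (mmrank (card S)) (S \<times> S) (S \<times> S) (S \<times> S) mm"
    using mm_rank_le_mmrank[OF assms(1) refl] by (simp add: mm_rank_le_def)
  then show ?thesis
  proof (rule rank_le_restrict[where A = "S \<times> S" and B = "S \<times> S" and C = "S \<times> S" and \<alpha> = \<alpha> and \<beta> = \<beta> and \<gamma> = \<gamma>
        and f = "\<lambda>l _. l" and g = "\<lambda>l _. l" and h = "\<lambda>l _. l"])
    show "t x y z = (\<Sum>l\<in>S \<times> S. \<Sum>m\<in>S \<times> S. \<Sum>n\<in>S \<times> S. \<alpha> l x * \<beta> m y * \<gamma> n z * mm l m n)"
      if "x \<in> X" "y \<in> Y" "z \<in> Z" for x y z
      using eq[OF that] sum_mm_triangle[OF assms(1), of "\<lambda>l. \<alpha> l x" "\<lambda>m. \<beta> m y" "\<lambda>n. \<gamma> n z"] by simp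
  qed auto
qed

text \<open>Distributing the product over \<open>P\<close> gives one term for every choice
  \<open>\<kappa>\<close> of a class at each position. A tensor product of matrix multiplications is
  a single one whose indices are functions on \<open>P\<close> and whose size is the product of the
  dimensions; distributing once more for each of the three indices brings it to triangle
  form.\<close>

lemma group_power_rank_le:
  fixes G :: "('a, 'b) monoid_scheme" and P :: "'p set"
  assumes "group G" "finite (carrier G)" "finite P"
  defines "X \<equiv> {x. \<forall>p\<in>P. x p \<in> carrier G}"
  shows "rank_le (\<Sum>\<kappa>\<in>P \<rightarrow>\<^sub>E irreducible_classes G. mmrank (\<Prod>p\<in>P. class_dim (\<kappa> p))) X X X
    (\<lambda>x y z. \<Prod>p\<in>P. of_bool (x p \<otimes>\<^bsub>G\<^esub> y p \<otimes>\<^bsub>G\<^esub> z p = \<one>\<^bsub>G\<^esub>))"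
proof -
  let ?K = "irreducible_classes G"
  have finK: "finite ?K"
    by (rule finite_irreducible_classes[OF assms(1,2)])
  obtain \<alpha> \<beta> \<gamma> where dec: "\<forall>x\<in>carrier G. \<forall>y\<in>carrier G. \<forall>z\<in>carrier G.
    of_bool (x \<otimes>\<^bsub>G\<^esub> y \<otimes>\<^bsub>G\<^esub> z = \<one>\<^bsub>G\<^esub>) =
      (\<Sum>X\<in>?K. \<Sum>p<class_dim X. \<Sum>q<class_dim X. \<Sum>r<class_dim X.
         \<alpha> X p q x * \<beta> X q r y * (\<gamma> X r p z :: complex))"
    using group_tensor_decomposition[OF assms(1,2)] by (elim exE)
  define T where "T X x y z = (\<Sum>i<class_dim X. \<Sum>j<class_dim X. \<Sum>k<class_dim X.
      \<alpha> X i j x * \<beta> X j k y * \<gamma> X k i z)" for X x y z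
  have "rank_le (mmrank (\<Prod>p\<in>P. class_dim (\<kappa> p))) X X X (\<lambda>x y z. \<Prod>p\<in>P. T (\<kappa> p) (x p) (y p) (z p))"
    for \<kappa> :: "'p \<Rightarrow> (nat \<times> ('a \<Rightarrow> complex mat)) set"
  proof -
    let ?S = "\<Pi>\<^sub>E p\<in>P. {..<class_dim (\<kappa> p)}"
    have fin: "finite ?S"
      using assms(3) by (intro finite_PiE) auto
    have card: "card ?S = (\<Prod>p\<in>P. class_dim (\<kappa> p))"
      using assms(3) by (simp add: card_PiE)
    have "rank_le (mmrank (card ?S)) X X X (\<lambda>x y z. \<Prod>p\<in>P. T (\<kappa> p) (x p) (y p) (z p))"
    proof (rule rank_le_triangle[OF fin, where \<alpha> = "\<lambda>(i, j) x. \<Prod>p\<in>P. \<alpha> (\<kappa> p) (i p) (j p) (x p)"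
          and \<beta> = "\<lambda>(i, j) x. \<Prod>p\<in>P. \<beta> (\<kappa> p) (i p) (j p) (x p)"
          and \<gamma> = "\<lambda>(i, j) x. \<Prod>p\<in>P. \<gamma> (\<kappa> p) (i p) (j p) (x p)"])
      fix x y z
      have "(\<Prod>p\<in>P. T (\<kappa> p) (x p) (y p) (z p)) = (\<Sum>i\<in>?S. \<Prod>p\<in>P. \<Sum>j<class_dim (\<kappa> p). \<Sum>k<class_dim (\<kappa> p).
          \<alpha> (\<kappa> p) (i p) j (x p) * \<beta> (\<kappa> p) j k (y p) * \<gamma> (\<kappa> p) k (i p) (z p))"
        unfolding T_def using assms(3) by (intro prod_sum_PiE) auto
      also have "\<dots> = (\<Sum>i\<in>?S. \<Sum>j\<in>?S. \<Prod>p\<in>P. \<Sum>k<class_dim (\<kappa> p).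
          \<alpha> (\<kappa> p) (i p) (j p) (x p) * \<beta> (\<kappa> p) (j p) k (y p) * \<gamma> (\<kappa> p) k (i p) (z p))"
        using assms(3) by (intro sum.cong refl prod_sum_PiE) auto
      also have "\<dots> = (\<Sum>i\<in>?S. \<Sum>j\<in>?S. \<Sum>k\<in>?S. \<Prod>p\<in>P.
          \<alpha> (\<kappa> p) (i p) (j p) (x p) * \<beta> (\<kappa> p) (j p) (k p) (y p) * \<gamma> (\<kappa> p) (k p) (i p) (z p))"
        using assms(3) by (intro sum.cong refl prod_sum_PiE) auto
      finally show "(\<Prod>p\<in>P. T (\<kappa> p) (x p) (y p) (z p)) = (\<Sum>i\<in>?S. \<Sum>j\<in>?S. \<Sum>k\<in>?S.
          (case (i, j) of (i, j) \<Rightarrow> \<lambda>x. \<Prod>p\<in>P. \<alpha> (\<kappa> p) (i p) (j p) (x p)) x *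
          (case (j, k) of (i, j) \<Rightarrow> \<lambda>x. \<Prod>p\<in>P. \<beta> (\<kappa> p) (i p) (j p) (x p)) y *
          (case (k, i) of (i, j) \<Rightarrow> \<lambda>x. \<Prod>p\<in>P. \<gamma> (\<kappa> p) (i p) (j p) (x p)) z)"
        by (simp add: prod.distrib)
    qed
    then show ?thesis
      by (simp only: card)
  qed
  then have "rank_le (\<Sum>\<kappa>\<in>P \<rightarrow>\<^sub>E ?K. mmrank (\<Prod>p\<in>P. class_dim (\<kappa> p))) X X X
      (\<lambda>x y z. \<Sum>\<kappa>\<in>P \<rightarrow>\<^sub>E ?K. \<Prod>p\<in>P. T (\<kappa> p) (x p) (y p) (z p))"
    using assms(3) finK by (intro rank_le_sum finite_PiE) auto
  then show ?thesis
  proof (rule rank_le_pullback[where f = id and g = id and h = id])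
    fix x y z assume xyz: "x \<in> X" "y \<in> X" "z \<in> X"
    have "(\<Prod>p\<in>P. of_bool (x p \<otimes>\<^bsub>G\<^esub> y p \<otimes>\<^bsub>G\<^esub> z p = \<one>\<^bsub>G\<^esub>)) = (\<Prod>p\<in>P. \<Sum>X\<in>?K. T X (x p) (y p) (z p))"
      using xyz dec by (intro prod.cong refl) (simp add: T_def X_def)
    also have "\<dots> = (\<Sum>\<kappa>\<in>P \<rightarrow>\<^sub>E ?K. \<Prod>p\<in>P. T (\<kappa> p) (x p) (y p) (z p))"
      using assms(3) finK by (intro prod_sum_PiE) auto
    finally show "(\<Prod>p\<in>P. of_bool (x p \<otimes>\<^bsub>G\<^esub> y p \<otimes>\<^bsub>G\<^esub> z p = \<one>\<^bsub>G\<^esub>)) =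
        (\<Sum>\<kappa>\<in>P \<rightarrow>\<^sub>E ?K. \<Prod>p\<in>P. T (\<kappa> p) (id x p) (id y p) (id z p))"
      by simp
  qed auto
qed

section \<open>Powers of a simultaneous triple product family\<close>

text \<open>Both clauses of the simultaneous triple product property in one implication, regrouped
  into the quotients that will stand for matrix entries. The parameter \<open>s\<close> rotates the
  roles of the three sets.\<close>

definition cyclic_stpp :: "('a, 'b) monoid_scheme \<Rightarrow> 'i set \<Rightarrow> (nat \<Rightarrow> 'i \<Rightarrow> 'a set) \<Rightarrow> bool" where
  "cyclic_stpp G I S \<longleftrightarrow>
     (\<forall>s<3. \<forall>i\<in>I. \<forall>j\<in>I. \<forall>k\<in>I. \<forall>a\<in>S s i. \<forall>a'\<in>S s j. \<forall>b\<in>S (s + 1) j. \<forall>b'\<in>S (s + 1) k.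
        \<forall>c\<in>S (s + 2) k. \<forall>c'\<in>S (s + 2) i.
          (inv\<^bsub>G\<^esub> a' \<otimes>\<^bsub>G\<^esub> b) \<otimes>\<^bsub>G\<^esub> (inv\<^bsub>G\<^esub> b' \<otimes>\<^bsub>G\<^esub> c) \<otimes>\<^bsub>G\<^esub> (inv\<^bsub>G\<^esub> c' \<otimes>\<^bsub>G\<^esub> a) = \<one>\<^bsub>G\<^esub> \<longrightarrow>
          i = j \<and> j = k \<and> a = a' \<and> b = b' \<and> c = c')"

lemma (in group) triple_cancel:
  assumes "a \<in> carrier G" "b \<in> carrier G" "c \<in> carrier G"
  shows "(inv a \<otimes> b) \<otimes> (inv b \<otimes> c) \<otimes> (inv c \<otimes> a) = \<one>"
proof -
  have "(inv a \<otimes> b) \<otimes> (inv b \<otimes> c) = inv a \<otimes> (b \<otimes> inv b) \<otimes> c"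
    using assms by (simp only: m_assoc inv_closed m_closed)
  also have "\<dots> = inv a \<otimes> c"
    using assms by simp
  finally have "(inv a \<otimes> b) \<otimes> (inv b \<otimes> c) \<otimes> (inv c \<otimes> a) = inv a \<otimes> (c \<otimes> inv c) \<otimes> a"
    using assms by (simp only: m_assoc inv_closed m_closed)
  then show ?thesis
    using assms by simp
qed

lemma (in group) mult_rotate_eq_one:
  assumes "x \<in> carrier G" "y \<in> carrier G" "z \<in> carrier G"
  shows "x \<otimes> y \<otimes> z = \<one> \<longleftrightarrow> y \<otimes> z \<otimes> x = \<one>"
proof -
  have "x \<otimes> y \<otimes> z = \<one> \<longleftrightarrow> x \<otimes> (y \<otimes> z) = \<one>"
    using assms by (simp add: m_assoc)
  also have "\<dots> \<longleftrightarrow> y \<otimes> z \<otimes> x = \<one>"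
    using assms inv_comm by blast
  finally show ?thesis .
qed

text \<open>Moving \<open>a\<close> to the front conjugates the regrouped product into the defining
  one. Condition (ii) equates the indices; only then do the quotients belong to a single index,
  where the triple product property applies.\<close>

lemma (in group) stpp_imp:
  assumes stpp: "simultaneous_triple_product_property G n A B C"
    and sub: "\<And>i. i \<in> {1..n} \<Longrightarrow> A i \<subseteq> carrier G \<and> B i \<subseteq> carrier G \<and> C i \<subseteq> carrier G"
    and I: "i \<in> {1..n}" "j \<in> {1..n}" "k \<in> {1..n}"
    and mem: "a \<in> A i" "a' \<in> A j" "b \<in> B j" "b' \<in> B k" "c \<in> C k" "c' \<in> C i"
    and one: "(inv a' \<otimes> b) \<otimes> (inv b' \<otimes> c) \<otimes> (inv c' \<otimes> a) = \<one>"
  shows "i = j \<and> j = k \<and> a = a' \<and> b = b' \<and> c = c'"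
proof -
  have car: "a \<in> carrier G" "a' \<in> carrier G" "b \<in> carrier G" "b' \<in> carrier G" "c \<in> carrier G" "c' \<in> carrier G"
    using sub I mem by blast+
  have "(inv a' \<otimes> b \<otimes> inv b' \<otimes> c \<otimes> inv c') \<otimes> a = \<one>"
    using one car by (simp add: m_assoc)
  then have "a \<otimes> (inv a' \<otimes> b \<otimes> inv b' \<otimes> c \<otimes> inv c') = \<one>"
    using car inv_comm by blast
  then have prod: "a \<otimes> inv a' \<otimes> b \<otimes> inv b' \<otimes> c \<otimes> inv c' = \<one>"
    using car by (simp add: m_assoc)
  then have eq: "i = j \<and> j = k"
    using stpp I mem unfolding simultaneous_triple_product_property_def by blast
  have "a \<otimes> inv a' \<in> quotient_set G (A i)" "b \<otimes> inv b' \<in> quotient_set G (B i)" "c \<otimes> inv c' \<in> quotient_set G (C i)"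
    using mem eq unfolding quotient_set_def by blast+
  moreover have "(a \<otimes> inv a') \<otimes> (b \<otimes> inv b') \<otimes> (c \<otimes> inv c') = \<one>"
    using prod car by (simp add: m_assoc)
  moreover have "triple_product_property G (A i) (B i) (C i)"
    using stpp I(1) unfolding simultaneous_triple_product_property_def by blast
  ultimately have "a \<otimes> inv a' = \<one>" "b \<otimes> inv b' = \<one>" "c \<otimes> inv c' = \<one>"
    unfolding triple_product_property_def by blast+
  then show ?thesis
    using eq car inv_equality inv_inv by (metis inv_closed)
qed

text \<open>A product of three elements is the identity exactly when its cyclic rotations are, so
  the rotated cases reduce to the unrotated one.\<close>

lemma stpp_imp_cyclic:
  assumes "group G" and stpp: "simultaneous_triple_product_property G n A B C"
    and sub: "\<And>i. i \<in> {1..n} \<Longrightarrow> A i \<subseteq> carrier G \<and> B i \<subseteq> carrier G \<and> C i \<subseteq> carrier G"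
    and "I \<subseteq> {1..n}"
  shows "cyclic_stpp G I (\<lambda>s. if s mod 3 = 0 then A else if s mod 3 = 1 then B else C)"
    (is "cyclic_stpp G I ?S")
proof -
  interpret group G by fact
  note imp = stpp_imp[OF stpp sub]
  have A: "?S 0 = A" "?S 3 = A" and B: "?S 1 = B" "?S 4 = B" and C: "?S 2 = C"
    by simp_all
  show ?thesis
    unfolding cyclic_stpp_def
  proof (intro allI impI ballI)
    fix s i j k a a' b b' c c'
    assume s: "s < 3" and ijk: "i \<in> I" "j \<in> I" "k \<in> I"
      and mem: "a \<in> ?S s i" "a' \<in> ?S s j" "b \<in> ?S (s + 1) j" "b' \<in> ?S (s + 1) k" "c \<in> ?S (s + 2) k" "c' \<in> ?S (s + 2) i"
      and one: "(inv\<^bsub>G\<^esub> a' \<otimes>\<^bsub>G\<^esub> b) \<otimes>\<^bsub>G\<^esub> (inv\<^bsub>G\<^esub> b' \<otimes>\<^bsub>G\<^esub> c) \<otimes>\<^bsub>G\<^esub> (inv\<^bsub>G\<^esub> c' \<otimes>\<^bsub>G\<^esub> a) = \<one>\<^bsub>G\<^esub>"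
    have I: "i \<in> {1..n}" "j \<in> {1..n}" "k \<in> {1..n}"
      using ijk assms(4) by blast+
    have S: "?S t l \<subseteq> carrier G" if "l \<in> {1..n}" for t l
      using sub[OF that] by simp
    have car: "a \<in> carrier G" "a' \<in> carrier G" "b \<in> carrier G" "b' \<in> carrier G" "c \<in> carrier G" "c' \<in> carrier G"
      using S I mem by blast+
    have rot: "(inv\<^bsub>G\<^esub> b' \<otimes>\<^bsub>G\<^esub> c) \<otimes>\<^bsub>G\<^esub> (inv\<^bsub>G\<^esub> c' \<otimes>\<^bsub>G\<^esub> a) \<otimes>\<^bsub>G\<^esub> (inv\<^bsub>G\<^esub> a' \<otimes>\<^bsub>G\<^esub> b) = \<one>\<^bsub>G\<^esub>"
      using one mult_rotate_eq_one[of "inv\<^bsub>G\<^esub> a' \<otimes>\<^bsub>G\<^esub> b" "inv\<^bsub>G\<^esub> b' \<otimes>\<^bsub>G\<^esub> c" "inv\<^bsub>G\<^esub> c' \<otimes>\<^bsub>G\<^esub> a"] car by simp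
    have rot2: "(inv\<^bsub>G\<^esub> c' \<otimes>\<^bsub>G\<^esub> a) \<otimes>\<^bsub>G\<^esub> (inv\<^bsub>G\<^esub> a' \<otimes>\<^bsub>G\<^esub> b) \<otimes>\<^bsub>G\<^esub> (inv\<^bsub>G\<^esub> b' \<otimes>\<^bsub>G\<^esub> c) = \<one>\<^bsub>G\<^esub>"
      using rot mult_rotate_eq_one[of "inv\<^bsub>G\<^esub> b' \<otimes>\<^bsub>G\<^esub> c" "inv\<^bsub>G\<^esub> c' \<otimes>\<^bsub>G\<^esub> a" "inv\<^bsub>G\<^esub> a' \<otimes>\<^bsub>G\<^esub> b"] car by simp
    consider "s = 0" | "s = 1" | "s = 2"
      using s by linarith
    then show "i = j \<and> j = k \<and> a = a' \<and> b = b' \<and> c = c'"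
    proof cases
      case 1
      have m: "a \<in> A i" "a' \<in> A j" "b \<in> B j" "b' \<in> B k" "c \<in> C k" "c' \<in> C i"
        using mem 1 by simp_all
      show ?thesis
        by (rule imp[OF _ I m one])
    next
      case 2
      have m: "c \<in> A k" "c' \<in> A i" "a \<in> B i" "a' \<in> B j" "b \<in> C j" "b' \<in> C k"
        using mem 2 by simp_all
      show ?thesis
        using imp[OF _ I(3,1,2) m rot2] by blast
    next
      case 3
      have m: "b \<in> A j" "b' \<in> A k" "c \<in> B k" "c' \<in> B i" "a \<in> C i" "a' \<in> C j"
        using mem 3 by simp_all
      show ?thesis
        using imp[OF _ I(2,3,1) m rot] by blast
    qed
  qed
qed

text \<open>Position \<open>(s, t)\<close> is coordinate t of the s-th of three copies of the m-th
  power, in which the sets are rotated by s. A summand is a triple of sequences from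
  \<open>F\<close>, and a matrix entry is represented in every coordinate by a quotient of two row
  elements. Coordinatewise the property says that three such quotients multiply to the identity
  exactly when the summands agree and adjacent indices match, so the direct sum is a pullback of a
  power of the group tensor.\<close>

lemma power_realization:
  fixes G :: "('a, 'b) monoid_scheme" and S :: "nat \<Rightarrow> 'i \<Rightarrow> 'a set" and F :: "(nat \<Rightarrow> 'i) set" and m :: nat
  assumes "group G" "finite (carrier G)" and cyc: "cyclic_stpp G I S"
    and sub: "\<And>s i. i \<in> I \<Longrightarrow> S s i \<subseteq> carrier G" and periodic: "\<And>s i. S (s + 3) i = S s i"
    and F: "F \<subseteq> {..<m} \<rightarrow>\<^sub>E I" and val: "\<And>f s. f \<in> F \<Longrightarrow> s < 3 \<Longrightarrow> (\<Prod>t<m. card (S s (f t))) = v s"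
  defines "P \<equiv> {..<3::nat} \<times> {..<m}"
  shows "mm_sum_rank_le (\<Sum>\<kappa>\<in>P \<rightarrow>\<^sub>E irreducible_classes G. mmrank (\<Prod>p\<in>P. class_dim (\<kappa> p)))
    ({..<3::nat} \<rightarrow>\<^sub>E F) (v 0 * v 1 * v 2)"
proof -
  interpret group G by fact
  define q where "q = v 0 * v 1 * v 2"
  \<comment> \<open>The values 0, 1, 2 of \<open>e\<close> select the sets in the roles of A, B and
    C; the elements of \<open>Row e \<phi>\<close> serve as matrix indices in the summand
    \<open>\<phi>\<close>.\<close>
  define Row where "Row e \<phi> = (\<Pi>\<^sub>E p\<in>P. S (fst p + e) (\<phi> (fst p) (snd p)))" for e and \<phi> :: "nat \<Rightarrow> nat \<Rightarrow> 'i"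
  have finP: "finite P"
    by (simp add: P_def)
  have \<phi>I: "\<phi> (fst p) (snd p) \<in> I" if "\<phi> \<in> {..<3} \<rightarrow>\<^sub>E F" "p \<in> P" for \<phi> p
  proof -
    have p: "fst p \<in> {..<3}" "snd p \<in> {..<m}"
      using that(2) by (simp_all add: P_def mem_Times_iff)
    show ?thesis
      by (rule PiE_mem[OF subsetD[OF F PiE_mem[OF that(1) p(1)]] p(2)])
  qed
  have ex: "\<exists>h. bij_betw h {..<q} (Row e \<phi>)" if \<phi>: "\<phi> \<in> {..<3} \<rightarrow>\<^sub>E F" and e: "e < 3" for e \<phi>
  proof -
    have "finite (S (fst p + e) (\<phi> (fst p) (snd p)))" if "p \<in> P" for p
      by (rule finite_subset[OF sub[OF \<phi>I[OF \<phi> that]] assms(2)])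
    then have "finite (Row e \<phi>)"
      unfolding Row_def using finP by (intro finite_PiE) auto
    moreover have "card (Row e \<phi>) = q"
    proof -
      have "card (Row e \<phi>) = (\<Prod>s<3. \<Prod>t<m. card (S (s + e) (\<phi> s t)))"
        unfolding Row_def using finP by (simp add: card_PiE P_def prod.cartesian_product split_def)
      \<comment> \<open>Over the three rotations each of \<open>v 0\<close>, \<open>v 1\<close>,
        \<open>v 2\<close> occurs once, whatever \<open>e\<close> is. So all three index sets have
        size \<open>q\<close> and the products become square.\<close>
      also have "\<dots> = (\<Prod>s<3. v ((s + e) mod 3))"
      proof (rule prod.cong[OF refl])
        fix s :: nat assume "s \<in> {..<3}"
        then have s: "s < 3" "\<phi> s \<in> F"
          using PiE_mem[OF \<phi>, of s] by simp_all
        have "S (s + e) i = S ((s + e) mod 3) i" for i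
        proof (cases "s + e < 3")
          case False
          have "s + e = (s + e - 3) + 3" "(s + e) mod 3 = s + e - 3"
            using False s(1) e by (simp_all add: mod_if)
          then show ?thesis
            using periodic[of "s + e - 3" i] by simp
        qed simp
        then show "(\<Prod>t<m. card (S (s + e) (\<phi> s t))) = v ((s + e) mod 3)"
          using val[OF s(2), of "(s + e) mod 3"] by simp
      qed
      also have "\<dots> = q"
      proof -
        have three: "{..<3::nat} = {0, 1, 2}"
          by auto
        have mod: "(1 + 2) mod 3 = (0::nat)" "(2 + 1) mod 3 = (0::nat)" "(2 + 2) mod 3 = (1::nat)"
          by simp_all
        consider "e = 0" | "e = 1" | "e = 2"
          using e by linarith
        then show ?thesis
          by cases (simp_all add: three q_def mod mult_ac flip: numeral_2_eq_2)
      qed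
      finally show ?thesis .
    qed
    ultimately show ?thesis
      using ex_bij_betw_nat_finite[of "Row e \<phi>"] by (simp add: atLeast0LessThan)
  qed
  \<comment> \<open>A numbering of each row gives all summands the common index set
    \<open>{..<q}\<close> that \<open>mm_sum_rank_le\<close> expects.\<close>
  define h where "h e \<phi> = (SOME h. bij_betw h {..<q} (Row e \<phi>))" for e \<phi>
  have h: "bij_betw (h e \<phi>) {..<q} (Row e \<phi>)" if "\<phi> \<in> {..<3} \<rightarrow>\<^sub>E F" "e < 3" for e \<phi>
    unfolding h_def by (rule someI_ex[OF ex[OF that]])
  have h_mem: "h e \<phi> i p \<in> S (fst p + e) (\<phi> (fst p) (snd p))"
    if "\<phi> \<in> {..<3} \<rightarrow>\<^sub>E F" "e < 3" "i < q" "p \<in> P" for e \<phi> i p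
  proof -
    have "h e \<phi> i \<in> Row e \<phi>"
      using bij_betwE[OF h[OF that(1,2)]] that(3) by blast
    then show ?thesis
      using that(4) unfolding Row_def by (rule PiE_mem)
  qed
  have h_inj: "i = j" if "\<phi> \<in> {..<3} \<rightarrow>\<^sub>E F" "e < 3" "i < q" "j < q" "\<And>p. p \<in> P \<Longrightarrow> h e \<phi> i p = h e \<phi> j p" for e \<phi> i j
  proof -
    have "h e \<phi> i \<in> Row e \<phi>" "h e \<phi> j \<in> Row e \<phi>"
      using bij_betwE[OF h[OF that(1,2)]] that(3,4) by blast+
    then have "h e \<phi> i = h e \<phi> j"
      unfolding Row_def by (rule PiE_ext) (rule that(5))
    then show ?thesis
      using inj_onD[OF bij_betw_imp_inj_on[OF h[OF that(1,2)]]] that(3,4) by simp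
  qed
  have h_car: "h e \<phi> i p \<in> carrier G"
    if "\<phi> \<in> {..<3} \<rightarrow>\<^sub>E F" "e < 3" "i < q" "p \<in> P" for e \<phi> i p
    using h_mem[OF that] sub[OF \<phi>I[OF that(1,4)]] by blast
  define emb where "emb e e' x = (\<lambda>p. inv\<^bsub>G\<^esub> (h e (fst x) (fst (snd x)) p) \<otimes>\<^bsub>G\<^esub> h e' (fst x) (snd (snd x)) p)"
    for e e' and x :: "(nat \<Rightarrow> nat \<Rightarrow> 'i) \<times> (nat \<times> nat)"
  let ?Q = "({..<3::nat} \<rightarrow>\<^sub>E F) \<times> ({..<q} \<times> {..<q})"
  have emb_car: "emb e e' x p \<in> carrier G" if "x \<in> ?Q" "e < 3" "e' < 3" "p \<in> P" for e e' x p
  proof -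
    have "fst x \<in> {..<3} \<rightarrow>\<^sub>E F" "fst (snd x) < q" "snd (snd x) < q"
      using that(1) by (simp_all add: mem_Times_iff)
    then show ?thesis
      unfolding emb_def using that by (intro m_closed inv_closed h_car)
  qed
  have "rank_le (\<Sum>\<kappa>\<in>P \<rightarrow>\<^sub>E irreducible_classes G. mmrank (\<Prod>p\<in>P. class_dim (\<kappa> p))) ?Q ?Q ?Q mm_sum"
  proof (rule rank_le_pullback[OF group_power_rank_le[OF assms(1,2) finP],
        where f = "emb 0 1" and g = "emb 1 2" and h = "emb 2 0"])
    fix x y z assume xyz: "x \<in> ?Q" "y \<in> ?Q" "z \<in> ?Q"
    obtain \<phi> i j where x: "x = (\<phi>, (i, j))" "\<phi> \<in> {..<3} \<rightarrow>\<^sub>E F" "i < q" "j < q"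
      using xyz(1) by (cases x) auto
    obtain \<phi>' j' k where y: "y = (\<phi>', (j', k))" "\<phi>' \<in> {..<3} \<rightarrow>\<^sub>E F" "j' < q" "k < q"
      using xyz(2) by (cases y) auto
    obtain \<phi>'' k' i' where z: "z = (\<phi>'', (k', i'))" "\<phi>'' \<in> {..<3} \<rightarrow>\<^sub>E F" "k' < q" "i' < q"
      using xyz(3) by (cases z) auto
    have iff: "(\<forall>p\<in>P. emb 0 1 x p \<otimes>\<^bsub>G\<^esub> emb 1 2 y p \<otimes>\<^bsub>G\<^esub> emb 2 0 z p = \<one>\<^bsub>G\<^esub>) \<longleftrightarrow>
        \<phi> = \<phi>' \<and> \<phi>' = \<phi>'' \<and> j = j' \<and> k = k' \<and> i' = i" (is "?lhs \<longleftrightarrow> ?rhs")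
    proof
      assume ?rhs
      then show ?lhs
        using x y z h_car triple_cancel unfolding emb_def by simp
    next
      assume lhs: ?lhs
      \<comment> \<open>The indices i, j, k of \<open>cyclic_stpp\<close> are the summands of the
        third, the first and the second argument, in this order.\<close>
      have point: "\<phi>'' (fst p) (snd p) = \<phi> (fst p) (snd p) \<and> \<phi> (fst p) (snd p) = \<phi>' (fst p) (snd p) \<and>
          h 0 \<phi>'' i' p = h 0 \<phi> i p \<and> h 1 \<phi> j p = h 1 \<phi>' j' p \<and> h 2 \<phi>' k p = h 2 \<phi>'' k' p" if p: "p \<in> P" for p
      proof -
        have s: "fst p < 3"
          using p by (auto simp: P_def)
        have one: "(inv\<^bsub>G\<^esub> (h 0 \<phi> i p) \<otimes>\<^bsub>G\<^esub> h 1 \<phi> j p) \<otimes>\<^bsub>G\<^esub> (inv\<^bsub>G\<^esub> (h 1 \<phi>' j' p) \<otimes>\<^bsub>G\<^esub> h 2 \<phi>' k p) \<otimes>\<^bsub>G\<^esub> (inv\<^bsub>G\<^esub> (h 2 \<phi>'' k' p) \<otimes>\<^bsub>G\<^esub> h 0 \<phi>'' i' p) = \<one>\<^bsub>G\<^esub>"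
          using lhs p unfolding emb_def x(1) y(1) z(1) by simp
        show ?thesis
          using cyc[unfolded cyclic_stpp_def, rule_format, OF s \<phi>I[OF z(2) p] \<phi>I[OF x(2) p] \<phi>I[OF y(2) p] _ _ _ _ _ _ one]
            h_mem[OF z(2) _ z(4) p, of 0] h_mem[OF x(2) _ x(3) p, of 0] h_mem[OF x(2) _ x(4) p, of 1]
            h_mem[OF y(2) _ y(3) p, of 1] h_mem[OF y(2) _ y(4) p, of 2] h_mem[OF z(2) _ z(3) p, of 2]
          by simp
      qed
      have eq_if: "\<psi> = \<psi>'" if "\<psi> \<in> {..<3} \<rightarrow>\<^sub>E F" "\<psi>' \<in> {..<3} \<rightarrow>\<^sub>E F" "\<And>p. p \<in> P \<Longrightarrow> \<psi> (fst p) (snd p) = \<psi>' (fst p) (snd p)" for \<psi> \<psi>'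
      proof (rule PiE_ext[OF that(1,2)])
        fix s :: nat assume s: "s \<in> {..<3}"
        then have "\<psi> s \<in> {..<m} \<rightarrow>\<^sub>E I" "\<psi>' s \<in> {..<m} \<rightarrow>\<^sub>E I"
          using subsetD[OF F PiE_mem[OF that(1) s]] subsetD[OF F PiE_mem[OF that(2) s]] by simp_all
        then show "\<psi> s = \<psi>' s"
        proof (rule PiE_ext)
          show "\<psi> s t = \<psi>' s t" if "t \<in> {..<m}" for t
            using \<open>\<And>p. p \<in> P \<Longrightarrow> \<psi> (fst p) (snd p) = \<psi>' (fst p) (snd p)\<close>[of "(s, t)"] s that by (simp add: P_def)
        qed
      qed
      have \<phi>: "\<phi> = \<phi>'" "\<phi>'' = \<phi>"
        using point eq_if[OF x(2) y(2)] eq_if[OF z(2) x(2)] by simp_all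
      have "j = j'"
      proof (rule h_inj[OF x(2) _ x(4) y(3), of 1])
        show "h 1 \<phi> j p = h 1 \<phi> j' p" if "p \<in> P" for p
          using point[OF that] \<phi> by simp
      qed simp
      moreover have "k = k'"
      proof (rule h_inj[OF y(2) _ y(4) z(3), of 2])
        show "h 2 \<phi>' k p = h 2 \<phi>' k' p" if "p \<in> P" for p
          using point[OF that] \<phi> by simp
      qed simp
      moreover have "i' = i"
      proof (rule h_inj[OF z(2) _ z(4) x(3), of 0])
        show "h 0 \<phi>'' i' p = h 0 \<phi>'' i p" if "p \<in> P" for p
          using point[OF that] \<phi> by simp
      qed simp
      ultimately show ?rhs
        using \<phi> by simp
    qed
    show "mm_sum x y z = (\<Prod>p\<in>P. of_bool (emb 0 1 x p \<otimes>\<^bsub>G\<^esub> emb 1 2 y p \<otimes>\<^bsub>G\<^esub> emb 2 0 z p = \<one>\<^bsub>G\<^esub>))"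
    proof (cases "\<forall>p\<in>P. emb 0 1 x p \<otimes>\<^bsub>G\<^esub> emb 1 2 y p \<otimes>\<^bsub>G\<^esub> emb 2 0 z p = \<one>\<^bsub>G\<^esub>")
      case True
      then have "mm_sum x y z = 1"
        using iff x(1) y(1) z(1) by (simp add: mm_sum_def mm_def)
      then show ?thesis
        using True by simp
    next
      case False
      then have "mm_sum x y z = 0"
        using iff x(1) y(1) z(1) by (auto simp: mm_sum_def mm_def)
      then show ?thesis
        using False finP by (auto simp: prod_zero_iff)
    qed
  qed (use emb_car in auto)
  then show ?thesis
    by (simp only: q_def mm_sum_rank_le_def Let_def)
qed

section \<open>The asymptotic inequality\<close>

text \<open>
  The sequences in \<open>I\<close> of length \<open>m\<close> are grouped by the number of occurrences of each
  element; there are at most \<open>(m + 1) ^ card I\<close> groups.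
\<close>

lemma popular_type:
  fixes c :: "nat \<Rightarrow> 'i \<Rightarrow> nat" and \<tau> :: real
  assumes "finite I"
  shows "\<exists>F v. F \<subseteq> {..<m} \<rightarrow>\<^sub>E I \<and> (\<forall>f\<in>F. \<forall>s. (\<Prod>t<m. c s (f t)) = v s) \<and>
    (\<Sum>i\<in>I. real (c 0 i * c 1 i * c 2 i) powr \<tau>) ^ m \<le>
      (real m + 1) ^ card I * (real (card F) * real (v 0 * v 1 * v 2) powr \<tau>)"
proof -
  let ?E = "{..<m} \<rightarrow>\<^sub>E I" and ?M = "I \<rightarrow>\<^sub>E {..m}"
  define w where "w i = real (c 0 i * c 1 i * c 2 i) powr \<tau>" for i
  define type where "type f = (\<lambda>i\<in>I. card {t\<in>{..<m}. f t = i})" for f :: "nat \<Rightarrow> 'i"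
  define F where "F \<mu> = {f\<in>?E. type f = \<mu>}" for \<mu>
  define W where "W \<mu> = (\<Sum>f\<in>F \<mu>. \<Prod>t<m. w (f t))" for \<mu>
  have fin: "finite ?E" "finite ?M"
    using assms by (auto intro: finite_PiE)
  have M: "?M \<noteq> {}" "card ?M = (m + 1) ^ card I"
    using assms by (auto simp: PiE_eq_empty_iff card_PiE)
  have "type f \<in> ?M" for f
    using card_mono[of "{..<m}" "{t\<in>{..<m}. f t = i}" for i] by (auto simp: type_def)
  then have "(\<Sum>\<mu>\<in>?M. W \<mu>) = (\<Sum>f\<in>?E. \<Prod>t<m. w (f t))"
    unfolding W_def F_def using fin by (intro sum.group) auto
  also have "\<dots> = (\<Prod>t<m. \<Sum>i\<in>I. w i)"
    using assms by (intro prod_sum_PiE[symmetric]) auto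
  finally have total: "(\<Sum>\<mu>\<in>?M. W \<mu>) = (\<Sum>i\<in>I. w i) ^ m"
    by simp
  \<comment> \<open>The heaviest group carries at least the average weight. Weighing by
    \<open>w\<close> instead of counting selects the group that matters for the sum in the
    claim.\<close>
  have "Max (W ` ?M) \<in> W ` ?M"
    using fin M by (intro Max_in) auto
  then obtain \<mu> where \<mu>: "W \<mu> = Max (W ` ?M)"
    by (metis imageE)
  have "(\<Sum>\<mu>\<in>?M. W \<mu>) \<le> real (card ?M) * W \<mu>"
    unfolding \<mu> using fin by (intro sum_bounded_above Max_ge) auto
  then have large: "(\<Sum>i\<in>I. w i) ^ m \<le> (real m + 1) ^ card I * W \<mu>"
    by (simp add: total M(2) add.commute)
  \<comment> \<open>A product over the positions depends only on how often each index occurs, so all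
    sequences of type \<open>\<mu>\<close> share it.\<close>
  define v where "v s = (\<Prod>i\<in>I. c s i ^ \<mu> i)" for s
  have val: "(\<Prod>t<m. c s (f t)) = v s" if f: "f \<in> F \<mu>" for f s
  proof -
    have "(\<Prod>t<m. c s (f t)) = (\<Prod>i\<in>I. \<Prod>t\<in>{t\<in>{..<m}. f t = i}. c s (f t))"
      using f assms by (intro prod.group[symmetric]) (auto simp: F_def)
    also have "\<dots> = (\<Prod>i\<in>I. c s i ^ card {t\<in>{..<m}. f t = i})"
      by (intro prod.cong refl) simp
    also have "\<dots> = v s"
    proof -
      have "\<mu> = type f"
        using f by (simp add: F_def)
      then show ?thesis
        by (simp add: v_def type_def)
    qed
    finally show ?thesis .
  qed
  have "(\<Prod>t<m. w (f t)) = real (v 0 * v 1 * v 2) powr \<tau>" if f: "f \<in> F \<mu>" for f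
  proof -
    have "(\<Prod>t<m. w (f t)) = (\<Prod>t<m. real (c 0 (f t) * c 1 (f t) * c 2 (f t))) powr \<tau>"
      unfolding w_def by (rule prod_powr_distrib[symmetric])
    also have "(\<Prod>t<m. real (c 0 (f t) * c 1 (f t) * c 2 (f t))) =
        real ((\<Prod>t<m. c 0 (f t)) * (\<Prod>t<m. c 1 (f t)) * (\<Prod>t<m. c 2 (f t)))"
      by (simp add: prod.distrib)
    also have "\<dots> = real (v 0 * v 1 * v 2)"
      by (simp only: val[OF f])
    finally show ?thesis .
  qed
  then have "W \<mu> = real (card (F \<mu>)) * real (v 0 * v 1 * v 2) powr \<tau>"
    by (simp add: W_def)
  then show ?thesis
    using val large by (intro exI[of _ "F \<mu>"] exI[of _ v]) (simp add: F_def w_def)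
qed

text \<open>A power of the size is multiplicative in \<open>\<kappa>\<close>, so the sum over all
  choices factors into a power of the sum over \<open>K\<close>. The constant is paid once and not
  once per position, since each summand is the rank of a single product.\<close>

lemma sum_mmrank_products_le:
  fixes d :: "'k \<Rightarrow> nat" and P :: "'p set"
  assumes "finite P" "finite K" and d: "\<And>k. k \<in> K \<Longrightarrow> d k \<ge> 1"
    and C: "\<And>m. m \<ge> 1 \<Longrightarrow> real (mmrank m) \<le> C * real m powr \<tau>"
  shows "real (\<Sum>\<kappa>\<in>P \<rightarrow>\<^sub>E K. mmrank (\<Prod>p\<in>P. d (\<kappa> p))) \<le> C * (\<Sum>k\<in>K. real (d k) powr \<tau>) ^ card P"
proof -
  have "real (\<Sum>\<kappa>\<in>P \<rightarrow>\<^sub>E K. mmrank (\<Prod>p\<in>P. d (\<kappa> p))) \<le> (\<Sum>\<kappa>\<in>P \<rightarrow>\<^sub>E K. C * (\<Prod>p\<in>P. real (d (\<kappa> p)) powr \<tau>))"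
    unfolding of_nat_sum
  proof (rule sum_mono)
    fix \<kappa> assume \<kappa>: "\<kappa> \<in> P \<rightarrow>\<^sub>E K"
    then have "(\<Prod>p\<in>P. d (\<kappa> p)) \<ge> 1"
      using d by (intro prod_ge_1) auto
    then have "real (mmrank (\<Prod>p\<in>P. d (\<kappa> p))) \<le> C * real (\<Prod>p\<in>P. d (\<kappa> p)) powr \<tau>"
      by (rule C)
    also have "real (\<Prod>p\<in>P. d (\<kappa> p)) powr \<tau> = (\<Prod>p\<in>P. real (d (\<kappa> p)) powr \<tau>)"
      by (simp add: prod_powr_distrib)
    finally show "real (mmrank (\<Prod>p\<in>P. d (\<kappa> p))) \<le> C * (\<Prod>p\<in>P. real (d (\<kappa> p)) powr \<tau>)" .
  qed
  also have "\<dots> = C * (\<Sum>\<kappa>\<in>P \<rightarrow>\<^sub>E K. \<Prod>p\<in>P. real (d (\<kappa> p)) powr \<tau>)"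
    by (rule sum_distrib_left[symmetric])
  also have "(\<Sum>\<kappa>\<in>P \<rightarrow>\<^sub>E K. \<Prod>p\<in>P. real (d (\<kappa> p)) powr \<tau>) = (\<Prod>p\<in>P. \<Sum>k\<in>K. real (d k) powr \<tau>)"
    using assms(1,2) by (intro prod_sum_PiE[symmetric]) auto
  finally show ?thesis
    by simp
qed

text \<open>The batch bound is compared with the lower bound for the rank of size
  \<open>D * q\<close>. Because \<open>L \<le> D\<close>, the rounding term 1 is at most
  \<open>D powr (\<omega> + \<epsilon>) / L\<close>, which explains \<open>C + 1\<close>; dividing
  by \<open>D powr \<omega>\<close> leaves the loss \<open>D powr \<epsilon>\<close>.\<close>

lemma direct_sum_bound:
  fixes C \<omega> \<epsilon> :: real
  defines "\<omega> \<equiv> matrix_mult_exponent"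
  assumes "\<epsilon> > 0" "C > 0"
    and C: "\<And>m. m \<ge> 1 \<Longrightarrow> real (mmrank m) \<le> C * real m powr (\<omega> + \<epsilon>)"
    and \<Lambda>: "finite \<Lambda>" "card \<Lambda> = L" "L > 0" and "q > 0" and D: "D \<ge> 1" "L \<le> D"
    and rank: "mm_sum_rank_le g \<Lambda> q"
  shows "real L * real q powr \<omega> \<le> (C + 1) * real D powr \<epsilon> * real g"
proof -
  have \<omega>: "\<omega> \<ge> 2"
    unfolding \<omega>_def by (rule matrix_mult_exponent_ge_2)
  have "real (D * q) powr \<omega> \<le> real (mmrank (D * q))"
    unfolding \<omega>_def using D \<open>q > 0\<close> by (intro powr_exponent_le_mmrank) (simp add: Suc_le_eq)
  also have "\<dots> \<le> real ((mmrank D div L + 1) * g)"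
    by (rule of_nat_mono[OF mmrank_le_batches[OF \<Lambda> rank]])
  also have "\<dots> \<le> (real (mmrank D) / real L + 1) * real g"
  proof -
    have "real ((mmrank D div L + 1) * g) = (real (mmrank D div L) + 1) * real g"
      by (simp only: of_nat_mult of_nat_add of_nat_1)
    also have "\<dots> \<le> (real (mmrank D) / real L + 1) * real g"
    proof (rule mult_right_mono)
      show "real (mmrank D div L) + 1 \<le> real (mmrank D) / real L + 1"
        using of_int_floor_le[of "real (mmrank D) / real L"] by (simp add: floor_divide_of_nat_eq)
    qed simp
    finally show ?thesis .
  qed
  also have "\<dots> \<le> ((C + 1) * real D powr (\<omega> + \<epsilon>) / real L) * real g"
  proof (rule mult_right_mono)
    have "real L \<le> real D powr 1"
      using D by simp
    also have "\<dots> \<le> real D powr (\<omega> + \<epsilon>)"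
      using D \<omega> \<open>\<epsilon> > 0\<close> by (intro powr_mono) auto
    finally have "1 \<le> real D powr (\<omega> + \<epsilon>) / real L"
      using \<Lambda>(3) by simp
    moreover have "real (mmrank D) / real L \<le> C * real D powr (\<omega> + \<epsilon>) / real L"
      using C[OF D(1)] by (simp add: divide_right_mono)
    ultimately show "real (mmrank D) / real L + 1 \<le> (C + 1) * real D powr (\<omega> + \<epsilon>) / real L"
      by (simp add: distrib_right add_divide_distrib)
  qed simp
  finally have "real L * (real D powr \<omega> * real q powr \<omega>) \<le> (C + 1) * (real D powr \<omega> * real D powr \<epsilon>) * real g"
    using \<Lambda>(3) by (simp add: powr_mult powr_add field_simps)
  then have "real D powr \<omega> * (real L * real q powr \<omega>) \<le> real D powr \<omega> * ((C + 1) * real D powr \<epsilon> * real g)"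
    by (simp add: mult_ac)
  then show ?thesis
    using D by (simp add: mult_le_cancel_left_pos)
qed

text \<open>The base \<open>card I ^ 3 + 1\<close> comes from the number of summands:
  \<open>card F ^ 3\<close> is at most its m-th power, which therefore serves as the outer size in
  \<open>direct_sum_bound\<close>. The \<open>+ 1\<close> keeps it positive when \<open>I\<close> is
  empty.\<close>

lemma stpp_bound_eps:
  fixes G :: "('a, 'b) monoid_scheme" and S :: "nat \<Rightarrow> 'i \<Rightarrow> 'a set"
  defines "\<omega> \<equiv> matrix_mult_exponent"
  assumes "group G" "finite (carrier G)" and cyc: "cyclic_stpp G I S" and "finite I"
    and sub: "\<And>s i. i \<in> I \<Longrightarrow> S s i \<subseteq> carrier G" and periodic: "\<And>s i. S (s + 3) i = S s i"
    and pos: "\<And>s i. i \<in> I \<Longrightarrow> card (S s i) > 0" and "\<epsilon> > 0"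
  shows "(\<Sum>i\<in>I. real (card (S 0 i) * card (S 1 i) * card (S 2 i)) powr (\<omega> / 3)) ^ 3 \<le>
    real (card I ^ 3 + 1) powr \<epsilon> * (\<Sum>X\<in>irreducible_classes G. real (class_dim X) powr (\<omega> + \<epsilon>)) ^ 3"
    (is "?s ^ 3 \<le> real ?D powr \<epsilon> * ?p ^ 3")
proof -
  obtain C where "C > 0" and "\<forall>m\<ge>1. real (mmrank m) \<le> C * real m powr (\<omega> + \<epsilon>)"
    unfolding \<omega>_def using mmrank_le_powr_exponent[OF \<open>\<epsilon> > 0\<close>] by (elim exE conjE)
  then have C: "real (mmrank m) \<le> C * real m powr (\<omega> + \<epsilon>)" if "m \<ge> 1" for m
    using that by simp
  have s0: "?s \<ge> 0" and p0: "?p \<ge> 0"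
    by (simp_all add: sum_nonneg)
  show ?thesis
  \<comment> \<open>\<open>C + 1\<close> is the loss in \<open>direct_sum_bound\<close> and
    \<open>C\<close> the one in \<open>sum_mmrank_products_le\<close>; the exponent is three times
    \<open>card I\<close> because the pigeonhole loss is cubed.\<close>
  proof (rule le_if_powers_le[where C = "(C + 1) * C" and e = "3 * card I"])
    fix m :: nat
    obtain F v where F: "F \<subseteq> {..<m} \<rightarrow>\<^sub>E I"
      and "\<forall>f\<in>F. \<forall>s. (\<Prod>t<m. card (S s (f t))) = v s"
      and large: "?s ^ m \<le> (real m + 1) ^ card I * (real (card F) * real (v 0 * v 1 * v 2) powr (\<omega> / 3))"
      using popular_type[OF \<open>finite I\<close>, of m "\<lambda>s i. card (S s i)" "\<omega> / 3"] by (elim exE conjE)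
    then have val: "(\<Prod>t<m. card (S s (f t))) = v s" if "f \<in> F" for f s
      using that by simp
    define q where "q = v 0 * v 1 * v 2"
    define \<Lambda> where "\<Lambda> = {..<3::nat} \<rightarrow>\<^sub>E F"
    define P where "P = {..<3::nat} \<times> {..<m}"
    define g where "g = (\<Sum>\<kappa>\<in>P \<rightarrow>\<^sub>E irreducible_classes G. mmrank (\<Prod>p\<in>P. class_dim (\<kappa> p)))"
    have finF: "finite F"
      using F \<open>finite I\<close> by (auto intro: finite_subset finite_PiE)
    have \<Lambda>: "finite \<Lambda>" "card \<Lambda> = card F ^ 3"
      using finF by (auto simp: \<Lambda>_def card_PiE intro: finite_PiE)
    have g: "real g \<le> C * ?p ^ (3 * m)"
    proof -
      have "real g \<le> C * ?p ^ card P"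
        unfolding g_def
        by (rule sum_mmrank_products_le[OF _ finite_irreducible_classes[OF assms(2,3)] class_dim_pos[OF assms(2)] C])
           (auto simp: P_def)
      then show ?thesis
        by (simp add: P_def)
    qed
    have "real (card F ^ 3) * real q powr \<omega> \<le> (C + 1) * real (?D ^ m) powr \<epsilon> * real g"
    proof (cases "F = {}")
      case True
      then show ?thesis
        using \<open>C > 0\<close> by simp
    next
      case False
      then obtain f where f: "f \<in> F"
        by blast
      have "v s > 0" for s
      proof -
        have "0 < (\<Prod>t<m. card (S s (f t)))"
        proof (rule prod_pos)
          show "0 < card (S s (f t))" if "t \<in> {..<m}" for t
            using pos PiE_mem[OF subsetD[OF F f] that] by simp
        qed
        then show ?thesis
          by (simp only: val[OF f])
      qed
      then have "q > 0"
        by (simp add: q_def)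
      moreover have "card F ^ 3 \<le> ?D ^ m"
      proof -
        have "card F \<le> card ({..<m} \<rightarrow>\<^sub>E I)"
          using F \<open>finite I\<close> by (intro card_mono finite_PiE) auto
        then have "card F ^ 3 \<le> (card I ^ m) ^ 3"
          by (intro power_mono) (simp_all add: card_PiE)
        also have "\<dots> = (card I ^ 3) ^ m"
          by (simp flip: power_mult add: mult.commute)
        also have "\<dots> \<le> ?D ^ m"
          by (intro power_mono) auto
        finally show ?thesis .
      qed
      moreover have "mm_sum_rank_le g \<Lambda> q"
        unfolding g_def \<Lambda>_def P_def q_def
        by (rule power_realization[OF assms(2,3) cyc sub periodic F val])
      moreover have "card F ^ 3 > 0"
        using False finF by (simp add: card_gt_0_iff)
      moreover have "?D ^ m \<ge> 1"
        by (rule one_le_power) simp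
      ultimately show ?thesis
        unfolding \<omega>_def by (intro direct_sum_bound[OF \<open>\<epsilon> > 0\<close> \<open>C > 0\<close> C[unfolded \<omega>_def] \<Lambda>])
    qed
    also have "\<dots> \<le> (C + 1) * real (?D ^ m) powr \<epsilon> * (C * ?p ^ (3 * m))"
      using g \<open>C > 0\<close> by (intro mult_left_mono) auto
    finally have bound: "real (card F ^ 3) * real q powr \<omega> \<le> (C + 1) * real (?D ^ m) powr \<epsilon> * (C * ?p ^ (3 * m))" .
    have "(?s ^ 3) ^ m = (?s ^ m) ^ 3"
      by (simp flip: power_mult add: mult.commute)
    also have "\<dots> \<le> ((real m + 1) ^ card I * (real (card F) * real q powr (\<omega> / 3))) ^ 3"
      using large s0 by (intro power_mono) (simp_all add: q_def)
    also have "\<dots> = (real m + 1) ^ (3 * card I) * (real (card F ^ 3) * (real q powr (\<omega> / 3)) ^ 3)"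
      by (simp add: power_mult_distrib power_mult[symmetric] mult.commute)
    also have "(real q powr (\<omega> / 3)) ^ 3 = real q powr \<omega>"
      by (cases "q = 0") (simp_all add: powr_power)
    also have "(real m + 1) ^ (3 * card I) * (real (card F ^ 3) * real q powr \<omega>) \<le>
        (real m + 1) ^ (3 * card I) * ((C + 1) * real (?D ^ m) powr \<epsilon> * (C * ?p ^ (3 * m)))"
      using bound by (intro mult_left_mono) auto
    also have "\<dots> = (C + 1) * C * (real m + 1) ^ (3 * card I) * (real ?D powr \<epsilon> * ?p ^ 3) ^ m"
    proof -
      have "real (?D ^ m) powr \<epsilon> = (real ?D powr \<epsilon>) ^ m"
        by (simp only: powr_power_swap of_nat_0_le_iff of_nat_power)
      moreover have "?p ^ (3 * m) = (?p ^ 3) ^ m"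
        by (rule power_mult)
      ultimately show ?thesis
        by (simp only: power_mult_distrib mult_ac)
    qed
    finally show "(?s ^ 3) ^ m \<le> (C + 1) * C * (real m + 1) ^ (3 * card I) * (real ?D powr \<epsilon> * ?p ^ 3) ^ m" .
  qed (use s0 p0 in auto)
qed

text \<open>Only here does \<open>\<epsilon>\<close> tend to 0: the right side is continuous in it,
  since the base and all dimensions are nonzero.\<close>

lemma stpp_bound:
  fixes G :: "('a, 'b) monoid_scheme" and S :: "nat \<Rightarrow> 'i \<Rightarrow> 'a set"
  defines "\<omega> \<equiv> matrix_mult_exponent"
  assumes "group G" "finite (carrier G)" and cyc: "cyclic_stpp G I S" and "finite I"
    and sub: "\<And>s i. i \<in> I \<Longrightarrow> S s i \<subseteq> carrier G" and periodic: "\<And>s i. S (s + 3) i = S s i"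
    and pos: "\<And>s i. i \<in> I \<Longrightarrow> card (S s i) > 0"
  shows "(\<Sum>i\<in>I. real (card (S 0 i) * card (S 1 i) * card (S 2 i)) powr (\<omega> / 3)) \<le>
    (\<Sum>X\<in>irreducible_classes G. real (class_dim X) powr \<omega>)"
    (is "?s \<le> ?p")
proof -
  let ?D = "real (card I ^ 3 + 1)" and ?K = "irreducible_classes G"
  have dim: "real (class_dim X) \<noteq> 0" if "X \<in> ?K" for X
    using class_dim_pos[OF assms(2) that] by simp
  have D: "?D \<noteq> 0"
    by (simp only: of_nat_eq_0_iff)
  have "((\<lambda>\<epsilon>. ?D powr \<epsilon> * (\<Sum>X\<in>?K. real (class_dim X) powr (\<omega> + \<epsilon>)) ^ 3) \<longlongrightarrow>
      ?D powr 0 * (\<Sum>X\<in>?K. real (class_dim X) powr (\<omega> + 0)) ^ 3) (at_right 0)"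
    by (intro tendsto_intros disjI1 D dim)
  then have lim: "((\<lambda>\<epsilon>. ?D powr \<epsilon> * (\<Sum>X\<in>?K. real (class_dim X) powr (\<omega> + \<epsilon>)) ^ 3) \<longlongrightarrow> ?p ^ 3) (at_right 0)"
    using D by simp
  have "\<forall>\<^sub>F \<epsilon> in at_right 0. ?s ^ 3 \<le> ?D powr \<epsilon> * (\<Sum>X\<in>?K. real (class_dim X) powr (\<omega> + \<epsilon>)) ^ 3"
    using eventually_at_right_less[of "0::real"]
    unfolding \<omega>_def by (rule eventually_mono) (rule stpp_bound_eps[OF assms(2-)])
  then have "?s ^ 3 \<le> ?p ^ 3"
    by (rule tendsto_lowerbound[OF lim]) simp
  then show ?thesis
    using power_mono_iff[of ?s ?p 3] by (simp add: sum_nonneg)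
qed

theorem theorem5p5:
  fixes H :: "('a, 'b) monoid_scheme"
    and n :: nat
    and a b c :: "nat \<Rightarrow> nat"
  assumes "group H"
    and "finite (carrier H)"
    and "simultaneously_realizes H n a b c"
  shows "(\<Sum>i = 1..n. real (a i * b i * c i) powr (matrix_mult_exponent / 3))
           \<le> (\<Sum>d \<in># character_degrees H. real d powr matrix_mult_exponent)"
proof -
  obtain A B C where
    ABC: "\<forall>i\<in>{1..n}. A i \<subseteq> carrier H \<and> B i \<subseteq> carrier H \<and> C i \<subseteq> carrier H \<and>
       card (A i) = a i \<and> card (B i) = b i \<and> card (C i) = c i"
    and stpp: "simultaneous_triple_product_property H n A B C"
    using assms(3) unfolding simultaneously_realizes_def by (elim exE conjE)
  \<comment> \<open>Indices with an empty set contribute a power of 0, which is 0, to the left side.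
    Leaving them out makes all cardinalities positive, as required for \<open>q > 0\<close>.\<close>
  define I where "I = {i\<in>{1..n}. a i * b i * c i > 0}"
  define S where "S s = (if s mod 3 = 0 then A else if s mod 3 = 1 then B else C)" for s :: nat
  have I: "I \<subseteq> {1..n}"
    by (auto simp: I_def)
  have cyc: "cyclic_stpp H I S"
    unfolding S_def by (rule stpp_imp_cyclic[OF assms(1) stpp _ I]) (use ABC in blast)
  have sub: "S s i \<subseteq> carrier H" if "i \<in> I" for s i
    using ABC that I unfolding S_def by auto
  have periodic: "S (s + 3) i = S s i" for s i
    by (simp add: S_def)
  have pos: "card (S s i) > 0" if "i \<in> I" for s i
    using ABC that I unfolding S_def by (auto simp: I_def)
  have "(\<Sum>i\<in>I. real (card (S 0 i) * card (S 1 i) * card (S 2 i)) powr (matrix_mult_exponent / 3)) \<le>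
      (\<Sum>X\<in>irreducible_classes H. real (class_dim X) powr matrix_mult_exponent)"
    by (rule stpp_bound[OF assms(1,2) cyc finite_subset[OF I finite_atLeastAtMost] sub periodic pos])
  also have "(\<Sum>i\<in>I. real (card (S 0 i) * card (S 1 i) * card (S 2 i)) powr (matrix_mult_exponent / 3)) =
      (\<Sum>i\<in>I. real (a i * b i * c i) powr (matrix_mult_exponent / 3))"
    using ABC I by (intro sum.cong refl) (auto simp: S_def)
  also have "\<dots> = (\<Sum>i = 1..n. real (a i * b i * c i) powr (matrix_mult_exponent / 3))"
    by (intro sum.mono_neutral_left) (auto simp: I_def)
  finally show ?thesis
    by (simp only: sum_character_degrees)
qed

end
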